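(* If a finite set of points $Z\subseteq\mathbb{P}^2_{\mathbb{C}}$ has an unexpected curve in degree $d$, then $\mathrm{reg}(Z)\leq d$. In particular, $Z$ imposes independent conditions on forms of degree $d-1$.
   Context: Let $R=\mathbb{C}[X_0,X_1,X_2]$ be the coordinate ring of $\mathbb{P}^2_{\mathbb{C}}$ and let $[M]_d$ be the degree $d$ part of a graded module $M$. $Z$ has (admits) an unexpected curve in degree $d$ if, for a general point $Q\in\mathbb{P}^2$, $$\dim[I(Z)\cap I(Q)^{d-1}]_d>\max\{0,\ \dim[I(Z)]_d-\dim[R/I(Q)^{d-1}]_d\}.$$ The regularity of $Z$ is $\mathrm{reg}(Z)=1+\min\{r:\dim_{\mathbb{C}}[R/I(Z)]_r=|Z|\}$. $Z$ imposes independent conditions on forms of degree $t$ if $\dim_{\mathbb{C}}[R/I(Z)]_t=|Z|$. *)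

theory Defs
  imports "HOL-Analysis.Analysis" "HOL-Library.Poly_Mapping"
begin

section \<open>Dimension of a quotient of vector spaces\<close>

text \<open>
  The finite family of cosets \<open>b + W\<close>, \<open>b \<in> B\<close>, is a basis of the image of \<open>V\<close> in the quotient
  by \<open>W\<close>, that is, of \<open>V / (V \<inter> W)\<close>; everything is expressed through representatives of cosets.
\<close>

definition quotient_basis ::
    "('a::field \<Rightarrow> 'b \<Rightarrow> 'b) \<Rightarrow> 'b::ab_group_add set \<Rightarrow> 'b set \<Rightarrow> 'b set \<Rightarrow> bool"
  where "quotient_basis sc V W B \<longleftrightarrow>
    finite B \<and> B \<subseteq> V \<and>
    (\<forall>c. (\<Sum>b\<in>B. sc (c b) b) \<in> W \<longrightarrow> (\<forall>b\<in>B. c b = 0)) \<and>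
    (\<forall>v\<in>V. \<exists>c. v - (\<Sum>b\<in>B. sc (c b) b) \<in> W)"

definition quotient_dim ::
    "('a::field \<Rightarrow> 'b \<Rightarrow> 'b) \<Rightarrow> 'b::ab_group_add set \<Rightarrow> 'b set \<Rightarrow> nat"
  where "quotient_dim sc V W = card (SOME B. quotient_basis sc V W B)"

text \<open>
  For subspaces \<open>V\<close>, \<open>W\<close> with \<open>V\<close> finite-dimensional such a \<open>B\<close> exists, and its cardinality does not
  depend on the choice.
\<close>

context vector_space
begin

lemma quotient_basis_card:
  assumes V: "subspace V" and W: "subspace W" and F: "finite F" "V \<subseteq> span F"
    and D: "quotient_basis scale V W D"
  shows "card D + dim (V \<inter> W) = dim V"
proof -
  obtain A where A: "A \<subseteq> V \<inter> W" "independent A" "V \<inter> W \<subseteq> span A" "card A = dim (V \<inter> W)"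
    using basis_exists by metis
  have finA: "finite A"
    using independent_span_bound[OF F(1) A(2)] A(1) F(2) by blast
  have finD: "finite D" and DV: "D \<subseteq> V"
    and ind: "\<And>c. (\<Sum>b\<in>D. scale (c b) b) \<in> W \<Longrightarrow> \<forall>b\<in>D. c b = 0"
    and gen: "\<And>v. v \<in> V \<Longrightarrow> \<exists>c. v - (\<Sum>b\<in>D. scale (c b) b) \<in> W"
    using D unfolding quotient_basis_def by auto
  have disj: "A \<inter> D = {}"
  proof (rule ccontr)
    assume "A \<inter> D \<noteq> {}"
    then obtain x where x: "x \<in> A" "x \<in> D" by blast
    have "(\<Sum>b\<in>D. scale (if b = x then 1 else 0) b) = (\<Sum>b\<in>D. if b = x then b else 0)"
      by (rule sum.cong) auto
    also have "\<dots> = x"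
      using x finD by simp
    finally have "(\<Sum>b\<in>D. scale (if b = x then 1 else 0) b) \<in> W"
      using x A(1) by auto
    from ind[OF this] x show False by auto
  qed
  have "independent (A \<union> D)"
  proof (rule independent_if_scalars_zero)
    show "finite (A \<union> D)" using finA finD by simp
    fix c x
    assume s: "(\<Sum>b\<in>A \<union> D. scale (c b) b) = 0" and x: "x \<in> A \<union> D"
    have s': "(\<Sum>b\<in>A. scale (c b) b) + (\<Sum>b\<in>D. scale (c b) b) = 0"
      using s by (simp add: sum.union_disjoint[OF finA finD disj])
    have "(\<Sum>b\<in>A. scale (c b) b) \<in> W"
      using A(1) W by (intro subspace_sum subspace_scale) auto
    then have "(\<Sum>b\<in>D. scale (c b) b) \<in> W"
      using s' subspace_neg[OF W] by (auto simp: add_eq_0_iff)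
    then have D0: "\<forall>b\<in>D. c b = 0" by (rule ind)
    then have "(\<Sum>b\<in>A. scale (c b) b) = 0"
      using s' by simp
    then have "\<forall>b\<in>A. c b = 0"
      using A(2) unfolding dependent_finite[OF finA] by blast
    then show "c x = 0" using D0 x by auto
  qed
  moreover have "V \<subseteq> span (A \<union> D)"
  proof
    fix v assume v: "v \<in> V"
    then obtain c where c: "v - (\<Sum>b\<in>D. scale (c b) b) \<in> W" using gen by blast
    have "(\<Sum>b\<in>D. scale (c b) b) \<in> V"
      using DV V by (intro subspace_sum subspace_scale) auto
    then have "v - (\<Sum>b\<in>D. scale (c b) b) \<in> V \<inter> W"
      using c v V by (auto intro: subspace_diff)
    then have 1: "v - (\<Sum>b\<in>D. scale (c b) b) \<in> span (A \<union> D)"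
      using A(3) span_mono[of A "A \<union> D"] by blast
    have 2: "(\<Sum>b\<in>D. scale (c b) b) \<in> span (A \<union> D)"
      by (intro span_sum span_scale span_base) auto
    show "v \<in> span (A \<union> D)"
      using span_add[OF 1 2] by simp
  qed
  moreover have "A \<union> D \<subseteq> V" using A(1) DV by auto
  ultimately have "card (A \<union> D) = dim V"
    by (intro basis_card_eq_dim)
  then show ?thesis
    using card_Un_disjoint[OF finA finD disj] A(4) by linarith
qed

lemma quotient_basis_exists:
  assumes V: "subspace V" and W: "subspace W" and F: "finite F" "V \<subseteq> span F"
  shows "\<exists>D. quotient_basis scale V W D"
proof -
  obtain A where A: "A \<subseteq> V \<inter> W" "independent A" "V \<inter> W \<subseteq> span A"
    using basis_exists by metis
  obtain B where B: "A \<subseteq> B" "B \<subseteq> V" "independent B" "V \<subseteq> span B"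
    using maximal_independent_subset_extend[of A V] A by auto
  have finB: "finite B"
    using independent_span_bound[OF F(1) B(3)] B(2) F(2) by blast
  have finA: "finite A" using finB B(1) finite_subset by blast
  define D where "D = B - A"
  have finD: "finite D" and DV: "D \<subseteq> V" and disj: "A \<inter> D = {}" and BAD: "B = A \<union> D"
    using finB B unfolding D_def by auto
  have "\<forall>b\<in>D. c b = 0" if "(\<Sum>b\<in>D. scale (c b) b) \<in> W" for c
  proof -
    have "(\<Sum>b\<in>D. scale (c b) b) \<in> V"
      using DV V by (intro subspace_sum subspace_scale) auto
    then have "(\<Sum>b\<in>D. scale (c b) b) \<in> span A"
      using that A(3) by auto
    then obtain u where u: "(\<Sum>b\<in>D. scale (c b) b) = (\<Sum>a\<in>A. scale (u a) a)"
      using span_finite[OF finA] by auto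
    define e where "e b = (if b \<in> A then - u b else c b)" for b
    have "(\<Sum>b\<in>B. scale (e b) b) = (\<Sum>b\<in>A. scale (e b) b) + (\<Sum>b\<in>D. scale (e b) b)"
      unfolding BAD by (rule sum.union_disjoint[OF finA finD disj])
    also have "(\<Sum>b\<in>A. scale (e b) b) = - (\<Sum>a\<in>A. scale (u a) a)"
      by (simp add: e_def sum_negf)
    also have "(\<Sum>b\<in>D. scale (e b) b) = (\<Sum>b\<in>D. scale (c b) b)"
      using disj by (intro sum.cong) (auto simp: e_def)
    finally have "(\<Sum>b\<in>B. scale (e b) b) = 0"
      using u by simp
    then have "\<forall>b\<in>B. e b = 0"
      using B(3) unfolding dependent_finite[OF finB] by blast
    then show ?thesis
      using disj BAD by (auto simp: e_def split: if_splits)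
  qed
  moreover have "\<exists>c. v - (\<Sum>b\<in>D. scale (c b) b) \<in> W" if "v \<in> V" for v
  proof -
    have "v \<in> span B" using that B(4) by auto
    then obtain u where u: "v = (\<Sum>b\<in>B. scale (u b) b)"
      using span_finite[OF finB] by auto
    then have "v - (\<Sum>b\<in>D. scale (u b) b) = (\<Sum>b\<in>A. scale (u b) b)"
      unfolding BAD by (simp add: sum.union_disjoint[OF finA finD disj])
    also have "\<dots> \<in> W"
      using A(1) W by (intro subspace_sum subspace_scale) auto
    finally show ?thesis by blast
  qed
  ultimately have "quotient_basis scale V W D"
    using finD DV unfolding quotient_basis_def by blast
  then show ?thesis by blast
qed

lemma quotient_dim_add:
  assumes "subspace V" "subspace W" "finite F" "V \<subseteq> span F"
  shows "quotient_dim scale V W + dim (V \<inter> W) = dim V"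
  unfolding quotient_dim_def
  using quotient_basis_card[OF assms] someI_ex[OF quotient_basis_exists[OF assms]] by blast

end


section \<open>The projective plane over the complex numbers\<close>

definition proportional :: "complex ^ 3 \<Rightarrow> complex ^ 3 \<Rightarrow> bool"
  where "proportional u v \<longleftrightarrow> u \<noteq> 0 \<and> v \<noteq> 0 \<and> (\<exists>c. c \<noteq> 0 \<and> v = c *s u)"

lemma part_equivp_proportional: "part_equivp proportional"
proof (rule part_equivpI)
  show "\<exists>x. proportional x x"
    by (rule exI[of _ "axis 1 1"]) (auto simp: proportional_def axis_eq_0_iff intro!: exI[of _ 1])
  show "symp proportional"
  proof (rule sympI)
    fix u v assume "proportional u v"
    then obtain c where "u \<noteq> 0" "v \<noteq> 0" "c \<noteq> 0" "v = c *s u"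
      by (auto simp: proportional_def)
    then show "proportional v u"
      unfolding proportional_def by (auto intro!: exI[of _ "inverse c"])
  qed
  show "transp proportional"
  proof (rule transpI)
    fix u v w assume "proportional u v" "proportional v w"
    then obtain c e where "u \<noteq> 0" "w \<noteq> 0" "c \<noteq> 0" "e \<noteq> 0" "w = (e * c) *s u"
      by (auto simp: proportional_def)
    then show "proportional u w"
      unfolding proportional_def by (metis mult_eq_0_iff)
  qed
qed

quotient_type proj_plane = "complex ^ 3" / partial: proportional
  by (rule part_equivp_proportional)

lift_definition homog_coords :: "proj_plane \<Rightarrow> complex ^ 3 \<Rightarrow> bool"
  is proportional
  using part_equivp_proportional unfolding part_equivp_def by blast


section \<open>The polynomial ring in three variables\<close>

text \<open>
  Exponent vectors are finitely supported functions from the index type \<open>3\<close> (elements \<open>0, 1, 2\<close>)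
  to the natural numbers, and polynomials are finitely supported functions from exponent vectors to
  coefficients; multiplication is the convolution product of \<open>Poly_Mapping\<close>.
\<close>

type_synonym poly3 = "(3 \<Rightarrow>\<^sub>0 nat) \<Rightarrow>\<^sub>0 complex"

definition scale_poly :: "complex \<Rightarrow> poly3 \<Rightarrow> poly3"
  where "scale_poly c f = Poly_Mapping.single 0 c * f"

global_interpretation poly3: vector_space scale_poly
  by unfold_locales
    (simp_all add: scale_poly_def algebra_simps single_add mult_single flip: mult.assoc)

text \<open>\<open>poly3\<close> as a module over itself: its submodules are the ideals.\<close>

global_interpretation poly3_ideal: module "(*) :: poly3 \<Rightarrow> poly3 \<Rightarrow> poly3"
  by unfold_locales (simp_all add: algebra_simps)

definition ideal_power :: "poly3 set \<Rightarrow> nat \<Rightarrow> poly3 set"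
  where "ideal_power I n = poly3_ideal.span {\<Prod>i<n. g i |g. \<forall>i<n. g i \<in> I}"

definition eval_poly :: "poly3 \<Rightarrow> complex ^ 3 \<Rightarrow> complex"
  where "eval_poly f v =
    (\<Sum>m\<in>Poly_Mapping.keys f. Poly_Mapping.lookup f m * (\<Prod>i\<in>UNIV. (v $ i) ^ Poly_Mapping.lookup m i))"

definition forms :: "nat \<Rightarrow> poly3 set"
  where "forms d = {f. \<forall>m\<in>Poly_Mapping.keys f. (\<Sum>i\<in>UNIV. Poly_Mapping.lookup m i) = d}"

text \<open>Vanishing for every choice of homogeneous coordinates, so that it makes sense for all polynomials.\<close>

definition vanishes_at :: "poly3 \<Rightarrow> proj_plane \<Rightarrow> bool"
  where "vanishes_at f P \<longleftrightarrow> (\<forall>v. homog_coords P v \<longrightarrow> eval_poly f v = 0)"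

definition vanishing_ideal :: "proj_plane set \<Rightarrow> poly3 set"
  where "vanishing_ideal Z = {f. \<forall>P\<in>Z. vanishes_at f P}"

definition zariski_closed :: "proj_plane set \<Rightarrow> bool"
  where "zariski_closed C \<longleftrightarrow>
    (\<exists>S. S \<subseteq> (\<Union>e. forms e) \<and> C = {P. \<forall>f\<in>S. vanishes_at f P})"

definition zariski_open :: "proj_plane set \<Rightarrow> bool"
  where "zariski_open U \<longleftrightarrow> zariski_closed (- U)"

text \<open>A general point has a property if all points of some nonempty Zariski-open set have it.\<close>

definition for_general_point :: "(proj_plane \<Rightarrow> bool) \<Rightarrow> bool"
  where "for_general_point p \<longleftrightarrow> (\<exists>U. zariski_open U \<and> U \<noteq> {} \<and> (\<forall>Q\<in>U. p Q))"


section \<open>Graded dimensions, unexpected curves, regularity\<close>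

definition graded_dim :: "poly3 set \<Rightarrow> nat \<Rightarrow> nat"
  where "graded_dim J d = poly3.dim (J \<inter> forms d)"

text \<open>The degree \<open>d\<close> part of the quotient ring by \<open>J\<close> is the image of the forms of degree \<open>d\<close>.\<close>

definition graded_quotient_dim :: "poly3 set \<Rightarrow> nat \<Rightarrow> nat"
  where "graded_quotient_dim J d = quotient_dim scale_poly (forms d) J"

text \<open>
  For \<open>d = 0\<close> the truncated exponent \<open>d - 1\<close> is \<open>0\<close>, the power is the whole ring, and the
  inequality is false; the same happens for \<open>d = 1\<close>.
\<close>

definition has_unexpected_curve :: "proj_plane set \<Rightarrow> nat \<Rightarrow> bool"
  where "has_unexpected_curve Z d \<longleftrightarrow> for_general_point (\<lambda>Q.
    int (graded_dim (vanishing_ideal Z \<inter> ideal_power (vanishing_ideal {Q}) (d - 1)) d) >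
    max 0 (int (graded_dim (vanishing_ideal Z) d) -
           int (graded_quotient_dim (ideal_power (vanishing_ideal {Q}) (d - 1)) d)))"

definition imposes_independent_conditions :: "proj_plane set \<Rightarrow> nat \<Rightarrow> bool"
  where "imposes_independent_conditions Z t \<longleftrightarrow>
    graded_quotient_dim (vanishing_ideal Z) t = card Z"

definition regularity :: "proj_plane set \<Rightarrow> nat"
  where "regularity Z =
    1 + (LEAST r. graded_quotient_dim (vanishing_ideal Z) r = card Z)"

end

theory Submission
  imports Defs
    "HOL-Computational_Algebra.Fundamental_Theorem_Algebra"
    "HOL-Computational_Algebra.Polynomial_Factorial"
    "HOL-Computational_Algebra.Field_as_Ring"
begin

text \<open>
  Suppose that a nonzero relation \<open>\<Sum> c\<^sub>i ev\<^sub>i\<close> kills all forms of degree \<open>j = d - 1\<close>. Projecting from a general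
  point \<open>Q\<close> with affine coordinates \<open>(s, w)\<close>, where \<open>Q\<close> is the point at infinity of the \<open>w\<close>-axis, a form
  of degree \<open>e + 1\<close> with multiplicity \<open>e\<close> at \<open>Q\<close> reads \<open>w A(s) + B(s)\<close>. By residues on the line, a relation
  on such forms is again such a curve through the points: if \<open>c\<^sub>i = R(s\<^sub>i)/\<Pi>'(s\<^sub>i)\<close> and
  \<open>c\<^sub>i w\<^sub>i = R\<^sub>1(s\<^sub>i)/\<Pi>'(s\<^sub>i)\<close>, then \<open>w R - R\<^sub>1\<close> vanishes at all points. Unexpectedness thus yields two
  curves, of degrees adding up to \<open>|Z| - 1\<close>, hence one of low degree. A minimal such curve through
  a subset of \<open>Z\<close> (each omitted point lowering the degree by one) has coprime \<open>A\<close> and \<open>B\<close>. If \<open>e = 0\<close>, it is a line,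
  and the forms with a multiple point impose as many conditions as all forms. If \<open>e > 0\<close>, the curve moves with
  \<open>Q\<close>, and its two derivatives with respect to \<open>Q\<close> give curves with leading terms \<open>w\<^sup>2 A'\<close> and
  \<open>w\<^sup>2 (e A - s A')\<close> through the points. Comparing these, modulo \<open>A\<close>, with the residue polynomials of
  \<open>c\<close>, \<open>c w\<close>, \<open>c w\<^sup>2\<close> forces \<open>c = 0\<close>. For the genericity of \<open>Q\<close> it suffices that all ranks are constant in a neighbourhood.
\<close>

section \<open>Univariate polynomials and residues\<close>

text \<open>Two relations are at work. The relation \<open>c\<close> to be refuted is the same for
  all \<open>Q\<close>; unexpectedness supplies, for each \<open>Q\<close>, a relation
  \<open>c0\<close> that kills the forms of degree \<open>j + 1\<close> with multiplicity
  \<open>j\<close> at \<open>Q\<close>, but not all forms of degree \<open>j + 1\<close>. The second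
  curve comes from \<open>c0\<close>, and for \<open>e = 0\<close>, where differentiating the
  constant \<open>A\<close> gives no information, it is \<open>c0\<close> that is contradicted. The
  curves of multiplicities \<open>j\<close> and \<open>card I - 3 - j\<close> give
  \<open>2 * \<kappa> + 3 \<le> card I\<close> for the smaller multiplicity \<open>\<kappa>\<close>.
  The budget \<open>card (I - S) + e \<le> \<kappa>\<close> for omitted points preserves
  \<open>2 * e + 3 \<le> card S\<close>, the bound that makes the final comparison of degrees work.
  The main obstacle is that curves through the points need not vary differentiably with
  \<open>Q\<close>. The equation at one \<open>Q\<close> is therefore carried along unchanged: its
  values on the points leave zero with a velocity that, the rank being constant, is again a vector
  of values of such forms at \<open>Q\<close>. That correction enters the lower terms
  \<open>A1\<close>, \<open>B1\<close>, \<open>A2\<close>, \<open>B2\<close>.\<close>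

lemma linear_factors_dvd:
  fixes s :: "'i \<Rightarrow> complex"
  assumes "finite I" "inj_on s I" "\<And>i. i \<in> I \<Longrightarrow> poly p (s i) = 0"
  shows "(\<Prod>i\<in>I. [:- s i, 1:]) dvd p"
  using assms
proof (induction I arbitrary: p rule: finite_induct)
  case (insert j I)
  have "[:- s j, 1:] dvd p"
    using insert.prems(2)[of j] by (simp add: poly_eq_0_iff_dvd)
  then obtain q where q: "p = [:- s j, 1:] * q" by (rule dvdE)
  have "poly q (s i) = 0" if "i \<in> I" for i
    using insert.prems(2)[of i] insert.prems(1) insert.hyps(2) that
    by (auto simp: q inj_on_def)
  then have "(\<Prod>i\<in>I. [:- s i, 1:]) dvd q"
    using insert.IH insert.prems(1) by auto
  then show ?case
    unfolding q prod.insert[OF insert.hyps] by (intro mult_dvd_mono) auto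
qed simp

lemma degree_linear_factors:
  fixes s :: "'i \<Rightarrow> complex"
  assumes "finite I"
  shows "degree (\<Prod>i\<in>I. [:- s i, 1:]) = card I" "(\<Prod>i\<in>I. [:- s i, 1:]) \<noteq> 0"
proof -
  show nz: "(\<Prod>i\<in>I. [:- s i, 1:]) \<noteq> 0" using assms by (simp add: prod_zero_iff)
  show "degree (\<Prod>i\<in>I. [:- s i, 1:]) = card I"
    using assms
    by (subst degree_prod_sum_eq) (auto)
qed

lemma vanishing_poly_factor:
  fixes s :: "'i \<Rightarrow> complex"
  assumes "finite I" "inj_on s I" "\<And>i. i \<in> I \<Longrightarrow> poly p (s i) = 0" "degree p \<le> m"
  obtains q where "p = (\<Prod>i\<in>I. [:- s i, 1:]) * q" "degree q + card I \<le> m \<or> q = 0"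
proof -
  obtain q where q: "p = (\<Prod>i\<in>I. [:- s i, 1:]) * q"
    using linear_factors_dvd[OF assms(1-3)] by (rule dvdE)
  have "degree q + card I \<le> m \<or> q = 0"
    using assms(4) degree_linear_factors[OF assms(1), of s] unfolding q
    by (cases "q = 0") (auto simp: degree_mult_eq)
  then show ?thesis by (rule that[OF q])
qed

lemma vanishing_poly_zero:
  fixes s :: "'i \<Rightarrow> complex"
  assumes "finite I" "inj_on s I" "\<And>i. i \<in> I \<Longrightarrow> poly p (s i) = 0" "degree p < card I"
  shows "p = 0"
proof -
  obtain q where q: "p = (\<Prod>i\<in>I. [:- s i, 1:]) * q" "degree q + card I \<le> degree p \<or> q = 0"
    using vanishing_poly_factor[OF assms(1-3) order_refl] .
  then have "q = 0" using assms(4) by linarith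
  then show ?thesis by (simp add: q(1))
qed

text \<open>\<open>R\<close> is the numerator of the sum of the \<open>c i / (X - s i)\<close> over
  the common denominator. The expansion of this sum in powers of \<open>1 / X\<close> has the power
  sums in the hypothesis as coefficients, so the vanishing of the first \<open>T\<close> of them
  lowers the degree of the numerator by at least \<open>T\<close>.\<close>

lemma residue_poly:
  fixes s c :: "'i \<Rightarrow> complex"
  assumes I: "finite I" and c: "\<And>k. k < T \<Longrightarrow> (\<Sum>i\<in>I. c i * s i ^ k) = 0"
  obtains R where "\<And>i. i \<in> I \<Longrightarrow> poly R (s i) = c i * (\<Prod>k\<in>I - {i}. s i - s k)"
    and "degree R + T < card I \<or> R = 0"
proof -
  define P where "P = (\<Prod>i\<in>I. [:- s i, 1:])"
  define G where "G i = (\<Prod>k\<in>I - {i}. [:- s k, 1:])" for i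
  define R where "R = (\<Sum>i\<in>I. smult (c i) (G i))"
  have PG: "P = [:- s i, 1:] * G i" if "i \<in> I" for i
    unfolding P_def G_def using I that by (rule prod.remove)
  \<comment> \<open>Comparing coefficients in \<open>P = (X - s i) * G i\<close> moves to the next
    coefficient of \<open>G i\<close> at the price of a factor \<open>s i\<close>; the other term is
    the same for all \<open>i\<close> and is killed by a power sum.\<close>
  have step: "coeff (G i) m = coeff P (Suc m) + s i * coeff (G i) (Suc m)" if "i \<in> I" for i m
    by (simp add: PG[OF that])
  have high: "coeff (G i) m = 0" if "i \<in> I" "card I \<le> m" for i m
  proof -
    have "degree (G i) = card I - 1"
      unfolding G_def using degree_linear_factors[of "I - {i}" s] I that by simp
    moreover have "card I > 0" using I that(1) by (auto simp: card_gt_0_iff)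
    ultimately show ?thesis using that by (intro coeff_eq_0) simp
  qed
  \<comment> \<open>The exponent \<open>r\<close> makes the descent close: \<open>m\<close> and
    \<open>r\<close> grow together, which preserves the hypothesis, until \<open>m\<close> exceeds
    the degree of all \<open>G i\<close>.\<close>
  have main: "(\<Sum>i\<in>I. c i * s i ^ r * coeff (G i) m) = 0" if "card I + r \<le> m + T" for m r
    using that
  proof (induction "card I - m" arbitrary: m r)
    case 0
    then show ?case using high by (intro sum.neutral) auto
  next
    case (Suc N)
    have "(\<Sum>i\<in>I. c i * s i ^ r * coeff (G i) m) =
      (\<Sum>i\<in>I. coeff P (Suc m) * (c i * s i ^ r) + c i * s i ^ Suc r * coeff (G i) (Suc m))"
      by (intro sum.cong refl) (simp add: step[where m = m] algebra_simps)
    also have "\<dots> = coeff P (Suc m) * (\<Sum>i\<in>I. c i * s i ^ r) +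
        (\<Sum>i\<in>I. c i * s i ^ Suc r * coeff (G i) (Suc m))"
      by (simp only: sum.distrib sum_distrib_left)
    also have "(\<Sum>i\<in>I. c i * s i ^ r) = 0"
      using Suc.prems Suc.hyps(2) by (intro c) linarith
    also have "(\<Sum>i\<in>I. c i * s i ^ Suc r * coeff (G i) (Suc m)) = 0"
      using Suc by (intro Suc.hyps(1)) auto
    finally show ?case by simp
  qed
  have "poly R (s i) = c i * (\<Prod>k\<in>I - {i}. s i - s k)" if "i \<in> I" for i
  proof -
    have "poly R (s i) = (\<Sum>j\<in>I. if j = i then c i * poly (G i) (s i) else 0)"
      unfolding R_def poly_sum using I that
      by (intro sum.cong refl) (auto simp: G_def poly_prod)
    then show ?thesis using I that by (simp add: G_def poly_prod)
  qed
  moreover have "coeff R m = 0" if "card I \<le> m + T" for m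
    using main[of 0 m] that by (simp add: R_def coeff_sum)
  then have "degree R + T < card I \<or> R = 0"
    by (metis leading_coeff_0_iff not_le)
  ultimately show ?thesis using that by blast
qed

lemma coprime_complex_poly:
  fixes p q :: "complex poly"
  assumes "p \<noteq> 0" "\<And>x. poly p x = 0 \<Longrightarrow> poly q x \<noteq> 0"
  shows "coprime p q"
proof (rule coprimeI)
  fix r assume r: "r dvd p" "r dvd q"
  then have "r \<noteq> 0" using assms(1) by auto
  have "\<not> (\<exists>x. poly r x = 0)"
    using r assms(2) by (metis dvd_trans poly_eq_0_iff_dvd)
  then have "constant (poly r)" using fundamental_theorem_of_algebra by blast
  then have "degree r = 0" by (simp add: constant_degree)
  then show "is_unit r" using \<open>r \<noteq> 0\<close> is_unit_iff_degree by blast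
qed

lemma dvd_small_degree:
  fixes A p :: "complex poly"
  assumes "A dvd p" "degree p < degree A"
  shows "p = 0"
  using dvd_imp_degree_le[OF assms(1)] assms(2) by linarith

text \<open>This polynomial is the dehomogenised partial derivative, in the second variable, of the
  binary form of degree \<open>e\<close> attached to \<open>p\<close>. The monomial
  \<open>s ^ e\<close> is free of that variable.\<close>

lemma degree_euler_diff:
  fixes p :: "complex poly"
  assumes "degree p \<le> e"
  shows "degree (smult (of_nat e) p - [:0, 1:] * pderiv p) \<le> e - 1"
proof (rule degree_le, intro allI impI)
  fix k assume k: "e - 1 < k"
  have "coeff p k = 0" if "k \<noteq> e" using that k assms by (intro coeff_eq_0) auto
  then show "coeff (smult (of_nat e) p - [:0, 1:] * pderiv p) k = 0"
    using k by (cases "k = e"; cases k) (auto simp: coeff_pderiv)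
qed

text \<open>\<open>g1\<close> and \<open>g2\<close> hold when the curve \<open>w A(s) + B(s) = 0\<close> through the points can be deformed to first order
  while its multiple point moves in the two coordinate directions.\<close>

theorem no_relation_on_deformable_curve:
  fixes s w c :: "'i \<Rightarrow> complex"
  assumes S: "finite S" "inj_on s S" and n: "2 * e + 3 \<le> card S" and e: "e \<ge> 1"
    and A: "degree A = e" and B: "degree B \<le> e + 1" and cop: "coprime A B"
    and g: "\<And>i. i \<in> S \<Longrightarrow> w i * poly A (s i) + poly B (s i) = 0"
    and A1: "degree A1 \<le> e" and B1: "degree B1 \<le> e + 1"
    and g1: "\<And>i. i \<in> S \<Longrightarrow> (w i)^2 * poly (pderiv A) (s i) + w i * poly A1 (s i) + poly B1 (s i) = 0"
    and A2: "degree A2 \<le> e" and B2: "degree B2 \<le> e + 1"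
    and g2: "\<And>i. i \<in> S \<Longrightarrow> (w i)^2 * (of_nat e * poly A (s i) - s i * poly (pderiv A) (s i))
        + w i * poly A2 (s i) + poly B2 (s i) = 0"
    and c: "\<And>k m. k + m \<le> e \<Longrightarrow> (\<Sum>i\<in>S. c i * s i ^ k * w i ^ m) = 0"
    and i: "i \<in> S"
  shows "c i = 0"
proof -
  define n where "n = card S"
  have n3: "2 * e + 3 \<le> n" using assms(3) by (simp add: n_def)
  define P where "P = (\<Prod>i\<in>S. [:- s i, 1:])"
  define D where "D i = (\<Prod>k\<in>S - {i}. s i - s k)" for i
  have D0: "D i \<noteq> 0" if "i \<in> S" for i
    using S that by (auto simp: D_def inj_on_def)
  have A0: "A \<noteq> 0" using A e by auto
  have root: "poly A (s i) \<noteq> 0" if "i \<in> S" for i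
  proof
    assume a: "poly A (s i) = 0"
    then have "poly B (s i) = 0" using g[OF that] by simp
    with a have "[:- s i, 1:] dvd A" "[:- s i, 1:] dvd B" by (simp_all add: poly_eq_0_iff_dvd)
    with cop have "is_unit [:- s i, 1:]" by (rule coprime_common_divisor)
    then show False by (simp add: is_unit_poly_iff)
  qed
  have copP: "coprime A P"
  proof (rule coprime_complex_poly[OF A0], rule ccontr)
    fix x assume "poly A x = 0" "\<not> poly P x \<noteq> 0"
    then show False using root S by (auto simp: P_def poly_prod)
  qed
  define C2 where "C2 = smult (of_nat e) A - [:0, 1:] * pderiv A"
  have C2: "degree C2 \<le> e - 1"
    unfolding C2_def using A by (intro degree_euler_diff) simp
  \<comment> \<open>Each factor \<open>w\<close> uses up one degree of the relation, so the number
    of vanishing power sums in \<open>s\<close> falls from \<open>e + 1\<close> to \<open>e\<close>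
    to \<open>e - 1\<close>, and each degree bound is one weaker than the last.\<close>
  obtain R where R: "\<And>i. i \<in> S \<Longrightarrow> poly R (s i) = c i * D i" "degree R + (e + 1) < n \<or> R = 0"
    using residue_poly[OF S(1), of "e + 1" c s] c[of _ 0] unfolding D_def n_def by auto
  obtain R1 where R1: "\<And>i. i \<in> S \<Longrightarrow> poly R1 (s i) = c i * w i * D i" "degree R1 + e < n \<or> R1 = 0"
    using residue_poly[OF S(1), of e "\<lambda>i. c i * w i" s] c[of _ 1] unfolding D_def n_def
    by (auto simp: mult_ac)
  obtain R2 where R2: "\<And>i. i \<in> S \<Longrightarrow> poly R2 (s i) = c i * (w i)^2 * D i" "degree R2 + (e - 1) < n \<or> R2 = 0"
    using residue_poly[OF S(1), of "e - 1" "\<lambda>i. c i * (w i)^2" s] c[of _ 2] unfolding D_def n_def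
    by (auto simp: mult_ac)
  \<comment> \<open>At \<open>s i\<close> this is the equation of the curve times
    \<open>c i * D i\<close>, and both products have degree at most \<open>n - 1\<close>.\<close>
  have "A * R1 + B * R = 0"
  proof (rule vanishing_poly_zero[OF S])
    fix i assume i: "i \<in> S"
    have "poly (A * R1 + B * R) (s i) = (w i * poly A (s i) + poly B (s i)) * (c i * D i)"
      by (simp add: R(1)[OF i] R1(1)[OF i] algebra_simps)
    then show "poly (A * R1 + B * R) (s i) = 0" by (simp add: g[OF i])
  next
    have "degree (A * R1) < n" "degree (B * R) < n"
      using degree_mult_le[of A R1] degree_mult_le[of B R] A B R(2) R1(2) n3 by auto
    then show "degree (A * R1 + B * R) < card S"
      by (simp add: degree_add_less n_def)
  qed
  then have "A * R1 = - (B * R)" by (simp add: add_eq_0_iff)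
  then have "A dvd B * R" by (metis dvd_minus_iff dvd_triv_left)
  then have "A dvd R" using cop by (simp add: coprime_dvd_mult_right_iff)
  then obtain H where H: "R = A * H" by (rule dvdE)
  have dH: "degree H + (2 * e + 2) \<le> n \<or> H = 0"
    using R(2) A A0 unfolding H by (cases "H = 0") (auto simp: degree_mult_eq)
  \<comment> \<open>On the points \<open>B = - w * A\<close>, so both terms equal
    \<open>w^2 * A^2 * H\<close>. The degree may now reach \<open>n\<close>; the difference need not
    vanish, but it is a constant \<open>\<gamma>\<close> times \<open>P\<close>.\<close>
  have "poly (B^2 * H - A * R2) (s i) = 0" if "i \<in> S" for i
  proof -
    have "poly B (s i) = - (w i * poly A (s i))" using g[OF that] by (simp add: add_eq_0_iff)
    moreover have "c i * D i = poly A (s i) * poly H (s i)" using R(1)[OF that] by (simp add: H)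
    then have "c i * (w i)^2 * D i = (w i)^2 * (poly A (s i) * poly H (s i))"
      by (metis mult.assoc mult.commute)
    ultimately show ?thesis by (auto simp: R2(1)[OF that] algebra_simps power2_eq_square)
  qed
  moreover have "degree (B^2 * H - A * R2) \<le> n"
  proof (rule degree_diff_le)
    show "degree (B^2 * H) \<le> n"
      using degree_mult_le[of "B^2" H] degree_power_le[of B 2] B dH by auto
    show "degree (A * R2) \<le> n"
      using degree_mult_le[of A R2] A R2(2) e n3 by auto
  qed
  ultimately obtain G where G: "B^2 * H - A * R2 = P * G" "degree G + card S \<le> n \<or> G = 0"
    unfolding P_def by (rule vanishing_poly_factor[OF S])
  then have "degree G = 0" by (auto simp: n_def)
  then obtain \<gamma> where \<gamma>: "G = [:\<gamma>:]" by (rule degree_eq_zeroE)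
  \<comment> \<open>Elimination of \<open>w\<close> by \<open>w = - B / A\<close>, cleared by
    \<open>A^2\<close>. Since \<open>n \<ge> 2 * e + 3\<close>, the cofactor \<open>E\<close> is
    zero or has degree at most \<open>e - 2\<close>.\<close>
  have curve: "\<exists>E. B^2 * C - A * A' * B + A^2 * B' = P * E \<and> (degree E + n \<le> 3 * e + 1 \<or> E = 0)"
    if C: "degree C \<le> e - 1" and d: "degree A' \<le> e" "degree B' \<le> e + 1"
      and z: "\<And>i. i \<in> S \<Longrightarrow> (w i)^2 * poly C (s i) + w i * poly A' (s i) + poly B' (s i) = 0" for C A' B'
  proof -
    have "poly (B^2 * C - A * A' * B + A^2 * B') (s i) = 0" if "i \<in> S" for i
    proof -
      have B: "poly B (s i) = - (w i * poly A (s i))" using g[OF that] by (simp add: add_eq_0_iff)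
      have "poly (B^2 * C - A * A' * B + A^2 * B') (s i) =
        (poly A (s i))^2 * ((w i)^2 * poly C (s i) + w i * poly A' (s i) + poly B' (s i))"
        by (simp add: B algebra_simps power2_eq_square)
      then show ?thesis by (simp add: z[OF that])
    qed
    moreover have "degree (B^2 * C - A * A' * B + A^2 * B') \<le> 3 * e + 1"
    proof (intro degree_add_le degree_diff_le)
      show "degree (B^2 * C) \<le> 3 * e + 1"
        using degree_mult_le[of "B^2" C] degree_power_le[of B 2] B C e by linarith
      show "degree (A * A' * B) \<le> 3 * e + 1"
        using degree_mult_le[of "A * A'" B] degree_mult_le[of A A'] A B d by linarith
      show "degree (A^2 * B') \<le> 3 * e + 1"
        using degree_mult_le[of "A^2" B'] degree_power_le[of A 2] A d by linarith
    qed
    ultimately show ?thesis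
      unfolding n_def P_def by (rule vanishing_poly_factor[OF S]) (assumption | rule exI conjI)+
  qed
  obtain E1 where E1: "B^2 * pderiv A - A * A1 * B + A^2 * B1 = P * E1" "degree E1 + n \<le> 3 * e + 1 \<or> E1 = 0"
    using curve[of "pderiv A" A1 B1] A A1 B1 g1 by (auto simp: degree_pderiv)
  obtain E2 where E2: "B^2 * C2 - A * A2 * B + A^2 * B2 = P * E2" "degree E2 + n \<le> 3 * e + 1 \<or> E2 = 0"
    using curve[OF C2 A2 B2] g2 by (auto simp: C2_def)
  define X where "X = ([:0, 1:] :: complex poly)"
  have euler: "X * pderiv A + C2 = smult (of_nat e) A" by (simp add: C2_def X_def)
  \<comment> \<open>Modulo \<open>A\<close> the cofactors satisfy
    \<open>P * E1 = B^2 * pderiv A\<close> and \<open>P * E2 = B^2 * C2\<close>, so Euler's relation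
    makes \<open>A\<close> divide \<open>P * (X * E1 + E2)\<close>. Here \<open>P\<close> cancels,
    and the remaining factor has degree below \<open>e\<close>.\<close>
  have EE: "X * E1 + E2 = 0"
  proof (rule dvd_small_degree)
    have "P * (X * E1 + E2) = X * (P * E1) + P * E2" by (simp add: algebra_simps)
    also have "\<dots> = B^2 * (X * pderiv A + C2) - A * (X * A1 * B + A2 * B - X * A * B1 - A * B2)"
      unfolding E1(1)[symmetric] E2(1)[symmetric] by (simp add: algebra_simps power2_eq_square)
    also have "\<dots> = A * (smult (of_nat e) (B^2) - (X * A1 * B + A2 * B - X * A * B1 - A * B2))"
      unfolding euler by (simp add: algebra_simps)
    finally have "A dvd P * (X * E1 + E2)" by (metis dvd_triv_left)
    then show "A dvd X * E1 + E2" using copP by (simp add: coprime_dvd_mult_right_iff)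
    have "degree (X * E1) < e" "degree E2 < e"
      using degree_mult_le[of X E1] E1(2) E2(2) n3 e by (auto simp: X_def)
    then show "degree (X * E1 + E2) < degree A" using A by (simp add: degree_add_less)
  qed
  \<comment> \<open>Modulo \<open>A\<close>, \<open>\<gamma> * P = B^2 * H\<close> and
    \<open>P * E = B^2 * C\<close>, hence \<open>P * \<gamma> * C = P * E * H\<close>, and
    \<open>P\<close> cancels. The degree bounds of \<open>E\<close> and \<open>H\<close> add up to
    \<open>e - 1\<close>, which turns the congruence into an equality.\<close>
  have multiple: "smult \<gamma> C = E * H"
    if C: "degree C \<le> e - 1" and E: "B^2 * C - A * A' * B + A^2 * B' = P * E" "degree E + n \<le> 3 * e + 1 \<or> E = 0"
    for C E A' B'
  proof -
    have "P * (smult \<gamma> C - E * H) = (P * G) * C - (P * E) * H"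
      unfolding \<gamma> by (simp add: algebra_simps)
    also have "\<dots> = A * (A' * B * H - A * B' * H - R2 * C)"
      unfolding G(1)[symmetric] E(1)[symmetric] by (simp add: algebra_simps power2_eq_square)
    finally have "A dvd P * (smult \<gamma> C - E * H)" by (metis dvd_triv_left)
    then have "A dvd smult \<gamma> C - E * H" using copP by (simp add: coprime_dvd_mult_right_iff)
    moreover have "degree (E * H) < e"
      using degree_mult_le[of E H] E(2) dH n3 e by auto
    moreover have "degree (smult \<gamma> C) < e" using C e degree_smult_le[of \<gamma> C] by linarith
    ultimately have "smult \<gamma> C - E * H = 0"
      using A by (intro dvd_small_degree[of A]) (auto intro: degree_diff_less)
    then show ?thesis by simp
  qed
  have 1: "smult \<gamma> (pderiv A) = E1 * H"
    by (rule multiple[OF _ E1]) (simp add: A degree_pderiv)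
  have 2: "smult \<gamma> C2 = E2 * H"
    by (rule multiple[OF C2 E2])
  \<comment> \<open>Here the two directions of motion of \<open>Q\<close> are used together: by
    \<open>EE\<close> the combined right side vanishes, although \<open>e * A\<close> is
    nonzero.\<close>
  have "smult (\<gamma> * of_nat e) A = X * smult \<gamma> (pderiv A) + smult \<gamma> C2"
    by (simp add: euler[symmetric] smult_add_right flip: smult_smult)
  also have "\<dots> = (X * E1 + E2) * H"
    unfolding 1 2 by (simp add: algebra_simps)
  finally have "\<gamma> = 0" using A0 e EE by simp
  then have "E1 = 0 \<or> H = 0" using 1 by simp
  then have "H = 0"
  proof
    assume "E1 = 0"
    then have "B^2 * pderiv A = A * (A1 * B - A * B1)"
      using E1(1) by (simp add: algebra_simps power2_eq_square)
    then have "A dvd B^2 * pderiv A" by (metis dvd_triv_left)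
    then have "A dvd pderiv A" using cop by (simp add: coprime_dvd_mult_right_iff)
    then have "pderiv A = 0" using A e by (intro dvd_small_degree[of A]) (auto simp: degree_pderiv)
    then show ?thesis using A e by (simp add: pderiv_eq_0_iff)
  qed
  then show ?thesis using R(1)[OF i] D0[OF i] by (simp add: H)
qed

section \<open>Separated sets and ranks of spaces of functions\<close>

definition linear_space :: "('i \<Rightarrow> complex) set \<Rightarrow> bool"
  where "linear_space V \<longleftrightarrow> (\<lambda>i. 0) \<in> V \<and>
    (\<forall>F\<in>V. \<forall>G\<in>V. \<forall>a b. (\<lambda>i. a * F i + b * G i) \<in> V)"

text \<open>For a linear space \<open>V\<close> and finite \<open>B\<close> this says that
  restriction from \<open>V\<close> to \<open>B\<close> is onto. A maximal such \<open>B\<close>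
  inside a finite set has as many elements as the rank of \<open>V\<close> on that set, so ranks are
  handled without dimensions or determinants.\<close>

definition separates :: "('i \<Rightarrow> complex) set \<Rightarrow> 'i set \<Rightarrow> bool"
  where "separates V B \<longleftrightarrow> (\<forall>b\<in>B. \<exists>F\<in>V. F b = 1 \<and> (\<forall>i\<in>B - {b}. F i = 0))"

lemma linear_space_comb:
  assumes "linear_space V" "F \<in> V" "G \<in> V"
  shows "(\<lambda>i. a * F i + b * G i) \<in> V"
  using assms unfolding linear_space_def by blast

lemma linear_space_scale:
  assumes "linear_space V" "F \<in> V"
  shows "(\<lambda>i. a * F i) \<in> V"
  using linear_space_comb[OF assms assms(2), of a 0] by simp

lemma linear_space_diff:
  assumes "linear_space V" "F \<in> V" "G \<in> V"
  shows "(\<lambda>i. F i - b * G i) \<in> V"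
  using linear_space_comb[OF assms, of 1 "- b"] by simp

lemma linear_space_sum:
  assumes "linear_space V" "\<And>b. b \<in> B \<Longrightarrow> F b \<in> V"
  shows "(\<lambda>i. \<Sum>b\<in>B. a b * F b i) \<in> V"
  using assms(2)
proof (induction B rule: infinite_finite_induct)
  case (insert x B)
  then show ?case
    using linear_space_comb[OF assms(1), of "F x" "\<lambda>i. \<Sum>b\<in>B. a b * F b i" "a x" 1] by simp
qed (use assms(1) in \<open>simp_all add: linear_space_def\<close>)

lemma separates_interpolate:
  assumes V: "linear_space V" and B: "finite B" "separates V B"
  shows "\<exists>F. (\<forall>b\<in>B. F b \<in> V) \<and> (\<forall>b\<in>B. \<forall>i\<in>B. F b i = (if i = b then 1 else 0)) \<and>
    (\<forall>a. \<forall>i\<in>B. (\<Sum>b\<in>B. a b * F b i) = a i)"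
proof -
  obtain F where F: "\<forall>b\<in>B. F b \<in> V \<and> F b b = 1 \<and> (\<forall>i\<in>B - {b}. F b i = 0)"
    using B(2) unfolding separates_def by metis
  then have 1: "F b i = (if i = b then 1 else 0)" if "b \<in> B" "i \<in> B" for b i
    using that by auto
  have 2: "(\<Sum>b\<in>B. a b * F b i) = a i" if "i \<in> B" for a i
  proof -
    have "(\<Sum>b\<in>B. a b * F b i) = (\<Sum>b\<in>B. if b = i then a b else 0)"
      using 1 that by (intro sum.cong) auto
    then show ?thesis using B(1) that by simp
  qed
  with F 1 show ?thesis by blast
qed

lemma separates_insert:
  assumes V: "linear_space V" and B: "finite B" "separates V B"
    and F: "F \<in> V" "F t \<noteq> 0" "\<And>b. b \<in> B \<Longrightarrow> F b = 0"
  shows "separates V (insert t B)"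
proof -
  obtain G where "\<forall>b\<in>B. G b \<in> V"
    "\<forall>b\<in>B. \<forall>i\<in>B. G b i = (if i = b then 1 else 0)"
    "\<forall>a. \<forall>i\<in>B. (\<Sum>b\<in>B. a b * G b i) = a i"
    using separates_interpolate[OF V B] by blast
  note G = this[rule_format]
  show ?thesis unfolding separates_def
  proof
    fix b assume b: "b \<in> insert t B"
    show "\<exists>F\<in>V. F b = 1 \<and> (\<forall>i\<in>insert t B - {b}. F i = 0)"
    proof (cases "b = t")
      case True
      then show ?thesis using F linear_space_scale[OF V F(1), of "1 / F t"]
        by (intro bexI[of _ "\<lambda>i. 1 / F t * F i"]) auto
    next
      case False
      then have b: "b \<in> B" using b by simp
      show ?thesis
      proof (intro bexI conjI ballI)
        show "(\<lambda>i. G b i - G b t / F t * F i) \<in> V"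
          by (rule linear_space_diff[OF V G(1)[OF b] F(1)])
        show "G b b - G b t / F t * F b = 1" by (simp add: G(2)[OF b b] F(3)[OF b])
        fix i assume "i \<in> insert t B - {b}"
        then consider "i = t" | "i \<in> B" "i \<noteq> b" by blast
        then show "G b i - G b t / F t * F i = 0"
          by cases (simp_all add: F(2,3) G(2)[OF b])
      qed
    qed
  qed
qed

lemma maximal_separated_set:
  assumes V: "linear_space V" and S: "finite S"
  obtains B where "B \<subseteq> S" "separates V B"
    "\<And>t. t \<in> S - B \<Longrightarrow> \<not> separates V (insert t B)"
proof -
  let ?P = "\<lambda>B. B \<subseteq> S \<and> separates V B"
  have "?P {}" by (simp add: separates_def)
  moreover have "\<forall>B. ?P B \<longrightarrow> card B < Suc (card S)" using S by (auto simp: less_Suc_eq_le intro: card_mono)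
  ultimately obtain B where B: "?P B" "\<forall>B'. ?P B' \<longrightarrow> card B' \<le> card B"
    using ex_has_greatest_nat[of ?P "{}" card "Suc (card S)"] by blast
  have "\<not> separates V (insert t B)" if "t \<in> S - B" for t
  proof
    assume "separates V (insert t B)"
    then have "card (insert t B) \<le> card B" using B that by blast
    then show False using that B(1) S finite_subset[of B S] by auto
  qed
  then show ?thesis using B(1) by (intro that[of B]) simp_all
qed

text \<open>Finite-dimensional duality. On \<open>S\<close>, a function of \<open>V\<close> is
  determined by its values on a maximal separated \<open>B\<close>, so the value at \<open>p\<close>
  minus the value predicted from \<open>B\<close> is a functional that kills \<open>V\<close>. A
  suitable \<open>p\<close> detects \<open>x\<close>, since the interpolant of \<open>x\<close> on
  \<open>B\<close> must differ from \<open>x\<close> somewhere.\<close>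

lemma separating_functional:
  assumes V: "linear_space V" and S: "finite S"
    and x: "\<forall>F\<in>V. \<exists>i\<in>S. F i \<noteq> x i"
  shows "\<exists>c :: 'i \<Rightarrow> complex. (\<forall>F\<in>V. (\<Sum>i\<in>S. c i * F i) = 0) \<and> (\<Sum>i\<in>S. c i * x i) \<noteq> 0"
proof -
  obtain B where B: "B \<subseteq> S" "separates V B" "\<And>t. t \<in> S - B \<Longrightarrow> \<not> separates V (insert t B)"
    using maximal_separated_set[OF V S] by blast
  have finB: "finite B" using B(1) S finite_subset by blast
  obtain F where "\<forall>b\<in>B. F b \<in> V"
    "\<forall>b\<in>B. \<forall>i\<in>B. F b i = (if i = b then 1 else 0)"
    "\<forall>a. \<forall>i\<in>B. (\<Sum>b\<in>B. a b * F b i) = a i"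
    using separates_interpolate[OF V finB B(2)] by blast
  note F = this[rule_format]
  have "(\<lambda>i. \<Sum>b\<in>B. x b * F b i) \<in> V" by (rule linear_space_sum[OF V F(1)])
  from bspec[OF x this] obtain p where p: "p \<in> S" "(\<Sum>b\<in>B. x b * F b p) \<noteq> x p" ..
  have pB: "p \<notin> B"
  proof
    assume "p \<in> B"
    from F(3)[OF this, of x] p(2) show False by contradiction
  qed
  define c where "c i = (if i = p then 1 else if i \<in> B then - F i p else 0)" for i
  have c: "(\<Sum>i\<in>S. c i * y i) = y p - (\<Sum>b\<in>B. y b * F b p)" for y
  proof -
    have "(\<Sum>i\<in>S. c i * y i) = (\<Sum>i\<in>insert p B. c i * y i)"
      using S B(1) p(1) by (intro sum.mono_neutral_right) (auto simp: c_def)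
    also have "\<dots> = y p + (\<Sum>i\<in>B. c i * y i)"
      using finB pB by (simp add: c_def)
    also have "(\<Sum>i\<in>B. c i * y i) = (\<Sum>b\<in>B. - (y b * F b p))"
      using pB by (intro sum.cong) (auto simp: c_def)
    finally show ?thesis by (simp add: sum_negf)
  qed
  have "\<forall>G\<in>V. (\<Sum>i\<in>S. c i * G i) = 0"
  proof (rule ballI, rule ccontr)
    fix G assume G: "G \<in> V"
    assume "(\<Sum>i\<in>S. c i * G i) \<noteq> 0"
    then have nz: "G p - 1 * (\<Sum>b\<in>B. G b * F b p) \<noteq> 0" by (simp add: c)
    \<comment> \<open>This function vanishes on \<open>B\<close> but not at \<open>p\<close>, so it
      would enlarge the maximal set \<open>B\<close>.\<close>
    have "(\<lambda>i. G i - 1 * (\<Sum>b\<in>B. G b * F b i)) \<in> V"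
      by (rule linear_space_diff[OF V G linear_space_sum[OF V F(1)]])
    from separates_insert[OF V finB B(2) this nz] have "separates V (insert p B)"
      by (simp only: F(3)) simp
    then show False using B(3) p(1) pB by blast
  qed
  moreover have "(\<Sum>i\<in>S. c i * x i) \<noteq> 0" using p(2) by (simp add: c)
  ultimately show ?thesis by (intro exI[of _ c] conjI)
qed

text \<open>The matrix of values of the \<open>\<phi> b t\<close> on \<open>B\<close> tends to the
  identity and is eventually invertible. In place of a determinant, one step of Gaussian elimination
  with pivot \<open>\<phi> x t x\<close> passes to the functions vanishing at
  \<open>x\<close>.\<close>

lemma eventually_separates:
  assumes "finite B" "\<And>t. linear_space (V t)"
    "\<forall>\<^sub>F t in T. \<forall>b\<in>B. \<phi> b t \<in> V t"
    "\<And>b i. b \<in> B \<Longrightarrow> i \<in> B \<Longrightarrow> ((\<lambda>t. \<phi> b t i) \<longlongrightarrow> (if i = b then 1 else 0)) T"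
  shows "\<forall>\<^sub>F t in T. separates (V t) B"
  using assms
proof (induction B arbitrary: V \<phi> rule: finite_induct)
  case empty
  then show ?case by (simp add: separates_def)
next
  case (insert x B)
  define \<psi> where "\<psi> b t = (\<lambda>i. \<phi> b t i - \<phi> b t x / \<phi> x t x * \<phi> x t i)" for b t
  define V' where "V' t = {F \<in> V t. F x = 0}" for t
  have lim: "((\<lambda>t. \<phi> b t i) \<longlongrightarrow> (if i = b then 1 else 0)) T"
    if "b \<in> insert x B" "i \<in> insert x B" for b i
    using insert.prems(3) that by blast
  have nz: "\<forall>\<^sub>F t in T. \<phi> x t x \<noteq> 0"
    using tendsto_imp_eventually_ne[OF lim[of x x]] by simp
  have "\<forall>\<^sub>F t in T. separates (V' t) B"
  proof (rule insert.IH)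
    show "linear_space (V' t)" for t
      using insert.prems(1)[of t] by (auto simp: V'_def linear_space_def)
    show "\<forall>\<^sub>F t in T. \<forall>b\<in>B. \<psi> b t \<in> V' t"
      using insert.prems(2) nz
    proof eventually_elim
      case (elim t)
      show ?case
      proof
        fix b assume "b \<in> B"
        then have "\<psi> b t \<in> V t"
          unfolding \<psi>_def using elim(1) by (intro linear_space_diff insert.prems(1)) auto
        then show "\<psi> b t \<in> V' t" using elim(2) by (simp add: V'_def \<psi>_def)
      qed
    qed
    show "((\<lambda>t. \<psi> b t i) \<longlongrightarrow> (if i = b then 1 else 0)) T" if "b \<in> B" "i \<in> B" for b i
    proof -
      have ne: "x \<noteq> b" "x \<noteq> i" using that insert.hyps by auto
      have "((\<lambda>t. \<psi> b t i) \<longlongrightarrow> (if i = b then 1 else 0) - 0 / 1 * 0) T"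
        unfolding \<psi>_def using lim[of b i] lim[of b x] lim[of x x] lim[of x i] that ne
        by (intro tendsto_intros) auto
      then show ?thesis by simp
    qed
  qed
  then show ?case using nz insert.prems(2)
  proof eventually_elim
    case (elim t)
    note V = insert.prems(1)[of t]
    have V': "linear_space (V' t)" using V by (auto simp: V'_def linear_space_def)
    have sB: "separates (V t) B" using elim(1) by (auto simp: V'_def separates_def)
    obtain F where "\<forall>b\<in>B. F b \<in> V' t"
    "\<forall>b\<in>B. \<forall>i\<in>B. F b i = (if i = b then 1 else 0)"
    "\<forall>a. \<forall>i\<in>B. (\<Sum>b\<in>B. a b * F b i) = a i"
      using separates_interpolate[OF V' insert.hyps(1) elim(1)] by blast
  note F = this[rule_format]
    \<comment> \<open>Subtracting this from \<open>\<phi> x t\<close> clears the values on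
      \<open>B\<close> and keeps the pivot, because all \<open>F b\<close> vanish at
      \<open>x\<close>.\<close>
    have "(\<lambda>i. \<Sum>b\<in>B. \<phi> x t b * F b i) \<in> V' t"
      by (rule linear_space_sum[OF V' F(1)])
    then have G: "(\<lambda>i. \<Sum>b\<in>B. \<phi> x t b * F b i) \<in> V t" "(\<Sum>b\<in>B. \<phi> x t b * F b x) = 0"
      by (auto simp: V'_def)
    have "(\<lambda>i. \<phi> x t i - 1 * (\<Sum>b\<in>B. \<phi> x t b * F b i)) \<in> V t"
      using elim(3) by (intro linear_space_diff[OF V _ G(1)]) blast
    then show ?case
      by (rule separates_insert[OF V insert.hyps(1) sB]) (simp_all only: F(3) G(2) elim(2), simp_all add: elim(2))
  qed
qed

text \<open>If a set maximal among the separated subsets of \<open>S\<close> at \<open>t = 0\<close> does not grow for nearby \<open>t\<close>,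
  the rank is locally constant, and the velocity of a curve of vectors that passes through \<open>0\<close> on
  \<open>S\<close> stays in the space.\<close>

lemma velocity_in_space:
  fixes V :: "complex \<Rightarrow> ('i \<Rightarrow> complex) set"
  assumes V: "\<And>t. linear_space (V t)" and S: "finite S"
    and cont: "\<And>F. F \<in> V 0 \<Longrightarrow>
      \<exists>\<phi>. \<phi> 0 = F \<and> (\<forall>t. \<phi> t \<in> V t) \<and> (\<forall>i. ((\<lambda>t. \<phi> t i) \<longlongrightarrow> F i) (at 0))"
    and const: "\<forall>\<^sub>F t in at 0. \<forall>B\<subseteq>S. separates (V t) B \<longrightarrow> separates (V 0) B"
    and g: "\<And>t. g t \<in> V t" "\<And>i. i \<in> S \<Longrightarrow> g 0 i = 0"
      "\<And>i. i \<in> S \<Longrightarrow> ((\<lambda>t. g t i) has_field_derivative g' i) (at 0)"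
  shows "\<exists>F\<in>V 0. \<forall>i\<in>S. F i = g' i"
proof -
  obtain B where B: "B \<subseteq> S" "separates (V 0) B" "\<And>x. x \<in> S - B \<Longrightarrow> \<not> separates (V 0) (insert x B)"
    using maximal_separated_set[OF V S] by blast
  have finB: "finite B" using B(1) S finite_subset by blast
  obtain F where "\<forall>b\<in>B. F b \<in> V 0"
    "\<forall>b\<in>B. \<forall>i\<in>B. F b i = (if i = b then 1 else 0)"
    "\<forall>a. \<forall>i\<in>B. (\<Sum>b\<in>B. a b * F b i) = a i"
    using separates_interpolate[OF V finB B(2)] by blast
  note F = this[rule_format]
  \<comment> \<open>\<open>h\<close> is prescribed by \<open>g'\<close> on the maximal separated
    set; it remains to see that it agrees with \<open>g'\<close> on the rest of
    \<open>S\<close>.\<close>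
  define h where "h = (\<lambda>i. \<Sum>b\<in>B. g' b * F b i)"
  have h: "h \<in> V 0" unfolding h_def by (rule linear_space_sum[OF V F(1)])
  have hB: "h b = g' b" if "b \<in> B" for b using F(3) that by (simp add: h_def)
  have "h i = g' i" if i: "i \<in> S" for i
  proof (rule ccontr)
    assume ne: "h i \<noteq> g' i"
    then have iB: "i \<notin> B" using hB by blast
    obtain H where H: "H 0 = h" "\<And>t. H t \<in> V t" "\<And>i. ((\<lambda>t. H t i) \<longlongrightarrow> h i) (at 0)"
      using cont[OF h] by blast
    have "\<forall>b\<in>B. \<exists>\<phi>. \<phi> 0 = F b \<and> (\<forall>t. \<phi> t \<in> V t) \<and> (\<forall>i. ((\<lambda>t. \<phi> t i) \<longlongrightarrow> F b i) (at 0))"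
      using cont F(1) by blast
    then obtain \<phi> where \<phi>: "\<And>b t. b \<in> B \<Longrightarrow> \<phi> b t \<in> V t"
        "\<And>b i. b \<in> B \<Longrightarrow> ((\<lambda>t. \<phi> b t i) \<longlongrightarrow> F b i) (at 0)"
      by metis
    define \<kappa> where "\<kappa> = g' i - h i"
    \<comment> \<open>A difference quotient of \<open>g\<close>, corrected by an extension
      \<open>H\<close> of \<open>h\<close> and rescaled. It lies in \<open>V t\<close> and tends to
      \<open>0\<close> on \<open>B\<close> and to \<open>1\<close> at \<open>i\<close>, so with the
      \<open>\<phi> b\<close> it would separate one more point at nearby \<open>t\<close>.\<close>
    define \<theta> where "\<theta> t = (\<lambda>k. inverse (\<kappa> * t) * g t k + (- inverse \<kappa>) * H t k)" for t
    have \<theta>V: "\<theta> t \<in> V t" for t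
      unfolding \<theta>_def by (rule linear_space_comb[OF V g(1) H(2)])
    have \<theta>lim: "((\<lambda>t. \<theta> t k) \<longlongrightarrow> (g' k - h k) / \<kappa>) (at 0)" if "k \<in> S" for k
    proof -
      have "((\<lambda>t. g t k / t) \<longlongrightarrow> g' k) (at 0)"
        using g(2,3)[OF that] by (simp add: has_field_derivative_iff)
      then have "((\<lambda>t. inverse \<kappa> * (g t k / t) + (- inverse \<kappa>) * H t k) \<longlongrightarrow>
          inverse \<kappa> * g' k + (- inverse \<kappa>) * h k) (at 0)"
        by (intro tendsto_intros H(3))
      then show ?thesis
        by (simp add: \<theta>_def field_simps diff_divide_distrib)
    qed
    define \<psi> where "\<psi> b t = (if b = i then \<theta> t else (\<lambda>k. \<phi> b t k - F b i * \<theta> t k))" for b t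
    have "\<forall>\<^sub>F t in at 0. separates (V t) (insert i B)"
    proof (rule eventually_separates)
      show "finite (insert i B)" using finB by simp
      show "linear_space (V t)" for t by (rule V)
      show "\<forall>\<^sub>F t in at 0. \<forall>b\<in>insert i B. \<psi> b t \<in> V t"
      proof (intro always_eventually allI ballI)
        fix t b assume "b \<in> insert i B"
        then show "\<psi> b t \<in> V t"
          by (cases "b = i") (auto simp: \<psi>_def intro: \<theta>V \<phi>(1) linear_space_diff[OF V])
      qed
      fix b k assume b: "b \<in> insert i B" and k: "k \<in> insert i B"
      have \<kappa>: "\<kappa> \<noteq> 0" using ne by (simp add: \<kappa>_def)
      have \<theta>k: "((\<lambda>t. \<theta> t k) \<longlongrightarrow> (if k = i then 1 else 0)) (at 0)"
        using \<theta>lim[of k] k i B(1) hB \<kappa> by (auto simp: \<kappa>_def split: if_splits)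
      show "((\<lambda>t. \<psi> b t k) \<longlongrightarrow> (if k = b then 1 else 0)) (at 0)"
      proof (cases "b = i")
        case True
        then show ?thesis using \<theta>k by (simp add: \<psi>_def)
      next
        case False
        then have bB: "b \<in> B" using b by simp
        have "((\<lambda>t. \<phi> b t k - F b i * \<theta> t k) \<longlongrightarrow> F b k - F b i * (if k = i then 1 else 0)) (at 0)"
          by (intro tendsto_intros \<phi>(2) bB \<theta>k)
        moreover have "F b k - F b i * (if k = i then 1 else 0) = (if k = b then 1 else 0)"
          using F(2)[OF bB, of k] k False by auto
        ultimately show ?thesis using False by (simp add: \<psi>_def)
      qed
    qed
    then have "\<forall>\<^sub>F t in at (0::complex). separates (V 0) (insert i B)"
      using const by eventually_elim (use B(1) i in auto)
    then show False using B(3) i iB by auto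
  qed
  with h show ?thesis by (intro bexI[of _ h]) simp_all
qed

section \<open>Curves with a point of high multiplicity\<close>

text \<open>The binary form whose dehomogenisation is \<open>p\<close>, for
  \<open>degree p \<le> e\<close>. As a sum it also makes sense at \<open>y = 0\<close>.\<close>

definition homog :: "nat \<Rightarrow> complex poly \<Rightarrow> complex \<Rightarrow> complex \<Rightarrow> complex"
  where "homog e p x y = (\<Sum>k\<le>e. coeff p k * x ^ k * y ^ (e - k))"

lemma homog_eq:
  assumes "degree p \<le> e" "y \<noteq> 0"
  shows "homog e p x y = y ^ e * poly p (x / y)"
proof -
  have "poly p (x / y) = (\<Sum>k\<le>e. coeff p k * (x / y) ^ k)"
    unfolding poly_altdef using assms(1)
    by (intro sum.mono_neutral_left) (auto simp: coeff_eq_0)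
  then have "y ^ e * poly p (x / y) = (\<Sum>k\<le>e. y ^ e * (coeff p k * (x / y) ^ k))"
    by (simp add: sum_distrib_left)
  also have "\<dots> = homog e p x y"
    unfolding homog_def using assms(2)
    by (intro sum.cong refl) (auto simp: power_diff power_divide)
  finally show ?thesis by simp
qed

lemma homog_one: "degree p \<le> e \<Longrightarrow> homog e p x 1 = poly p x"
  by (simp add: homog_eq)

lemma homog_zero [simp]: "homog e 0 x y = 0"
  by (simp add: homog_def)

lemma homog_lead: "homog e p 1 0 = coeff p e"
proof -
  have "homog e p 1 0 = (\<Sum>k\<le>e. if k = e then coeff p k else 0)"
    unfolding homog_def by (intro sum.cong) (auto simp: power_0_left)
  then show ?thesis by simp
qed

lemma homog_comb:
  "homog e (smult a p + smult b q) x y = a * homog e p x y + b * homog e q x y"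
  by (simp add: homog_def sum_distrib_left sum.distrib algebra_simps)

lemma tendsto_homog:
  assumes "(f \<longlongrightarrow> x) T" "(g \<longlongrightarrow> y) T"
  shows "((\<lambda>t. homog e p (f t) (g t)) \<longlongrightarrow> homog e p x y) T"
  unfolding homog_def by (intro tendsto_intros assms)

text \<open>Shears fix the multiple point and serve to make all second coordinates nonzero, so that
  all points have a finite coordinate \<open>s\<close>.\<close>

lemma homog_shear:
  "\<exists>p'. degree p' \<le> e \<and> (\<forall>x u. homog e p x (u + l * x) = homog e p' x u)"
proof -
  define p' where "p' = (\<Sum>k\<le>e. smult (coeff p k) (monom 1 k * [:1, l:] ^ (e - k)))"
  have deg: "degree p' \<le> e"
    unfolding p'_def
  proof (intro degree_sum_le)
    fix k assume "k \<in> {..e}"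
    moreover have "degree ([:1, l:] ^ (e - k)) \<le> e - k"
      using degree_power_le[of "[:1, l:]" "e - k"] by (auto split: if_splits intro: le_trans)
    moreover have "degree (monom (1::complex) k) \<le> k" by (simp add: degree_monom_le)
    ultimately have "degree (monom 1 k * [:1, l:] ^ (e - k)) \<le> e"
      using degree_mult_le[of "monom 1 k" "[:1, l:] ^ (e - k)"] by auto
    then show "degree (smult (coeff p k) (monom 1 k * [:1, l:] ^ (e - k))) \<le> e"
      using degree_smult_le le_trans by blast
  qed simp
  have eq: "homog e p x (u + l * x) = homog e p' x u" if "u \<noteq> 0" for x u
  proof -
    have "homog e p' x u = u ^ e * poly p' (x / u)" using deg that by (rule homog_eq)
    also have "\<dots> = (\<Sum>k\<le>e. u ^ e * (coeff p k * ((x / u) ^ k * (1 + x / u * l) ^ (e - k))))"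
      by (simp add: p'_def poly_sum poly_monom sum_distrib_left)
    also have "\<dots> = (\<Sum>k\<le>e. coeff p k * x ^ k * (u + l * x) ^ (e - k))"
    proof (intro sum.cong refl)
      fix k assume "k \<in> {..e}"
      then have 1: "u ^ e = u ^ k * u ^ (e - k)" by (simp flip: power_add)
      have 2: "u ^ (e - k) * (1 + x / u * l) ^ (e - k) = (u + l * x) ^ (e - k)"
      proof -
        have "u * (1 + x / u * l) = u + l * x" using that by (simp add: field_simps)
        then show ?thesis by (simp only: power_mult_distrib[symmetric])
      qed
      have 3: "u ^ k * (x / u) ^ k = x ^ k"
        using that by (simp add: power_divide)
      have "u ^ e * (coeff p k * ((x / u) ^ k * (1 + x / u * l) ^ (e - k))) =
          coeff p k * (u ^ k * (x / u) ^ k) * (u ^ (e - k) * (1 + x / u * l) ^ (e - k))"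
        by (simp only: 1 mult_ac)
      then show "u ^ e * (coeff p k * ((x / u) ^ k * (1 + x / u * l) ^ (e - k))) =
          coeff p k * x ^ k * (u + l * x) ^ (e - k)"
        by (simp only: 2 3)
    qed
    finally show ?thesis by (simp add: homog_def)
  qed
  \<comment> \<open>The dehomogenised computation divides by \<open>u\<close>; the value at
    \<open>u = 0\<close> follows by continuity.\<close>
  have "homog e p x (u + l * x) = homog e p' x u" for x u
  proof (cases "u = 0")
    case True
    have "((\<lambda>u. homog e p x (u + l * x)) \<longlongrightarrow> homog e p x (0 + l * x)) (at 0)"
      by (intro tendsto_homog tendsto_intros)
    moreover have "\<forall>\<^sub>F u in at 0. homog e p x (u + l * x) = homog e p' x u"
      unfolding eventually_at_filter using eq by (intro always_eventually) auto
    ultimately have "((\<lambda>u. homog e p' x u) \<longlongrightarrow> homog e p x (0 + l * x)) (at 0)"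
      by (rule Lim_transform_eventually)
    moreover have "((\<lambda>u. homog e p' x u) \<longlongrightarrow> homog e p' x 0) (at 0)"
      by (intro tendsto_homog tendsto_intros)
    ultimately have "homog e p x (0 + l * x) = homog e p' x 0"
      by (intro tendsto_unique[of "at (0::complex)"]) auto
    then show ?thesis by (simp add: True)
  qed (rule eq)
  with deg show ?thesis by blast
qed

text \<open>Chain rule: up to the factor \<open>y ^ e\<close>, the two polynomials multiplied by
  \<open>a\<close> and \<open>b\<close> are the partial derivatives of the binary form at
  \<open>s = x / y\<close>.\<close>

lemma homog_derivative:
  fixes x y a b :: complex
  assumes p: "degree p \<le> Suc e" and y: "y \<noteq> 0"
  shows "((\<lambda>t. homog (Suc e) p (x - t * a) (y - t * b)) has_field_derivative
    - (y ^ e * poly (smult a (pderiv p) + smult b (smult (of_nat (Suc e)) p - [:0, 1:] * pderiv p)) (x / y))) (at 0)"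
proof -
  have pe: "y * y ^ (e - Suc 0) = y ^ e" if "0 < e" using that by (simp flip: power_Suc)
  have "((\<lambda>t. (y - t * b) ^ Suc e * poly p ((x - t * a) / (y - t * b))) has_field_derivative
      (of_nat (Suc e) * y ^ e * (- b)) * poly p (x / y) +
      y ^ Suc e * (poly (pderiv p) (x / y) * (((- a) * y - x * (- b)) / y ^ 2))) (at 0)"
    using y pe by (auto intro!: derivative_eq_intros simp: power2_eq_square algebra_simps)
  moreover have "(of_nat (Suc e) * y ^ e * (- b)) * poly p (x / y) +
      y ^ Suc e * (poly (pderiv p) (x / y) * (((- a) * y - x * (- b)) / y ^ 2)) =
    - (y ^ e * poly (smult a (pderiv p) + smult b (smult (of_nat (Suc e)) p - [:0, 1:] * pderiv p)) (x / y))"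
    using y by (simp add: power2_eq_square field_simps)
  moreover have "\<forall>\<^sub>F t in nhds 0. homog (Suc e) p (x - t * a) (y - t * b) =
      (y - t * b) ^ Suc e * poly p ((x - t * a) / (y - t * b))"
  proof -
    have "((\<lambda>t. y - t * b) \<longlongrightarrow> y - 0 * b) (nhds 0)"
      by (intro tendsto_intros filterlim_ident)
    then have "\<forall>\<^sub>F t in nhds 0. y - t * b \<noteq> 0"
      using y by (intro tendsto_imp_eventually_ne) auto
    then show ?thesis by eventually_elim (rule homog_eq[OF p])
  qed
  ultimately show ?thesis
    by (subst DERIV_cong_ev[OF refl _ refl]) auto
qed

text \<open>Values at the points \<open>(X : Y : Z)\<close> of the forms of degree \<open>e + 1\<close> with multiplicity at least \<open>e\<close>
  at \<open>(0 : 0 : 1)\<close>.\<close>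

definition curve_values ::
    "nat \<Rightarrow> ('i \<Rightarrow> complex) \<Rightarrow> ('i \<Rightarrow> complex) \<Rightarrow> ('i \<Rightarrow> complex) \<Rightarrow> ('i \<Rightarrow> complex) set"
  where "curve_values e X Y Z = {\<lambda>i. Z i * homog e a (X i) (Y i) + homog (Suc e) b (X i) (Y i) |a b.
    degree a \<le> e \<and> degree b \<le> Suc e}"

text \<open>Nontriviality is a condition on the coefficients, because the values on \<open>S\<close>
  are all zero.\<close>

definition on_curve ::
    "nat \<Rightarrow> ('i \<Rightarrow> complex) \<Rightarrow> ('i \<Rightarrow> complex) \<Rightarrow> ('i \<Rightarrow> complex) \<Rightarrow> 'i set \<Rightarrow> bool"
  where "on_curve e X Y Z S \<longleftrightarrow> (\<exists>a b. degree a \<le> e \<and> degree b \<le> Suc e \<and> (a \<noteq> 0 \<or> b \<noteq> 0) \<and>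
    (\<forall>i\<in>S. Z i * homog e a (X i) (Y i) + homog (Suc e) b (X i) (Y i) = 0))"

lemma linear_space_curve_values: "linear_space (curve_values e X Y Z)"
  unfolding linear_space_def
proof (intro conjI ballI allI)
  show "(\<lambda>i. 0) \<in> curve_values e X Y Z"
    unfolding curve_values_def by (rule CollectI, rule exI[of _ 0], rule exI[of _ 0]) simp
  fix F G and u v :: complex
  assume "F \<in> curve_values e X Y Z" "G \<in> curve_values e X Y Z"
  then obtain a b a' b' where
    F: "F = (\<lambda>i. Z i * homog e a (X i) (Y i) + homog (Suc e) b (X i) (Y i))" "degree a \<le> e" "degree b \<le> Suc e" and
    G: "G = (\<lambda>i. Z i * homog e a' (X i) (Y i) + homog (Suc e) b' (X i) (Y i))" "degree a' \<le> e" "degree b' \<le> Suc e"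
    unfolding curve_values_def by blast
  have "degree (smult u a + smult v a') \<le> e" "degree (smult u b + smult v b') \<le> Suc e"
    using F G by (auto intro!: degree_add_le intro: degree_smult_le[THEN order_trans])
  moreover have "(\<lambda>i. u * F i + v * G i) = (\<lambda>i. Z i * homog e (smult u a + smult v a') (X i) (Y i) +
      homog (Suc e) (smult u b + smult v b') (X i) (Y i))"
    unfolding F(1) G(1) homog_comb by (simp add: algebra_simps)
  ultimately show "(\<lambda>i. u * F i + v * G i) \<in> curve_values e X Y Z"
    unfolding curve_values_def by (intro CollectI exI conjI)
qed

lemma homog_shear_nonzero:
  assumes "degree p \<le> e" "p \<noteq> 0" "\<forall>x u. homog e p x (u + l * x) = homog e p' x u"
  shows "p' \<noteq> 0"
proof
  assume "p' = 0"
  then have "homog e p x ((1 - l * x) + l * x) = 0" for x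
    using assms(3) by (metis homog_zero)
  then have "poly p x = 0" for x using homog_one[OF assms(1), of x] by simp
  then show False using assms(2) by (metis poly_all_0_iff_0)
qed

lemma curve_values_shear_subset:
  "curve_values e X (\<lambda>i. Y i + l * X i) Z \<subseteq> curve_values e X Y Z"
proof
  fix F assume "F \<in> curve_values e X (\<lambda>i. Y i + l * X i) Z"
  then obtain a b where F: "F = (\<lambda>i. Z i * homog e a (X i) (Y i + l * X i) + homog (Suc e) b (X i) (Y i + l * X i))"
    unfolding curve_values_def by blast
  obtain a' where a': "degree a' \<le> e" "\<forall>x u. homog e a x (u + l * x) = homog e a' x u"
    using homog_shear by blast
  obtain b' where b': "degree b' \<le> Suc e" "\<forall>x u. homog (Suc e) b x (u + l * x) = homog (Suc e) b' x u"
    using homog_shear by blast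
  have "F = (\<lambda>i. Z i * homog e a' (X i) (Y i) + homog (Suc e) b' (X i) (Y i))"
    unfolding F by (simp add: a'(2) b'(2))
  then show "F \<in> curve_values e X Y Z"
    unfolding curve_values_def using a'(1) b'(1) by (intro CollectI exI conjI)
qed

lemma curve_values_shear: "curve_values e X (\<lambda>i. Y i - l * X i) Z = curve_values e X Y Z"
  using curve_values_shear_subset[of e X Y "- l" Z]
    curve_values_shear_subset[of e X "\<lambda>i. Y i - l * X i" l Z] by simp

lemma on_curve_shear:
  assumes "on_curve e X (\<lambda>i. Y i - l * X i) Z S"
  shows "on_curve e X Y Z S"
proof -
  obtain a b where ab: "degree a \<le> e" "degree b \<le> Suc e" "a \<noteq> 0 \<or> b \<noteq> 0"
    "\<forall>i\<in>S. Z i * homog e a (X i) (Y i + (- l) * X i) + homog (Suc e) b (X i) (Y i + (- l) * X i) = 0"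
    using assms unfolding on_curve_def by auto
  obtain a' where a': "degree a' \<le> e" "\<forall>x u. homog e a x (u + (- l) * x) = homog e a' x u"
    using homog_shear by blast
  obtain b' where b': "degree b' \<le> Suc e" "\<forall>x u. homog (Suc e) b x (u + (- l) * x) = homog (Suc e) b' x u"
    using homog_shear by blast
  have "a' \<noteq> 0 \<or> b' \<noteq> 0"
    using ab(3) homog_shear_nonzero[OF ab(1) _ a'(2)] homog_shear_nonzero[OF ab(2) _ b'(2)] by blast
  then show ?thesis
    unfolding on_curve_def using ab(4) a' b' by (intro exI[of _ a'] exI[of _ b']) simp
qed

section \<open>Moving the multiple point\<close>

text \<open>An affine function that vanishes on a nonempty open set has zero coefficients, as small
  moves in the two coordinate directions show. Hence each zero set can be removed in turn.\<close>

lemma avoid_affine_functions: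
  fixes W :: "(complex \<times> complex) set" and L :: "(complex \<times> complex \<times> complex) set"
  assumes "finite L" "(0, 0, 0) \<notin> L" "open W" "W \<noteq> {}"
  shows "\<exists>W'\<subseteq>W. open W' \<and> W' \<noteq> {} \<and>
    (\<forall>q\<in>W'. \<forall>(a, b, c)\<in>L. a + b * fst q + c * snd q \<noteq> 0)"
  using assms
proof (induction L rule: finite_induct)
  case empty
  then show ?case by blast
next
  case (insert l L)
  obtain W' where W': "W' \<subseteq> W" "open W'" "W' \<noteq> {}"
    "\<forall>q\<in>W'. \<forall>(a, b, c)\<in>L. a + b * fst q + c * snd q \<noteq> 0"
    using insert by auto
  obtain a b c where l: "l = (a, b, c)" by (cases l)
  define f where "f q = a + b * fst q + c * snd q" for q :: "complex \<times> complex"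
  define W'' where "W'' = W' \<inter> {q. f q \<noteq> 0}"
  have "open {q. f q \<noteq> 0}"
    unfolding f_def by (intro open_Collect_neq continuous_intros)
  then have op: "open W''" unfolding W''_def using W'(2) by blast
  have "W'' \<noteq> {}"
  proof
    assume "W'' = {}"
    then have z: "f q = 0" if "q \<in> W'" for q using that by (auto simp: W''_def)
    obtain q1 q2 where q: "(q1, q2) \<in> W'" using W'(3) by auto
    then obtain e where e: "e > 0" "ball (q1, q2) e \<subseteq> W'"
      using W'(2) open_contains_ball by blast
    define t where "t = complex_of_real (e / 2)"
    have t: "t \<noteq> 0" "norm t < e" using e(1) by (auto simp: t_def)
    have "(q1 + t, q2) \<in> ball (q1, q2) e" "(q1, q2 + t) \<in> ball (q1, q2) e"
      using t(2) by (auto simp: dist_Pair_Pair dist_norm)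
    then have "f (q1, q2) = 0" "f (q1 + t, q2) = 0" "f (q1, q2 + t) = 0"
      using z q e(2) by blast+
    moreover have "b * t = f (q1 + t, q2) - f (q1, q2)" "c * t = f (q1, q2 + t) - f (q1, q2)"
      by (simp_all add: f_def algebra_simps)
    ultimately have "b * t = 0" "c * t = 0" "a + b * q1 + c * q2 = 0"
      by (simp_all add: f_def)
    then have "a = 0" "b = 0" "c = 0" using t(1) by auto
    then show False using insert.prems(1) l by simp
  qed
  moreover have "\<forall>q\<in>W''. \<forall>(a, b, c)\<in>insert l L. a + b * fst q + c * snd q \<noteq> 0"
    using W'(4) by (auto simp: W''_def l f_def)
  moreover have "W'' \<subseteq> W" using W'(1) by (auto simp: W''_def)
  ultimately show ?case using op by (intro exI[of _ W''] conjI)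
qed

text \<open>\<open>Q\<close> has to avoid the points and the lines joining two of them. Collinearity
  with \<open>Q\<close> is an affine condition on \<open>q\<close>, because the terms in
  \<open>fst q * snd q\<close> cancel in the determinant.\<close>

lemma generic_projection_center:
  fixes x y z :: "'i \<Rightarrow> complex" and W :: "(complex \<times> complex) set"
  assumes I: "finite I" and W: "open W" "W \<noteq> {}"
    and pts: "\<forall>i\<in>I. (x i, y i, z i) \<noteq> (0, 0, 0)"
    and ne: "\<forall>i\<in>I. \<forall>k\<in>I. i \<noteq> k \<longrightarrow>
      (x i * y k - x k * y i, z i * y k - z k * y i, x i * z k - x k * z i) \<noteq> (0, 0, 0)"
  shows "\<exists>W'\<subseteq>W. open W' \<and> W' \<noteq> {} \<and> (\<forall>q\<in>W'.
    (\<forall>i\<in>I. x i - fst q * z i \<noteq> 0 \<or> y i - snd q * z i \<noteq> 0) \<and>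
    (\<forall>i\<in>I. \<forall>k\<in>I. i \<noteq> k \<longrightarrow>
      (x i - fst q * z i) * (y k - snd q * z k) \<noteq> (x k - fst q * z k) * (y i - snd q * z i)))"
proof -
  define L1 where "L1 = (\<lambda>(i, k). (x i * y k - x k * y i, - (z i * y k - z k * y i), - (x i * z k - x k * z i))) `
    {(i, k). i \<in> I \<and> k \<in> I \<and> i \<noteq> k}"
  \<comment> \<open>For \<open>z i \<noteq> 0\<close> it suffices to keep the first coordinate
    nonzero; for \<open>z i = 0\<close> the claim is already contained in
    \<open>pts\<close>.\<close>
  define L2 where "L2 = (\<lambda>i. (x i, - z i, 0::complex)) ` {i \<in> I. z i \<noteq> 0}"
  have "finite L1"
    unfolding L1_def by (rule finite_imageI, rule finite_subset[of _ "I \<times> I"]) (auto simp: I)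
  then have fin: "finite (L1 \<union> L2)" using I by (simp add: L2_def)
  have "(0, 0, 0) \<notin> L1 \<union> L2"
    using ne by (force simp: L1_def L2_def)
  from avoid_affine_functions[OF fin this W] obtain W' where W': "W' \<subseteq> W" "open W'" "W' \<noteq> {}"
    "\<forall>q\<in>W'. \<forall>(a, b, c)\<in>L1 \<union> L2. a + b * fst q + c * snd q \<noteq> 0"
    by blast
  have "(\<forall>i\<in>I. x i - fst q * z i \<noteq> 0 \<or> y i - snd q * z i \<noteq> 0) \<and>
    (\<forall>i\<in>I. \<forall>k\<in>I. i \<noteq> k \<longrightarrow>
      (x i - fst q * z i) * (y k - snd q * z k) \<noteq> (x k - fst q * z k) * (y i - snd q * z i))"
    if q: "q \<in> W'" for q
  proof (intro conjI ballI impI)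
    have nz: "a + b * fst q + c * snd q \<noteq> 0" if "(a, b, c) \<in> L1 \<union> L2" for a b c
      using bspec[OF bspec[OF W'(4) q] that] by simp
    fix i assume i: "i \<in> I"
    show "x i - fst q * z i \<noteq> 0 \<or> y i - snd q * z i \<noteq> 0"
    proof (cases "z i = 0")
      case True
      then show ?thesis using bspec[OF pts i] by auto
    next
      case False
      then have "(x i, - z i, 0) \<in> L1 \<union> L2" using i by (auto simp: L2_def)
      from nz[OF this] show ?thesis by (simp add: algebra_simps)
    qed
    fix k assume k: "k \<in> I" "i \<noteq> k"
    have "(x i * y k - x k * y i, - (z i * y k - z k * y i), - (x i * z k - x k * z i)) \<in> L1 \<union> L2"
      using i k by (auto simp: L1_def)
    from nz[OF this]
    show "(x i - fst q * z i) * (y k - snd q * z k) \<noteq> (x k - fst q * z k) * (y i - snd q * z i)"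
      by (simp add: algebra_simps)
  qed
  then show ?thesis using W'(1-3) by (intro exI[of _ W'] conjI ballI) simp_all
qed

text \<open>Translation moves \<open>Q = (fst q : snd q : 1)\<close> to \<open>(0 : 0 : 1)\<close>,
  so these are the values of the forms of degree \<open>e + 1\<close> with multiplicity at least
  \<open>e\<close> at \<open>Q\<close>.\<close>

definition projected_values ::
    "('i \<Rightarrow> complex) \<Rightarrow> ('i \<Rightarrow> complex) \<Rightarrow> ('i \<Rightarrow> complex) \<Rightarrow> nat \<Rightarrow> complex \<times> complex \<Rightarrow> ('i \<Rightarrow> complex) set"
  where "projected_values x y z e q =
    curve_values e (\<lambda>i. x i - fst q * z i) (\<lambda>i. y i - snd q * z i) z"

text \<open>The coefficient polynomials stay fixed and only the centre moves. The filter is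
  arbitrary because both neighbourhoods of \<open>p\<close> and paths towards \<open>p\<close> occur
  later.\<close>

lemma projected_values_deform:
  assumes "F \<in> projected_values x y z e p"
  shows "\<exists>\<phi>. \<phi> p = F \<and> (\<forall>q. \<phi> q \<in> projected_values x y z e q) \<and>
    (\<forall>i (T :: 'b filter) f. (f \<longlongrightarrow> p) T \<longrightarrow> ((\<lambda>t. \<phi> (f t) i) \<longlongrightarrow> F i) T)"
proof -
  obtain a b where F: "F = (\<lambda>i. z i * homog e a (x i - fst p * z i) (y i - snd p * z i) +
      homog (Suc e) b (x i - fst p * z i) (y i - snd p * z i))" "degree a \<le> e" "degree b \<le> Suc e"
    using assms unfolding projected_values_def curve_values_def by auto
  define \<phi> where "\<phi> q = (\<lambda>i. z i * homog e a (x i - fst q * z i) (y i - snd q * z i) +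
      homog (Suc e) b (x i - fst q * z i) (y i - snd q * z i))" for q :: "complex \<times> complex"
  have "\<phi> q \<in> projected_values x y z e q" for q
    using \<phi>_def[of q] F(2,3) unfolding projected_values_def curve_values_def by (intro CollectI exI conjI)
  moreover have "((\<lambda>t. \<phi> (f t) i) \<longlongrightarrow> F i) T" if "(f \<longlongrightarrow> p) T" for i f and T :: "'b filter"
    unfolding \<phi>_def F(1) by (intro tendsto_intros tendsto_homog that)
  moreover have "\<phi> p = F" by (simp add: \<phi>_def F(1))
  ultimately show ?thesis by (intro exI[of _ \<phi>]) simp
qed

text \<open>At a point of an open set where the number of separated pairs is maximal, that set of pairs is
  locally constant, because being separated is an open condition.\<close>

lemma locally_constant_separation:
  fixes x y z :: "'i \<Rightarrow> complex"
  assumes I: "finite I" and W: "open W" "W \<noteq> {}"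
  shows "\<exists>p\<in>W. \<forall>\<^sub>F q in nhds p. \<forall>e\<le>j. \<forall>B\<subseteq>I.
    separates (projected_values x y z e q) B \<longrightarrow> separates (projected_values x y z e p) B"
proof -
  \<comment> \<open>All \<open>e \<le> j\<close> are treated at once, since the multiplicity of the
    minimal curve is known only after \<open>p\<close> has been chosen.\<close>
  define N where "N q = {(e, B). e \<le> j \<and> B \<subseteq> I \<and> separates (projected_values x y z e q) B}" for q
  have sub: "N q \<subseteq> {..j} \<times> Pow I" for q by (auto simp: N_def)
  have fin: "finite (N q)" for q
    using finite_subset[OF sub] I by simp
  have "\<exists>p. p \<in> W \<and> (\<forall>q. q \<in> W \<longrightarrow> card (N q) \<le> card (N p))"
  proof -
    obtain p0 where "p0 \<in> W" using W(2) by blast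
    moreover have "card (N q) \<le> card ({..j} \<times> Pow I)" for q
      by (rule card_mono[OF _ sub]) (simp add: I)
    then have "\<forall>q. q \<in> W \<longrightarrow> card (N q) < Suc (card ({..j} \<times> Pow I))"
      by (simp only: less_Suc_eq_le) simp
    ultimately show ?thesis
      using ex_has_greatest_nat[of "\<lambda>q. q \<in> W" p0 "\<lambda>q. card (N q)"] by blast
  qed
  then obtain p where p: "p \<in> W" "\<And>q. q \<in> W \<Longrightarrow> card (N q) \<le> card (N p)" by blast
  have "\<forall>\<^sub>F q in nhds p. \<forall>b\<in>N p. b \<in> N q"
  proof (subst eventually_ball_finite_distrib[OF fin], rule ballI)
    fix eB assume "eB \<in> N p"
    then obtain e B where eB: "eB = (e, B)" "e \<le> j" "B \<subseteq> I" "separates (projected_values x y z e p) B"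
      by (auto simp: N_def)
    have finB: "finite B" using eB(3) I finite_subset by blast
    have ls: "linear_space (projected_values x y z e q)" for q
      unfolding projected_values_def by (rule linear_space_curve_values)
    obtain F where "\<forall>b\<in>B. F b \<in> projected_values x y z e p"
      "\<forall>b\<in>B. \<forall>i\<in>B. F b i = (if i = b then 1 else 0)"
      using separates_interpolate[OF ls finB eB(4)] by blast
    note F = this[rule_format]
    have "\<exists>\<phi>. (\<forall>q. \<phi> q \<in> projected_values x y z e q) \<and>
        (\<forall>i. ((\<lambda>q. \<phi> q i) \<longlongrightarrow> F b i) (nhds p))" if "b \<in> B" for b
    proof -
      from projected_values_deform[OF F(1)[OF that]] obtain \<phi> where \<phi>:
        "\<forall>q. \<phi> q \<in> projected_values x y z e q"
        "\<forall>i (T :: (complex \<times> complex) filter) f. (f \<longlongrightarrow> p) T \<longrightarrow> ((\<lambda>t. \<phi> (f t) i) \<longlongrightarrow> F b i) T"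
        by blast
      have "((\<lambda>q. \<phi> q i) \<longlongrightarrow> F b i) (nhds p)" for i
        by (rule \<phi>(2)[rule_format]) (rule filterlim_ident)
      with \<phi>(1) show ?thesis by (intro exI[of _ \<phi>]) simp
    qed
    then obtain \<phi> where \<phi>: "\<forall>b\<in>B. (\<forall>q. \<phi> b q \<in> projected_values x y z e q) \<and>
        (\<forall>i. ((\<lambda>q. \<phi> b q i) \<longlongrightarrow> F b i) (nhds p))"
      by metis
    have "\<forall>\<^sub>F q in nhds p. separates (projected_values x y z e q) B"
    proof (rule eventually_separates[OF finB ls])
      show "\<forall>\<^sub>F q in nhds p. \<forall>b\<in>B. \<phi> b q \<in> projected_values x y z e q"
        using \<phi> by (intro always_eventually allI) blast
      fix b i assume bi: "b \<in> B" "i \<in> B"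
      show "((\<lambda>q. \<phi> b q i) \<longlongrightarrow> (if i = b then 1 else 0)) (nhds p)"
        unfolding F(2)[OF bi, symmetric] using \<phi> bi(1) by blast
    qed
    then show "\<forall>\<^sub>F q in nhds p. eB \<in> N q"
      by eventually_elim (use eB in \<open>simp add: N_def\<close>)
  qed
  then have "\<forall>\<^sub>F q in nhds p. N q = N p"
    using eventually_nhds_in_open[OF W(1) p(1)]
  proof eventually_elim
    case (elim q)
    then have "N p \<subseteq> N q" by blast
    then show ?case using card_seteq[OF fin _ p(2)] elim(2) by blast
  qed
  then have "\<forall>\<^sub>F q in nhds p. \<forall>e\<le>j. \<forall>B\<subseteq>I.
    separates (projected_values x y z e q) B \<longrightarrow> separates (projected_values x y z e p) B"
  proof eventually_elim
    case (elim q)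
    then show ?case by (auto simp: N_def set_eq_iff)
  qed
  with p(1) show ?thesis by blast
qed

text \<open>With \<open>A\<close> and \<open>B\<close> fixed and the centre moving, the values
  vanish on \<open>S\<close> at time \<open>0\<close>, and their derivative is quadratic in
  \<open>w\<close> with a partial derivative of \<open>A\<close> as leading coefficient. By
  \<open>velocity_in_space\<close> this derivative is also the value vector of a curve at the
  original centre; the equation states that the two agree.\<close>

lemma first_order_deformation:
  fixes x y z :: "'i \<Rightarrow> complex" and p :: "complex \<times> complex" and l :: complex
  defines "X \<equiv> \<lambda>i. x i - fst p * z i"
  defines "U \<equiv> \<lambda>i. y i - snd p * z i - l * X i"
  assumes S: "finite S" and e: "Suc e \<le> j"
    and const: "\<forall>\<^sub>F q in nhds p. \<forall>e\<le>j. \<forall>B\<subseteq>S.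
      separates (projected_values x y z e q) B \<longrightarrow> separates (projected_values x y z e p) B"
    and U0: "\<And>i. i \<in> S \<Longrightarrow> U i \<noteq> 0"
    and A: "degree A \<le> Suc e" and B: "degree B \<le> Suc (Suc e)"
    and g: "\<And>i. i \<in> S \<Longrightarrow> z i / U i * poly A (X i / U i) + poly B (X i / U i) = 0"
  shows "\<exists>A1 B1. degree A1 \<le> Suc e \<and> degree B1 \<le> Suc (Suc e) \<and> (\<forall>i\<in>S.
    (z i / U i)^2 * poly (smult v1 (pderiv A) + smult v2 (smult (of_nat (Suc e)) A - [:0, 1:] * pderiv A)) (X i / U i)
      + z i / U i * poly A1 (X i / U i) + poly B1 (X i / U i) = 0)"
proof -
  \<comment> \<open>The summand \<open>l * v1\<close> compensates the shear: in the coordinates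
    \<open>X\<close>, \<open>U\<close> the centre moves with velocity
    \<open>(v1, v2)\<close>.\<close>
  define f where "f t = p + (t * v1, t * (v2 + l * v1))" for t :: complex
  define Xt where "Xt t = (\<lambda>i. X i - t * (v1 * z i))" for t
  define Ut where "Ut t = (\<lambda>i. U i - t * (v2 * z i))" for t
  define V where "V t = projected_values x y z (Suc e) (f t)" for t
  have ls: "linear_space (V t)" for t
    unfolding V_def projected_values_def by (rule linear_space_curve_values)
  have V: "V t = curve_values (Suc e) (Xt t) (Ut t) z" for t
  proof -
    have 1: "(\<lambda>i. x i - fst (f t) * z i) = Xt t"
      by (simp add: f_def Xt_def X_def algebra_simps)
    have 2: "(\<lambda>i. y i - snd (f t) * z i - l * Xt t i) = Ut t"
      by (simp add: f_def Xt_def X_def Ut_def U_def algebra_simps)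
    show ?thesis
      unfolding V_def projected_values_def 1
      using curve_values_shear[of "Suc e" "Xt t" "\<lambda>i. y i - snd (f t) * z i" l z] unfolding 2 by simp
  qed
  have f0: "f 0 = p" by (simp add: f_def prod_eq_iff)
  have flim: "(f \<longlongrightarrow> p) (at 0)"
  proof -
    have "(f \<longlongrightarrow> p + (0 * v1, 0 * (v2 + l * v1))) (at 0)"
      unfolding f_def by (intro tendsto_intros)
    then show ?thesis by (simp add: zero_prod_def[symmetric])
  qed
  define g where "g t = (\<lambda>i. z i * homog (Suc e) A (Xt t i) (Ut t i) + homog (Suc (Suc e)) B (Xt t i) (Ut t i))" for t
  define C where "C = smult v1 (pderiv A) + smult v2 (smult (of_nat (Suc e)) A - [:0, 1:] * pderiv A)"
  define C' where "C' = smult v1 (pderiv B) + smult v2 (smult (of_nat (Suc (Suc e))) B - [:0, 1:] * pderiv B)"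
  have hd: "((\<lambda>t. homog (Suc n) P (Xt t i) (Ut t i)) has_field_derivative
      - (z i * U i ^ n * poly (smult v1 (pderiv P) + smult v2 (smult (of_nat (Suc n)) P - [:0, 1:] * pderiv P)) (X i / U i))) (at 0)"
    if "i \<in> S" "degree P \<le> Suc n" for i n P
  proof -
    have "((\<lambda>t. homog (Suc n) P (X i - t * (v1 * z i)) (U i - t * (v2 * z i))) has_field_derivative
      - (U i ^ n * poly (smult (v1 * z i) (pderiv P) + smult (v2 * z i) (smult (of_nat (Suc n)) P - [:0, 1:] * pderiv P)) (X i / U i))) (at 0)"
      by (rule homog_derivative[OF that(2) U0[OF that(1)]])
    then show ?thesis
      unfolding Xt_def Ut_def by (rule DERIV_cong) (simp add: algebra_simps)
  qed
  have "\<exists>F\<in>V 0. \<forall>i\<in>S. F i = z i * (- (z i * U i ^ e * poly C (X i / U i))) +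
      (- (z i * U i ^ Suc e * poly C' (X i / U i)))"
  proof (rule velocity_in_space[of V S g])
    show "linear_space (V t)" for t by (rule ls)
    show "finite S" by (rule S)
    show "\<exists>\<phi>. \<phi> 0 = F \<and> (\<forall>t. \<phi> t \<in> V t) \<and> (\<forall>i. ((\<lambda>t. \<phi> t i) \<longlongrightarrow> F i) (at 0))" if F: "F \<in> V 0" for F
    proof -
      obtain \<phi> where \<phi>: "\<phi> p = F" "\<forall>q. \<phi> q \<in> projected_values x y z (Suc e) q"
        "\<forall>i (T :: complex filter) f. (f \<longlongrightarrow> p) T \<longrightarrow> ((\<lambda>t. \<phi> (f t) i) \<longlongrightarrow> F i) T"
        using projected_values_deform[of F x y z "Suc e" p] F unfolding V_def f0 by blast
      show ?thesis
      proof (intro exI conjI allI)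
        show "\<phi> (f 0) = F" by (simp add: f0 \<phi>(1))
        show "\<phi> (f t) \<in> V t" for t unfolding V_def by (rule \<phi>(2)[rule_format])
        show "((\<lambda>t. \<phi> (f t) i) \<longlongrightarrow> F i) (at 0)" for i by (rule \<phi>(3)[rule_format, OF flim])
      qed
    qed
    show "\<forall>\<^sub>F t in at 0. \<forall>B\<subseteq>S. separates (V t) B \<longrightarrow> separates (V 0) B"
      using eventually_compose_filterlim[OF const flim]
    proof eventually_elim
      case (elim t)
      then show ?case unfolding V_def f0 using e by blast
    qed
    show "g t \<in> V t" for t
      using g_def[of t] A B unfolding V curve_values_def by (intro CollectI exI conjI)
    show "g 0 i = 0" if "i \<in> S" for i
    proof -
      have 0: "Xt 0 i = X i" "Ut 0 i = U i" by (simp_all add: Xt_def Ut_def)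
      have "g 0 i = z i * (U i ^ Suc e * poly A (X i / U i)) + U i ^ Suc (Suc e) * poly B (X i / U i)"
        by (simp only: g_def 0 homog_eq[OF A U0[OF that]] homog_eq[OF B U0[OF that]])
      also have "\<dots> = U i ^ Suc (Suc e) * (z i / U i * poly A (X i / U i) + poly B (X i / U i))"
        using U0[OF that] by (simp add: distrib_left)
      finally have "g 0 i = U i ^ Suc (Suc e) * (z i / U i * poly A (X i / U i) + poly B (X i / U i))" .
      then show ?thesis using assms(9)[OF that] by simp
    qed
    show "((\<lambda>t. g t i) has_field_derivative z i * (- (z i * U i ^ e * poly C (X i / U i))) +
      (- (z i * U i ^ Suc e * poly C' (X i / U i)))) (at 0)" if "i \<in> S" for i
      unfolding g_def C_def C'_def
      by (intro DERIV_add DERIV_cmult hd that A B)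
  qed
  then obtain F where F: "F \<in> V 0" "\<And>i. i \<in> S \<Longrightarrow> F i = z i * (- (z i * U i ^ e * poly C (X i / U i))) +
      (- (z i * U i ^ Suc e * poly C' (X i / U i)))" by blast
  from F(1) obtain a b where ab: "F = (\<lambda>i. z i * homog (Suc e) a (X i) (U i) + homog (Suc (Suc e)) b (X i) (U i))"
    "degree a \<le> Suc e" "degree b \<le> Suc (Suc e)"
    unfolding V curve_values_def Xt_def Ut_def by auto
  \<comment> \<open>\<open>C'\<close> comes from differentiating \<open>B\<close> and joins the
    terms linear in \<open>w\<close>, so its degree must be one less than the bound for
    \<open>B\<close>.\<close>
  have "degree C' \<le> Suc e"
    unfolding C'_def
    using degree_euler_diff[OF B] B
    by (intro degree_add_le order_trans[OF degree_smult_le]) (auto simp: degree_pderiv)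
  then have "degree (C' + a) \<le> Suc e" using ab(2) by (rule degree_add_le)
  moreover have "(z i / U i)^2 * poly C (X i / U i) + z i / U i * poly (C' + a) (X i / U i) + poly b (X i / U i) = 0"
    if i: "i \<in> S" for i
  proof -
    note u = U0[OF i]
    define s where "s = X i / U i"
    have "F i = z i * (U i ^ Suc e * poly a s) + U i ^ Suc (Suc e) * poly b s"
      unfolding ab(1) s_def by (simp only: homog_eq[OF ab(2) u] homog_eq[OF ab(3) u])
    then have F': "z i * (- (z i * U i ^ e * poly C s)) + (- (z i * U i ^ Suc e * poly C' s)) =
        z i * (U i ^ Suc e * poly a s) + U i ^ Suc (Suc e) * poly b s"
      unfolding F(2)[OF i] s_def .
    have clear: "k * v * v * ((r / v) * (r / v) * c + r / v * d + m) = k * (r * r * c + r * v * d + v * v * m)"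
      if "v \<noteq> 0" for k v r c d m :: complex
      using that by (simp add: field_simps)
    have "U i ^ e * U i * U i * ((z i / U i) * (z i / U i) * poly C s + z i / U i * poly (C' + a) s + poly b s) = 0"
    proof -
      have "U i ^ e * (z i * z i * poly C s + z i * U i * poly (C' + a) s + U i * U i * poly b s) =
        (z i * (U i ^ Suc e * poly a s) + U i ^ Suc (Suc e) * poly b s) -
        (z i * (- (z i * U i ^ e * poly C s)) + (- (z i * U i ^ Suc e * poly C' s)))"
        by (simp add: algebra_simps)
      then show ?thesis unfolding clear[OF u] F' by simp
    qed
    then show ?thesis using u by (simp add: s_def power2_eq_square)
  qed
  ultimately show ?thesis
    unfolding C_def using ab(3) by blast
qed

section \<open>Relations between points in general projection\<close>

lemma sum_poly_eq_0:
  fixes c s :: "'i \<Rightarrow> complex"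
  assumes "\<And>k. k \<le> d \<Longrightarrow> (\<Sum>i\<in>I. c i * s i ^ k) = 0" "degree p \<le> d"
  shows "(\<Sum>i\<in>I. c i * poly p (s i)) = 0"
proof -
  have "(\<Sum>i\<in>I. c i * poly p (s i)) = (\<Sum>i\<in>I. \<Sum>k\<le>degree p. coeff p k * (c i * s i ^ k))"
    by (simp add: poly_altdef sum_distrib_left mult_ac)
  also have "\<dots> = (\<Sum>k\<le>degree p. coeff p k * (\<Sum>i\<in>I. c i * s i ^ k))"
    by (subst sum.swap) (simp add: sum_distrib_left)
  also have "\<dots> = 0" using assms by (intro sum.neutral) auto
  finally show ?thesis .
qed

lemma on_curve_frame:
  assumes "\<And>i. i \<in> S \<Longrightarrow> U i \<noteq> 0"
  shows "on_curve e X U Z S \<longleftrightarrow> (\<exists>a b. degree a \<le> e \<and> degree b \<le> Suc e \<and> (a \<noteq> 0 \<or> b \<noteq> 0) \<and>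
    (\<forall>i\<in>S. Z i / U i * poly a (X i / U i) + poly b (X i / U i) = 0))"
proof -
  have "Z i * homog e a (X i) (U i) + homog (Suc e) b (X i) (U i) = 0 \<longleftrightarrow>
      Z i / U i * poly a (X i / U i) + poly b (X i / U i) = 0"
    if "degree a \<le> e" "degree b \<le> Suc e" "i \<in> S" for a b i
  proof -
    have "Z i * homog e a (X i) (U i) + homog (Suc e) b (X i) (U i) =
        U i ^ Suc e * (Z i / U i * poly a (X i / U i) + poly b (X i / U i))"
      using assms[OF that(3)]
      by (simp add: homog_eq[OF that(1)] homog_eq[OF that(2)] distrib_left)
    then show ?thesis using assms[OF that(3)] by simp
  qed
  then show ?thesis unfolding on_curve_def by (intro ex_cong1) auto
qed

text \<open>Each point forbids at most one slope \<open>l\<close>, and the nonzero binary form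
  forbids only the finitely many roots of its restriction to \<open>(1, l)\<close>.\<close>

lemma generic_shear:
  fixes X Y :: "'i \<Rightarrow> complex"
  assumes "finite I" "\<And>i. i \<in> I \<Longrightarrow> X i \<noteq> 0 \<or> Y i \<noteq> 0" "degree a \<le> e" "a \<noteq> 0"
  shows "\<exists>l. (\<forall>i\<in>I. Y i - l * X i \<noteq> 0) \<and> homog e a 1 l \<noteq> 0"
proof -
  define p where "p = (\<Sum>k\<le>e. monom (coeff a k) (e - k))"
  have p: "poly p l = homog e a 1 l" for l
    by (simp add: p_def homog_def poly_sum poly_monom)
  have "coeff p (e - degree a) = (\<Sum>k\<le>e. if k = degree a then coeff a k else 0)"
    unfolding p_def coeff_sum using assms(3) by (intro sum.cong) auto
  then have "p \<noteq> 0" using assms(3,4) by auto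
  then have "finite {l. poly p l = 0}" by (rule poly_roots_finite)
  moreover have "finite (\<Union>i\<in>I. {l. Y i - l * X i = 0})"
  proof (intro finite_UN_I assms(1))
    fix i assume i: "i \<in> I"
    have "{l. Y i - l * X i = 0} \<subseteq> {Y i / X i}"
      using assms(2)[OF i] by (auto simp: field_simps)
    then show "finite {l. Y i - l * X i = 0}" using finite_subset by blast
  qed
  ultimately have "finite ({l. poly p l = 0} \<union> (\<Union>i\<in>I. {l. Y i - l * X i = 0}))" by blast
  then obtain l where "l \<notin> {l. poly p l = 0} \<union> (\<Union>i\<in>I. {l. Y i - l * X i = 0})"
    using ex_new_if_finite[OF infinite_UNIV_char_0] by blast
  then show ?thesis using p by auto
qed

text \<open>The weight \<open>U i ^ Suc j\<close> comes from dehomogenising forms of degree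
  \<open>j + 1\<close>. Monomials as \<open>b\<close> and as \<open>a\<close> give the power sums
  without and with a factor \<open>w\<close>.\<close>

lemma curve_values_relations:
  fixes X U Z c :: "'i \<Rightarrow> complex"
  assumes U: "\<And>i. i \<in> I \<Longrightarrow> U i \<noteq> 0"
    and c: "\<And>F. F \<in> curve_values j X U Z \<Longrightarrow> (\<Sum>i\<in>I. c i * F i) = 0"
  shows "k \<le> j + 1 \<Longrightarrow> (\<Sum>i\<in>I. c i * U i ^ Suc j * (X i / U i) ^ k) = 0"
    and "k \<le> j \<Longrightarrow> (\<Sum>i\<in>I. c i * U i ^ Suc j * (Z i / U i) * (X i / U i) ^ k) = 0"
proof -
  define s where "s = (\<lambda>i. X i / U i)"
  define w where "w = (\<lambda>i. Z i / U i)"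
  define c' where "c' = (\<lambda>i. c i * U i ^ Suc j)"
  have kill: "(\<Sum>i\<in>I. c' i * w i * poly a (s i) + c' i * poly b (s i)) = 0"
    if ab: "degree a \<le> j" "degree b \<le> Suc j" for a b
  proof -
    have "(\<lambda>i. Z i * homog j a (X i) (U i) + homog (Suc j) b (X i) (U i)) \<in> curve_values j X U Z"
      unfolding curve_values_def using ab by blast
    from c[OF this] show ?thesis
      by (rule trans[OF sum.cong[OF refl], rotated])
        (use U in \<open>simp add: homog_eq[OF ab(1)] homog_eq[OF ab(2)] c'_def w_def s_def algebra_simps\<close>)
  qed
  show "(\<Sum>i\<in>I. c i * U i ^ Suc j * (X i / U i) ^ k) = 0" if "k \<le> j + 1"
    using kill[of 0 "monom 1 k"] that by (simp add: poly_monom degree_monom_eq c'_def s_def)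
  show "(\<Sum>i\<in>I. c i * U i ^ Suc j * (Z i / U i) * (X i / U i) ^ k) = 0" if "k \<le> j"
    using kill[of "monom 1 k" 0] that by (simp add: poly_monom degree_monom_eq c'_def s_def w_def)
qed

text \<open>There are \<open>j + 2\<close> vanishing power sums of \<open>c'\<close> and
  \<open>j + 1\<close> of \<open>c' * w\<close>, so the residue polynomials have degrees at most
  \<open>card I - 3 - j\<close> and \<open>card I - 2 - j\<close>, the right ones for the
  coefficients of a curve. That \<open>R\<close> is nonzero forces
  \<open>j + 3 \<le> card I\<close>.\<close>

lemma relation_gives_curve:
  fixes X U Z c :: "'i \<Rightarrow> complex"
  assumes I: "finite I" and U: "\<And>i. i \<in> I \<Longrightarrow> U i \<noteq> 0" and inj: "inj_on (\<lambda>i. X i / U i) I"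
    and c: "\<And>F. F \<in> curve_values j X U Z \<Longrightarrow> (\<Sum>i\<in>I. c i * F i) = 0" "\<exists>i\<in>I. c i \<noteq> 0"
  shows "j + 3 \<le> card I \<and> on_curve (card I - 3 - j) X U Z I"
proof -
  define s where "s = (\<lambda>i. X i / U i)"
  define w where "w = (\<lambda>i. Z i / U i)"
  define c' where "c' = (\<lambda>i. c i * U i ^ Suc j)"
  have k1: "(\<Sum>i\<in>I. c' i * s i ^ k) = 0" if "k < j + 2" for k
    using curve_values_relations(1)[of I U j X Z c k] U c(1) that by (simp add: c'_def s_def)
  have k2: "(\<Sum>i\<in>I. c' i * w i * s i ^ k) = 0" if "k < j + 1" for k
    using curve_values_relations(2)[of I U j X Z c k] U c(1) that by (simp add: c'_def s_def w_def)
  obtain R where R: "\<And>i. i \<in> I \<Longrightarrow> poly R (s i) = c' i * (\<Prod>k\<in>I - {i}. s i - s k)"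
    "degree R + (j + 2) < card I \<or> R = 0"
    using residue_poly[OF I k1] by blast
  obtain R1 where R1: "\<And>i. i \<in> I \<Longrightarrow> poly R1 (s i) = c' i * w i * (\<Prod>k\<in>I - {i}. s i - s k)"
    "degree R1 + (j + 1) < card I \<or> R1 = 0"
    using residue_poly[OF I k2] by blast
  have "R \<noteq> 0"
  proof
    assume R0: "R = 0"
    obtain i where i: "i \<in> I" "c i \<noteq> 0" using c(2) by blast
    have "(\<Prod>k\<in>I - {i}. s i - s k) \<noteq> 0"
      using I inj i(1) by (auto simp: s_def inj_on_def)
    then show False using R(1)[OF i(1)] i U by (simp add: R0 c'_def)
  qed
  then have d: "degree R + (j + 2) < card I" using R(2) by blast
  have "\<exists>a b. degree a \<le> card I - 3 - j \<and> degree b \<le> Suc (card I - 3 - j) \<and> (a \<noteq> 0 \<or> b \<noteq> 0) \<and>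
    (\<forall>i\<in>I. Z i / U i * poly a (X i / U i) + poly b (X i / U i) = 0)"
  proof (intro exI conjI ballI)
    show "degree R \<le> card I - 3 - j" using d by linarith
    show "degree (- R1) \<le> Suc (card I - 3 - j)" using d R1(2) by auto
    show "R \<noteq> 0 \<or> - R1 \<noteq> 0" using \<open>R \<noteq> 0\<close> by simp
    show "Z i / U i * poly R (X i / U i) + poly (- R1) (X i / U i) = 0" if "i \<in> I" for i
      using R(1)[OF that] R1(1)[OF that] by (simp add: s_def w_def)
  qed
  then have "on_curve (card I - 3 - j) X U Z I"
    by (subst on_curve_frame[OF U]) simp_all
  with d show ?thesis by simp
qed

text \<open>The product of the linear factors of all points outside \<open>S\<close> but one
  isolates the value of \<open>f\<close> at the remaining point.\<close>

lemma vanish_off_subset: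
  fixes s c f :: "'i \<Rightarrow> complex"
  assumes I: "finite I" "S \<subseteq> I" and inj: "inj_on s I"
    and f: "\<And>i. i \<in> S \<Longrightarrow> f i = 0"
    and c: "\<And>p. degree p + 1 \<le> card (I - S) \<Longrightarrow> (\<Sum>i\<in>I. f i * poly p (s i)) = 0"
    and i: "i \<in> I"
  shows "f i = 0"
proof (cases "i \<in> S")
  case False
  define T where "T = I - S"
  define p where "p = (\<Prod>k\<in>T - {i}. [:- s k, 1:])"
  have fin: "finite T" and iT: "i \<in> T" using I i False by (auto simp: T_def)
  have z: "poly p (s k) = 0" if "k \<in> T" "k \<noteq> i" for k
    using that fin by (auto simp: p_def poly_prod)
  have "card T > 0" using fin iT by (auto simp: card_gt_0_iff)
  then have "0 = (\<Sum>k\<in>I. f k * poly p (s k))"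
    using degree_linear_factors[of "T - {i}" s] fin iT
    by (intro c[symmetric]) (auto simp: p_def T_def[symmetric] card_Diff_singleton)
  also have "\<dots> = (\<Sum>k\<in>I. if k = i then f i * poly p (s i) else 0)"
    using z f by (intro sum.cong refl) (auto simp: T_def)
  also have "\<dots> = f i * poly p (s i)" using I i by simp
  finally have "f i * poly p (s i) = 0" by simp
  moreover have "poly p (s i) \<noteq> 0"
    using fin inj i by (auto simp: p_def poly_prod T_def inj_on_def)
  ultimately show ?thesis by simp
qed (rule f)

text \<open>The points of \<open>S\<close> lie on a line and \<open>c\<close> is supported on that line, where a form of degree \<open>j + 1\<close>
  restricts to a polynomial in \<open>s\<close> of degree at most \<open>j + 1\<close>.\<close>

lemma line_kills_forms:
  fixes s w c :: "'i \<Rightarrow> complex"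
  assumes I: "finite I" "S \<subseteq> I" and inj: "inj_on s I"
    and \<alpha>: "\<alpha> \<noteq> 0" "degree B \<le> 1" "\<And>i. i \<in> S \<Longrightarrow> \<alpha> * w i + poly B (s i) = 0"
    and card: "card (I - S) \<le> j"
    and c: "\<And>k. k \<le> j + 1 \<Longrightarrow> (\<Sum>i\<in>I. c i * s i ^ k) = 0" "\<And>k. k \<le> j \<Longrightarrow> (\<Sum>i\<in>I. c i * w i * s i ^ k) = 0"
    and klm: "k + m + n = j + 1"
  shows "(\<Sum>i\<in>I. c i * (s i + q1 * w i) ^ k * (1 + l * s i + q2 * w i) ^ m * w i ^ n) = 0"
proof -
  \<comment> \<open>At most \<open>j\<close> points lie off \<open>S\<close>, so enough power sums
    of \<open>f\<close> vanish to make it zero everywhere: a point with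
    \<open>c i \<noteq> 0\<close> lies on the line.\<close>
  define f where "f i = c i * (\<alpha> * w i + poly B (s i))" for i
  have f0: "f i = 0" if "i \<in> I" for i
  proof (rule vanish_off_subset[OF I inj _ _ that])
    show "f i = 0" if "i \<in> S" for i using \<alpha>(3)[OF that] by (simp add: f_def)
    fix p :: "complex poly" assume p: "degree p + 1 \<le> card (I - S)"
    have "(\<Sum>i\<in>I. f i * poly p (s i)) =
        \<alpha> * (\<Sum>i\<in>I. c i * w i * poly p (s i)) + (\<Sum>i\<in>I. c i * poly (B * p) (s i))"
      by (simp add: f_def sum_distrib_left sum.distrib algebra_simps)
    moreover have "(\<Sum>i\<in>I. c i * w i * poly p (s i)) = 0"
      by (rule sum_poly_eq_0[of j]) (use c(2) p card in auto)
    moreover have "(\<Sum>i\<in>I. c i * poly (B * p) (s i)) = 0"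
      by (rule sum_poly_eq_0[of "j + 1"]) (use c(1) p card \<alpha>(2) degree_mult_le[of B p] in auto)
    ultimately show "(\<Sum>i\<in>I. f i * poly p (s i)) = 0" by simp
  qed
  define L where "L = smult (- inverse \<alpha>) B"
  define P where "P = ([:0, 1:] + smult q1 L) ^ k * ([:1, l:] + smult q2 L) ^ m * L ^ n"
  have dL: "degree L \<le> 1" using \<alpha>(2) degree_smult_le[of _ B] le_trans unfolding L_def by blast
  have dl: "degree ([:0, 1:] + smult q1 L) \<le> 1" "degree ([:1, l:] + smult q2 L) \<le> 1"
    using dL by (auto intro!: degree_add_le intro: order_trans[OF degree_smult_le])
  have dp: "degree (Q ^ r) \<le> r" if "degree Q \<le> 1" for Q :: "complex poly" and r
    using degree_power_le[of Q r] that mult_le_mono1[OF that, of r] by linarith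
  have "degree P \<le> j + 1"
    unfolding P_def klm[symmetric]
    using dp[OF dl(1), of k] dp[OF dl(2), of m] dp[OF dL, of n]
      degree_mult_le[of "([:0, 1:] + smult q1 L) ^ k" "([:1, l:] + smult q2 L) ^ m"]
      degree_mult_le[of "([:0, 1:] + smult q1 L) ^ k * ([:1, l:] + smult q2 L) ^ m" "L ^ n"] by linarith
  have "c i * (s i + q1 * w i) ^ k * (1 + l * s i + q2 * w i) ^ m * w i ^ n = c i * poly P (s i)"
    if "i \<in> I" for i
  proof (cases "c i = 0")
    case False
    then have "\<alpha> * w i + poly B (s i) = 0" using f0[OF that] by (simp add: f_def)
    then have "\<alpha> * w i = - poly B (s i)" by (simp add: add_eq_0_iff)
    then have "w i = poly L (s i)" using \<alpha>(1) by (simp add: L_def field_simps)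
    then show ?thesis by (simp add: P_def mult_ac)
  qed simp
  then have "(\<Sum>i\<in>I. c i * (s i + q1 * w i) ^ k * (1 + l * s i + q2 * w i) ^ m * w i ^ n) =
      (\<Sum>i\<in>I. c i * poly P (s i))"
    by (rule sum.cong[OF refl])
  also have "\<dots> = 0" by (rule sum_poly_eq_0[OF c(1) \<open>degree P \<le> j + 1\<close>])
  finally show ?thesis .
qed

text \<open>\<open>kill\<close> ranges over all centres and shears because \<open>p\<close> and
  \<open>l\<close> are chosen only in the proof. The relation in \<open>extra\<close> may change
  with the centre, whereas \<open>c\<close> may not.\<close>

theorem no_relation_of_general_position:
  fixes x y z c :: "'i \<Rightarrow> complex" and W :: "(complex \<times> complex) set"
  assumes I: "finite I" and W: "open W" "W \<noteq> {}"
    and pts: "\<forall>i\<in>I. (x i, y i, z i) \<noteq> (0, 0, 0)"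
    and ne: "\<forall>i\<in>I. \<forall>k\<in>I. i \<noteq> k \<longrightarrow>
      (x i * y k - x k * y i, z i * y k - z k * y i, x i * z k - x k * z i) \<noteq> (0, 0, 0)"
    and curve: "\<And>q. q \<in> W \<Longrightarrow> on_curve j (\<lambda>i. x i - fst q * z i) (\<lambda>i. y i - snd q * z i) z I"
    and extra: "\<And>q. q \<in> W \<Longrightarrow> \<exists>c. (\<forall>F\<in>projected_values x y z j q. (\<Sum>i\<in>I. c i * F i) = 0) \<and>
      (\<exists>k l m. k + l + m = j + 1 \<and> (\<Sum>i\<in>I. c i * x i ^ k * y i ^ l * z i ^ m) \<noteq> 0)"
    and kill: "\<And>q1 q2 l k m. k + m \<le> j \<Longrightarrow>
      (\<Sum>i\<in>I. c i * (x i - q1 * z i) ^ k * (y i - q2 * z i - l * (x i - q1 * z i)) ^ (j - k - m) * z i ^ m) = 0"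
    and i: "i \<in> I"
  shows "c i = 0"
proof -
  obtain W' where W': "W' \<subseteq> W" "open W'" "W' \<noteq> {}"
    and gen: "\<forall>q\<in>W'. (\<forall>i\<in>I. x i - fst q * z i \<noteq> 0 \<or> y i - snd q * z i \<noteq> 0) \<and>
    (\<forall>i\<in>I. \<forall>k\<in>I. i \<noteq> k \<longrightarrow>
      (x i - fst q * z i) * (y k - snd q * z k) \<noteq> (x k - fst q * z k) * (y i - snd q * z i))"
    using generic_projection_center[OF I W pts ne] by (elim exE conjE) (rule that)
  obtain p where p: "p \<in> W'" and const: "\<forall>\<^sub>F q in nhds p. \<forall>e\<le>j. \<forall>B\<subseteq>I.
      separates (projected_values x y z e q) B \<longrightarrow> separates (projected_values x y z e p) B"
    using locally_constant_separation[OF I W'(2,3)] by blast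
  have pW: "p \<in> W" using p W'(1) by blast
  define X where "X = (\<lambda>i. x i - fst p * z i)"
  define Y where "Y = (\<lambda>i. y i - snd p * z i)"
  have XY: "X i \<noteq> 0 \<or> Y i \<noteq> 0" if "i \<in> I" for i
    using gen p that by (auto simp: X_def Y_def)
  have det: "X i * Y k \<noteq> X k * Y i" if "i \<in> I" "k \<in> I" "i \<noteq> k" for i k
    using gen p that by (simp add: X_def Y_def)
  have inj: "inj_on (\<lambda>i. X i / (Y i - l * X i)) I" if "\<And>i. i \<in> I \<Longrightarrow> Y i - l * X i \<noteq> 0" for l
  proof (rule inj_onI, rule ccontr)
    fix i k assume ik: "i \<in> I" "k \<in> I" "X i / (Y i - l * X i) = X k / (Y k - l * X k)" "i \<noteq> k"
    then have "X i * (Y k - l * X k) = X k * (Y i - l * X i)"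
      using that by (simp add: frac_eq_eq)
    then have "X i * Y k = X k * Y i" by (simp add: algebra_simps)
    then show False using det ik by blast
  qed
  obtain c0 kk ll mm where c0: "\<forall>F\<in>curve_values j X Y z. (\<Sum>i\<in>I. c0 i * F i) = 0"
    and klm: "kk + ll + mm = j + 1" "(\<Sum>i\<in>I. c0 i * x i ^ kk * y i ^ ll * z i ^ mm) \<noteq> 0"
    using extra[OF pW] unfolding projected_values_def X_def[symmetric] Y_def[symmetric]
    by (elim exE conjE) (rule that)
  have c0': "(\<Sum>i\<in>I. c0 i * F i) = 0" if "F \<in> curve_values j X (\<lambda>i. Y i - l * X i) z" for F l
    using c0 that unfolding curve_values_shear by simp
  \<comment> \<open>A preliminary shear that brings all points into one affine chart; the final
    \<open>l\<close> depends on the curve found below. The constant form \<open>1\<close> makes the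
    second condition automatic.\<close>
  have "\<exists>l. (\<forall>i\<in>I. Y i - l * X i \<noteq> 0) \<and> homog 0 1 1 l \<noteq> 0"
    by (rule generic_shear[OF I XY]) simp_all
  then obtain l0 where l0: "\<And>i. i \<in> I \<Longrightarrow> Y i - l0 * X i \<noteq> 0" by blast
  have "\<exists>i\<in>I. c0 i \<noteq> 0"
  proof (rule ccontr)
    assume "\<not> ?thesis"
    then have "(\<Sum>i\<in>I. c0 i * x i ^ kk * y i ^ ll * z i ^ mm) = 0" by (intro sum.neutral) auto
    then show False using klm(2) by simp
  qed
  then have "j + 3 \<le> card I \<and> on_curve (card I - 3 - j) X (\<lambda>i. Y i - l0 * X i) z I"
    by (intro relation_gives_curve[OF I l0 inj[OF l0] c0'[where l = l0]])
  then have n: "j + 3 \<le> card I" and cn: "on_curve (card I - 3 - j) X Y z I"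
    using on_curve_shear by blast+
  \<comment> \<open>The smaller of the two multiplicities satisfies both
    \<open>\<kappa> \<le> j\<close> and \<open>2 * \<kappa> + 3 \<le> card I\<close>.\<close>
  define \<kappa> where "\<kappa> = min j (card I - 3 - j)"
  have "on_curve \<kappa> X Y z I"
    using curve[OF pW] cn unfolding \<kappa>_def min_def X_def[symmetric] Y_def[symmetric] by simp
  \<comment> \<open>One point may be dropped for each unit by which the multiplicity falls below
    \<open>\<kappa>\<close>.\<close>
  define P where "P e \<longleftrightarrow> (\<exists>S\<subseteq>I. card (I - S) + e \<le> \<kappa> \<and> on_curve e X Y z S)" for e
  have "P \<kappa>" unfolding P_def using \<open>on_curve \<kappa> X Y z I\<close> by (intro exI[of _ I]) simp
  define e where "e = (LEAST e. P e)"
  have Pe: "P e" unfolding e_def using \<open>P \<kappa>\<close> by (rule LeastI)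
  have minimal: "e \<le> e'" if "P e'" for e' unfolding e_def using that by (rule Least_le)
  obtain S where S: "S \<subseteq> I" "card (I - S) + e \<le> \<kappa>" "on_curve e X Y z S"
    using Pe unfolding P_def by blast
  have finS: "finite S" using S(1) I finite_subset by blast
  have cardS: "card (I - S) + card S = card I"
    using card_Diff_subset[OF finS S(1)] card_mono[OF I S(1)] by simp
  have nS: "2 * e + 3 \<le> card S"
    using S(2) cardS n unfolding \<kappa>_def by linarith
  obtain a b where ab: "degree a \<le> e" "degree b \<le> Suc e" "a \<noteq> 0 \<or> b \<noteq> 0"
    "\<forall>i\<in>S. z i * homog e a (X i) (Y i) + homog (Suc e) b (X i) (Y i) = 0"
    using S(3) unfolding on_curve_def by blast
  \<comment> \<open>Otherwise the curve would consist of at most \<open>e + 1\<close> lines through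
    \<open>Q\<close>, each containing at most one of the more than \<open>e + 1\<close>
    points.\<close>
  have "a \<noteq> 0"
  proof
    assume a: "a = 0"
    obtain b' where b': "degree b' \<le> Suc e" "\<forall>x u. homog (Suc e) b x (u + l0 * x) = homog (Suc e) b' x u"
      using homog_shear by blast
    have "b' \<noteq> 0" using homog_shear_nonzero[OF ab(2) _ b'(2)] ab(3) a by blast
    have "b' = 0"
    proof (rule vanishing_poly_zero[OF finS inj_on_subset[OF inj[OF l0] S(1)]])
      fix i assume i: "i \<in> S"
      then have "homog (Suc e) b (X i) ((Y i - l0 * X i) + l0 * X i) = 0" using ab(4) a by simp
      then have "homog (Suc e) b' (X i) (Y i - l0 * X i) = 0" by (simp only: b'(2))
      then show "poly b' (X i / (Y i - l0 * X i)) = 0"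
        using l0[of i] i S(1) by (auto simp: homog_eq[OF b'(1)])
    next
      show "degree b' < card S" using b'(1) nS by linarith
    qed auto
    with \<open>b' \<noteq> 0\<close> show False ..
  qed
  \<comment> \<open>This shear also keeps the root at infinity away from the binary form of
    \<open>a\<close>, so that \<open>A\<close> has degree exactly \<open>e\<close>.\<close>
  have "\<exists>l. (\<forall>i\<in>I. Y i - l * X i \<noteq> 0) \<and> homog e a 1 l \<noteq> 0"
    by (rule generic_shear[OF I XY ab(1) \<open>a \<noteq> 0\<close>])
  then obtain l where l: "\<And>i. i \<in> I \<Longrightarrow> Y i - l * X i \<noteq> 0" "homog e a 1 l \<noteq> 0" by blast
  define U where "U = (\<lambda>i. Y i - l * X i)"
  define s where "s = (\<lambda>i. X i / U i)"
  define w where "w = (\<lambda>i. z i / U i)"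
  have U: "U i \<noteq> 0" if "i \<in> I" for i using l(1)[OF that] by (simp add: U_def)
  have sI: "inj_on s I" unfolding s_def U_def by (rule inj[OF l(1)])
  have sS: "inj_on s S" using sI S(1) by (rule inj_on_subset)
  obtain A where A: "degree A \<le> e" "\<forall>x u. homog e a x (u + l * x) = homog e A x u"
    using homog_shear by blast
  obtain B where B: "degree B \<le> Suc e" "\<forall>x u. homog (Suc e) b x (u + l * x) = homog (Suc e) B x u"
    using homog_shear by blast
  have "homog e A 1 0 = homog e a 1 (0 + l * 1)" using A(2) by metis
  then have lead: "coeff A e \<noteq> 0" using l(2) by (simp add: homog_lead)
  then have dA: "degree A = e" using A(1) le_degree[OF lead] by simp
  have A0: "A \<noteq> 0" using lead by auto
  have g: "w i * poly A (s i) + poly B (s i) = 0" if i: "i \<in> S" for i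
  proof -
    have u: "U i \<noteq> 0" using U i S(1) by blast
    have "z i * homog e a (X i) (U i + l * X i) + homog (Suc e) b (X i) (U i + l * X i) = 0"
      using ab(4) i by (simp add: U_def)
    then have "z i * homog e A (X i) (U i) + homog (Suc e) B (X i) (U i) = 0" by (simp only: A(2) B(2))
    then have "U i ^ Suc e * (w i * poly A (s i) + poly B (s i)) = 0"
      using u by (simp add: homog_eq[OF A(1)] homog_eq[OF B(1)] distrib_left w_def s_def mult_ac)
    then show ?thesis using u by simp
  qed
  \<comment> \<open>A common root \<open>\<sigma>\<close> means that the line
    \<open>s = \<sigma>\<close> through \<open>Q\<close> is a component. It contains at most one
    point of \<open>S\<close>; discarding the line and that point contradicts minimality.\<close>
  have cop: "coprime A B"
  proof (rule coprime_complex_poly[OF A0], rule notI)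
    fix \<sigma> assume r: "poly A \<sigma> = 0" "poly B \<sigma> = 0"
    have e1: "e \<ge> 1"
    proof (rule ccontr)
      assume "\<not> e \<ge> 1"
      then have "degree A = 0" using dA by simp
      then obtain t where "A = [:t:]" by (rule degree_eq_zeroE)
      then show False using r(1) A0 by simp
    qed
    have "[:- \<sigma>, 1:] dvd A" using r(1) by (simp add: poly_eq_0_iff_dvd)
    then obtain A' where A': "A = [:- \<sigma>, 1:] * A'" by (rule dvdE)
    have "[:- \<sigma>, 1:] dvd B" using r(2) by (simp add: poly_eq_0_iff_dvd)
    then obtain B' where B': "B = [:- \<sigma>, 1:] * B'" by (rule dvdE)
    have "A' \<noteq> 0" using A0 A' by auto
    then have dA': "degree A' \<le> e - 1"
      using dA unfolding A' by (subst (asm) degree_mult_eq) auto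
    have dB': "degree B' \<le> Suc (e - 1)"
    proof (cases "B' = 0")
      case False
      then show ?thesis using B(1) unfolding B' by (subst (asm) degree_mult_eq) auto
    qed simp
    define S' where "S' = {i \<in> S. s i \<noteq> \<sigma>}"
    have "card {i \<in> S. s i = \<sigma>} \<le> 1"
      using finS sS by (auto simp: card_le_Suc0_iff_eq inj_on_def)
    moreover have "I - S' = (I - S) \<union> {i \<in> S. s i = \<sigma>}" using S(1) by (auto simp: S'_def)
    then have "card (I - S') \<le> card (I - S) + card {i \<in> S. s i = \<sigma>}" by (simp add: card_Un_le)
    ultimately have "card (I - S') + (e - 1) \<le> \<kappa>" using S(2) e1 by linarith
    moreover have "S' \<subseteq> I" using S(1) by (auto simp: S'_def)
    moreover have "on_curve (e - 1) X (\<lambda>i. Y i - l * X i) z S'"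
      unfolding U_def[symmetric]
    proof (subst on_curve_frame)
      show "U i \<noteq> 0" if "i \<in> S'" for i using U that \<open>S' \<subseteq> I\<close> by blast
      have "z i / U i * poly A' (X i / U i) + poly B' (X i / U i) = 0" if "i \<in> S'" for i
      proof -
        have "(s i - \<sigma>) * (w i * poly A' (s i) + poly B' (s i)) = w i * poly A (s i) + poly B (s i)"
          by (simp add: A' B' algebra_simps)
        also have "\<dots> = 0" using g that by (simp add: S'_def)
        finally show ?thesis using that by (simp add: S'_def s_def w_def)
      qed
      then show "\<exists>a b. degree a \<le> e - 1 \<and> degree b \<le> Suc (e - 1) \<and> (a \<noteq> 0 \<or> b \<noteq> 0) \<and>
          (\<forall>i\<in>S'. z i / U i * poly a (X i / U i) + poly b (X i / U i) = 0)"
        using dA' dB' \<open>A' \<noteq> 0\<close> by blast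
    qed
    then have "on_curve (e - 1) X Y z S'" by (rule on_curve_shear)
    ultimately have "P (e - 1)" unfolding P_def by blast
    then show False using minimal e1 by fastforce
  qed
  have cardj: "card (I - S) + e \<le> j" using S(2) by (simp add: \<kappa>_def)
  show ?thesis
  proof (cases e)
    case 0
    then obtain \<alpha> where \<alpha>: "A = [:\<alpha>:]" using dA by (auto elim: degree_eq_zeroE)
    have c0U: "(\<Sum>i\<in>I. c0 i * F i) = 0" if "F \<in> curve_values j X U z" for F
      using that unfolding U_def by (rule c0'[where l = l])
    \<comment> \<open>In projected coordinates this is the sum over
      \<open>x ^ kk * y ^ ll * z ^ mm\<close> with weights \<open>c0\<close>, which was chosen to be
      nonzero.\<close>
    have zero: "(\<Sum>i\<in>I. c0 i * U i ^ Suc j * (s i + fst p * w i) ^ kk * (1 + l * s i + snd p * w i) ^ ll * w i ^ mm) = 0"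
    proof (rule line_kills_forms[OF I S(1) sI])
      show "\<alpha> \<noteq> 0" using A0 \<alpha> by auto
      show "degree B \<le> 1" using B(1) 0 by simp
      show "\<alpha> * w i + poly B (s i) = 0" if "i \<in> S" for i
        using g[OF that] by (simp add: \<alpha> mult.commute)
      show "card (I - S) \<le> j" using cardj by simp
      show "(\<Sum>i\<in>I. c0 i * U i ^ Suc j * s i ^ k) = 0" if "k \<le> j + 1" for k
        unfolding s_def by (rule curve_values_relations(1)[OF U c0U that])
      show "(\<Sum>i\<in>I. c0 i * U i ^ Suc j * w i * s i ^ k) = 0" if "k \<le> j" for k
        unfolding s_def w_def by (rule curve_values_relations(2)[OF U c0U that])
    qed (rule klm(1))
    have eq: "c0 i * U i ^ Suc j * (s i + fst p * w i) ^ kk * (1 + l * s i + snd p * w i) ^ ll * w i ^ mm =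
        c0 i * x i ^ kk * y i ^ ll * z i ^ mm" if "i \<in> I" for i
    proof -
      have "x i = U i * (s i + fst p * w i)" "y i = U i * (1 + l * s i + snd p * w i)" "z i = U i * w i"
        using U[OF that] by (simp_all add: s_def w_def field_simps) (simp_all add: U_def X_def Y_def algebra_simps)
      moreover have "U i ^ Suc j = U i ^ kk * U i ^ ll * U i ^ mm"
        using klm(1) by (simp flip: power_add power_Suc)
      ultimately show ?thesis by (simp only: power_mult_distrib mult_ac)
    qed
    from zero have "(\<Sum>i\<in>I. c0 i * x i ^ kk * y i ^ ll * z i ^ mm) = 0"
      by (simp only: eq cong: sum.cong)
    with klm(2) show ?thesis by contradiction
  next
    case (Suc e')
    have constS: "\<forall>\<^sub>F q in nhds p. \<forall>e\<le>j. \<forall>B\<subseteq>S.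
        separates (projected_values x y z e q) B \<longrightarrow> separates (projected_values x y z e p) B"
      using const by eventually_elim (use S(1) in blast)
    have deform: "\<exists>A1 B1. degree A1 \<le> e \<and> degree B1 \<le> Suc e \<and> (\<forall>i\<in>S.
        (w i)^2 * poly (smult v1 (pderiv A) + smult v2 (smult (of_nat e) A - [:0, 1:] * pderiv A)) (s i)
        + w i * poly A1 (s i) + poly B1 (s i) = 0)" for v1 v2
      unfolding s_def w_def U_def X_def Y_def Suc
    proof (rule first_order_deformation[OF finS _ constS])
      show "Suc e' \<le> j" using cardj Suc by simp
      show "degree A \<le> Suc e'" "degree B \<le> Suc (Suc e')" using A(1) B(1) Suc by simp_all
      show "y i - snd p * z i - l * (x i - fst p * z i) \<noteq> 0" if "i \<in> S" for i
        using U[of i] that S(1) by (auto simp: U_def X_def Y_def)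
    qed (use g in \<open>simp add: s_def w_def U_def X_def Y_def\<close>)
    obtain A1 B1 where 1: "degree A1 \<le> e" "degree B1 \<le> Suc e"
      "\<forall>i\<in>S. (w i)^2 * poly (pderiv A) (s i) + w i * poly A1 (s i) + poly B1 (s i) = 0"
      using deform[of 1 0] by auto
    obtain A2 B2 where 2: "degree A2 \<le> e" "degree B2 \<le> Suc e"
      "\<forall>i\<in>S. (w i)^2 * poly (smult (of_nat e) A - [:0, 1:] * pderiv A) (s i) + w i * poly A2 (s i) + poly B2 (s i) = 0"
      using deform[of 0 1] by auto
    define c' where "c' = (\<lambda>i. c i * U i ^ j)"
    have c': "(\<Sum>i\<in>I. c' i * w i ^ m * s i ^ k) = 0" if km: "k + m \<le> j" for k m
    proof -
      have "c' i * w i ^ m * s i ^ k = c i * X i ^ k * U i ^ (j - k - m) * z i ^ m" if "i \<in> I" for i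
      proof -
        have "U i ^ j = U i ^ k * U i ^ m * U i ^ (j - k - m)" using km by (simp flip: power_add)
        then show ?thesis using U[OF that] by (simp add: c'_def w_def s_def power_divide)
      qed
      then have "(\<Sum>i\<in>I. c' i * w i ^ m * s i ^ k) = (\<Sum>i\<in>I. c i * X i ^ k * U i ^ (j - k - m) * z i ^ m)"
        by (rule sum.cong[OF refl])
      also have "\<dots> = 0"
        using kill[OF km, of "fst p" "snd p" l] by (simp only: X_def Y_def U_def)
      finally show ?thesis .
    qed
    have c'p: "(\<Sum>i\<in>I. c' i * w i ^ m * poly q (s i)) = 0" if "degree q + m \<le> j" for q m
      by (rule sum_poly_eq_0[of "j - m"]) (use c' that in auto)
    \<comment> \<open>Multiplying \<open>c'\<close> by \<open>G\<close> removes the omitted points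
      at the cost of \<open>card (I - S)\<close> degrees; since
      \<open>card (I - S) + e \<le> j\<close>, a relation for all monomials of degree at most
      \<open>e\<close> survives on \<open>S\<close>.\<close>
    define G where "G = (\<Prod>k\<in>I - S. [:- s k, 1:])"
    have fin: "finite (I - S)" using I by simp
    have dG: "degree G = card (I - S)" unfolding G_def by (rule degree_linear_factors(1)[OF fin])
    have G0: "poly G (s i) = 0" if "i \<in> I - S" for i
      using that fin by (auto simp: G_def poly_prod)
    have "c' i = 0" if i: "i \<in> S" for i
    proof -
      have "c' i * poly G (s i) = 0"
      proof (rule no_relation_on_deformable_curve[OF finS sS nS _ dA _ cop g 1(1) _ _ 2(1) _ _ _ i])
        show "1 \<le> e" using Suc by simp
        show "degree B \<le> e + 1" "degree B1 \<le> e + 1" "degree B2 \<le> e + 1" using B(1) 1(2) 2(2) by simp_all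
        show "(w i)^2 * poly (pderiv A) (s i) + w i * poly A1 (s i) + poly B1 (s i) = 0" if "i \<in> S" for i
          using 1(3) that by blast
        show "(w i)^2 * (of_nat e * poly A (s i) - s i * poly (pderiv A) (s i)) + w i * poly A2 (s i) + poly B2 (s i) = 0"
          if "i \<in> S" for i using 2(3) that by simp
        show "(\<Sum>i\<in>S. c' i * poly G (s i) * s i ^ k * w i ^ m) = 0" if km: "k + m \<le> e" for k m
        proof -
          have "(\<Sum>i\<in>S. c' i * poly G (s i) * s i ^ k * w i ^ m) = (\<Sum>i\<in>I. c' i * w i ^ m * poly (G * monom 1 k) (s i))"
            using G0 by (intro sum.mono_neutral_cong_left I S(1)) (auto simp: poly_monom)
          also have "\<dots> = 0"
            using dG km cardj degree_mult_le[of G "monom 1 k"]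
            by (intro c'p) (simp add: degree_monom_eq)
          finally show ?thesis .
        qed
      qed
      moreover have "poly G (s i) \<noteq> 0"
        using i S(1) sI fin by (auto simp: G_def poly_prod inj_on_def)
      ultimately show ?thesis by simp
    qed
    \<comment> \<open>Once \<open>c'\<close> vanishes on \<open>S\<close>, the omitted points are
      too few to carry a relation in degree \<open>j\<close>.\<close>
    then have "c' i = 0"
    proof (rule vanish_off_subset[OF I S(1) sI _ _ i])
      show "(\<Sum>i\<in>I. c' i * poly q (s i)) = 0" if "degree q + 1 \<le> card (I - S)" for q
        using c'p[of q 0] that cardj by simp
    qed
    then show ?thesis using U[OF i] by (simp add: c'_def)
  qed
qed

section \<open>Forms in three variables\<close>

definition monom_val :: "(3 \<Rightarrow>\<^sub>0 nat) \<Rightarrow> complex ^ 3 \<Rightarrow> complex"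
  where "monom_val m v = (\<Prod>i\<in>UNIV. (v $ i) ^ Poly_Mapping.lookup m i)"

lemma monom_val_add: "monom_val (m + n) v = monom_val m v * monom_val n v"
  by (simp add: monom_val_def lookup_add power_add prod.distrib)

text \<open>In the index type \<open>3\<close> the numeral \<open>3\<close> is the element
  \<open>0\<close>; it serves as the index of the last coordinate throughout.\<close>

lemma monom_val_3:
  "monom_val m v = (v $ 1) ^ Poly_Mapping.lookup m 1 * (v $ 2) ^ Poly_Mapping.lookup m 2 *
    (v $ 3) ^ Poly_Mapping.lookup m 3"
  unfolding monom_val_def UNIV_3 by (simp add: mult.assoc)

lemma eval_poly_superset:
  assumes "finite K" "Poly_Mapping.keys f \<subseteq> K"
  shows "eval_poly f v = (\<Sum>m\<in>K. Poly_Mapping.lookup f m * monom_val m v)"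
  unfolding eval_poly_def monom_val_def[symmetric]
  by (rule sum.mono_neutral_left[OF assms]) (simp add: in_keys_iff)

lemma eval_poly_single [simp]: "eval_poly (Poly_Mapping.single m c) v = c * monom_val m v"
  using eval_poly_superset[of "{m}" "Poly_Mapping.single m c" v] by simp

lemma eval_poly_zero [simp]: "eval_poly 0 v = 0"
  by (simp add: eval_poly_def)

lemma eval_poly_add [simp]: "eval_poly (f + g) v = eval_poly f v + eval_poly g v"
proof -
  let ?K = "Poly_Mapping.keys f \<union> Poly_Mapping.keys g"
  have "Poly_Mapping.keys (f + g) \<subseteq> ?K" by (rule Poly_Mapping.keys_add)
  then show ?thesis
    using eval_poly_superset[of ?K f v] eval_poly_superset[of ?K g v] eval_poly_superset[of ?K "f + g" v]
    by (simp add: lookup_add algebra_simps sum.distrib)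
qed

lemma eval_poly_sum: "eval_poly (sum f I) v = (\<Sum>i\<in>I. eval_poly (f i) v)"
  by (induction I rule: infinite_finite_induct) auto

lemma poly3_expand:
  "f = (\<Sum>m\<in>Poly_Mapping.keys f. Poly_Mapping.single m (Poly_Mapping.lookup f m))"
proof (rule poly_mapping_eqI)
  fix k
  have "(\<Sum>m\<in>Poly_Mapping.keys f. Poly_Mapping.lookup (Poly_Mapping.single m (Poly_Mapping.lookup f m)) k) =
      (\<Sum>m\<in>Poly_Mapping.keys f. if m = k then Poly_Mapping.lookup f k else 0)"
    by (intro sum.cong refl) (simp add: lookup_single when_def)
  then show "Poly_Mapping.lookup f k =
      Poly_Mapping.lookup (\<Sum>m\<in>Poly_Mapping.keys f. Poly_Mapping.single m (Poly_Mapping.lookup f m)) k"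
    by (simp add: lookup_sum in_keys_iff)
qed

lemma eval_poly_mult [simp]: "eval_poly (f * g) v = eval_poly f v * eval_poly g v"
proof -
  let ?s = "\<lambda>f m. Poly_Mapping.single m (Poly_Mapping.lookup f m) :: poly3"
  have "f * g = (\<Sum>m\<in>Poly_Mapping.keys f. ?s f m) * (\<Sum>n\<in>Poly_Mapping.keys g. ?s g n)"
    by (simp flip: poly3_expand)
  also have "\<dots> = (\<Sum>m\<in>Poly_Mapping.keys f. \<Sum>n\<in>Poly_Mapping.keys g.
      Poly_Mapping.single (m + n) (Poly_Mapping.lookup f m * Poly_Mapping.lookup g n))"
    by (simp add: sum_product mult_single)
  finally have fg: "f * g = (\<Sum>m\<in>Poly_Mapping.keys f. \<Sum>n\<in>Poly_Mapping.keys g.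
      Poly_Mapping.single (m + n) (Poly_Mapping.lookup f m * Poly_Mapping.lookup g n))" .
  have ev: "eval_poly h v = (\<Sum>m\<in>Poly_Mapping.keys h. Poly_Mapping.lookup h m * monom_val m v)" for h
    by (rule eval_poly_superset) simp_all
  show ?thesis
    unfolding fg ev[of f] ev[of g] by (simp add: eval_poly_sum monom_val_add sum_product mult_ac)
qed

lemma eval_poly_scale [simp]: "eval_poly (scale_poly c f) v = c * eval_poly f v"
  by (simp add: scale_poly_def monom_val_def)

lemma eval_poly_one [simp]: "eval_poly 1 v = 1"
  unfolding single_one[symmetric] eval_poly_single by (simp add: monom_val_def)

lemma eval_poly_power [simp]: "eval_poly (f ^ n) v = eval_poly f v ^ n"
  by (induction n) simp_all

lemma eval_poly_minus [simp]: "eval_poly (f - g) v = eval_poly f v - eval_poly g v"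
  using eval_poly_add[of "f - g" g v] by simp

lemma eval_poly_prod: "eval_poly (prod f I) v = (\<Prod>i\<in>I. eval_poly (f i) v)"
  by (induction I rule: infinite_finite_induct) auto

lemma eval_poly_along_line: "\<exists>P. \<forall>t. eval_poly f (v + t *s u) = poly P t"
proof
  show "\<forall>t. eval_poly f (v + t *s u) = poly (\<Sum>m\<in>Poly_Mapping.keys f.
    smult (Poly_Mapping.lookup f m) (\<Prod>i\<in>UNIV. [:v $ i, u $ i:] ^ Poly_Mapping.lookup m i)) t"
    by (simp add: eval_poly_def poly_sum poly_prod)
qed

lemma forms_add: "f \<in> forms d \<Longrightarrow> g \<in> forms d \<Longrightarrow> f + g \<in> forms d"
  using subsetD[OF Poly_Mapping.keys_add[of f g]] by (auto simp: forms_def)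

lemma forms_mult:
  assumes "f \<in> forms d" "g \<in> forms e"
  shows "f * g \<in> forms (d + e)"
  unfolding forms_def
proof (intro CollectI ballI)
  fix m assume "m \<in> Poly_Mapping.keys (f * g)"
  then obtain a b where "m = a + b" "a \<in> Poly_Mapping.keys f" "b \<in> Poly_Mapping.keys g"
    using keys_mult[of f g] by blast
  then show "(\<Sum>i\<in>UNIV. Poly_Mapping.lookup m i) = d + e"
    using assms by (simp add: forms_def lookup_add sum.distrib)
qed

lemma forms_zero [simp]: "0 \<in> forms d"
  by (simp add: forms_def)

lemma forms_one [simp]: "1 \<in> forms 0"
  by (simp add: forms_def)

lemma forms_scale: "f \<in> forms d \<Longrightarrow> scale_poly c f \<in> forms d"
proof -
  assume "f \<in> forms d"
  moreover have "Poly_Mapping.single 0 c \<in> forms 0" by (simp add: forms_def)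
  ultimately show ?thesis unfolding scale_poly_def using forms_mult[of _ 0 f d] by simp
qed

lemma subspace_forms: "poly3.subspace (forms d)"
  unfolding poly3.subspace_def by (simp add: forms_add forms_scale)

lemma forms_power: "f \<in> forms d \<Longrightarrow> f ^ n \<in> forms (n * d)"
  by (induction n) (simp_all add: forms_mult)

lemma eval_form_scale:
  assumes "f \<in> forms d"
  shows "eval_poly f (c *s v) = c ^ d * eval_poly f v"
proof -
  have "monom_val m (c *s v) = c ^ d * monom_val m v" if "m \<in> Poly_Mapping.keys f" for m
  proof -
    have "(\<Sum>i\<in>UNIV. Poly_Mapping.lookup m i) = d" using assms that by (auto simp: forms_def)
    then have "(\<Prod>i\<in>UNIV. c ^ Poly_Mapping.lookup m i) = c ^ d" by (simp flip: power_sum)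
    then show ?thesis by (simp add: monom_val_def power_mult_distrib prod.distrib)
  qed
  then show ?thesis
    unfolding eval_poly_def monom_val_def[symmetric] by (simp add: sum_distrib_left mult_ac)
qed

definition indet :: "3 \<Rightarrow> poly3"
  where "indet k = Poly_Mapping.single (Poly_Mapping.single k 1) 1"

lemma eval_indet [simp]: "eval_poly (indet k) v = v $ k"
proof -
  have "monom_val (Poly_Mapping.single k 1) v = (\<Prod>i\<in>UNIV. if i = k then v $ k else 1)"
    unfolding monom_val_def by (intro prod.cong refl) (simp add: lookup_single when_def)
  then show ?thesis by (simp add: indet_def)
qed

lemma indet_form [simp]: "indet k \<in> forms 1"
proof -
  have "(\<Sum>i\<in>UNIV. Poly_Mapping.lookup (Poly_Mapping.single k (1::nat)) i) = (\<Sum>i\<in>UNIV. if i = k then 1 else 0)"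
    by (intro sum.cong refl) (simp add: lookup_single when_def)
  then show ?thesis by (simp add: forms_def indet_def)
qed

lemma indet_power: "indet k ^ n = Poly_Mapping.single (Poly_Mapping.single k n) 1"
  by (induction n) (simp_all add: indet_def mult_single flip: single_add)

lemma single_eq_indets:
  "(Poly_Mapping.single m 1 :: poly3) =
    indet 1 ^ Poly_Mapping.lookup m 1 * indet 2 ^ Poly_Mapping.lookup m 2 * indet 3 ^ Poly_Mapping.lookup m 3"
proof -
  have "m = Poly_Mapping.single 1 (Poly_Mapping.lookup m 1) + Poly_Mapping.single 2 (Poly_Mapping.lookup m 2) +
      Poly_Mapping.single 3 (Poly_Mapping.lookup m 3)"
    by (rule poly_mapping_eqI) (use exhaust_3 in \<open>auto simp: lookup_add lookup_single when_def\<close>)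
  then show ?thesis by (simp add: indet_power mult_single)
qed

lemma forms_finite_span: "\<exists>F. finite F \<and> forms d \<subseteq> poly3.span F"
proof -
  define M where "M = {m :: 3 \<Rightarrow>\<^sub>0 nat. (\<Sum>i\<in>UNIV. Poly_Mapping.lookup m i) = d}"
  have "Poly_Mapping.lookup ` M \<subseteq> UNIV \<rightarrow>\<^sub>E {..d}"
    by (auto simp: M_def PiE_def extensional_def intro: member_le_sum)
  then have "finite (Poly_Mapping.lookup ` M)"
    by (rule finite_subset) (simp add: finite_PiE)
  then have finM: "finite M"
    by (rule finite_imageD) (simp add: inj_on_def poly_mapping_eqI)
  have "f \<in> poly3.span ((\<lambda>m. Poly_Mapping.single m 1) ` M)" if f: "f \<in> forms d" for f
  proof -
    have "f = (\<Sum>m\<in>Poly_Mapping.keys f. scale_poly (Poly_Mapping.lookup f m) (Poly_Mapping.single m 1))"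
      unfolding scale_poly_def mult_single by (simp flip: poly3_expand)
    also have "\<dots> \<in> poly3.span ((\<lambda>m. Poly_Mapping.single m 1) ` M)"
      using f by (intro poly3.span_sum poly3.span_scale poly3.span_base) (auto simp: forms_def M_def)
    finally show ?thesis .
  qed
  with finM show ?thesis by (intro exI[of _ "(\<lambda>m. Poly_Mapping.single m 1) ` M"]) auto
qed

section \<open>Homogeneous coordinates of points\<close>

lemma coords_nonzero: "homog_coords P v \<Longrightarrow> v \<noteq> 0"
  by transfer (auto simp: proportional_def)

lemma coords_exist: "\<exists>v. homog_coords P v"
  by transfer blast

lemma coords_proportional: "homog_coords P v \<Longrightarrow> homog_coords P w \<Longrightarrow> \<exists>c. c \<noteq> 0 \<and> w = c *s v"
proof (transfer)
  fix p v w assume "proportional p v" "proportional p w"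
  then have "proportional v w"
    using part_equivp_proportional by (meson part_equivp_symp part_equivp_transp)
  then show "\<exists>c. c \<noteq> 0 \<and> w = c *s v" by (auto simp: proportional_def)
qed

lemma coords_scale: "homog_coords P v \<Longrightarrow> c \<noteq> 0 \<Longrightarrow> homog_coords P (c *s v)"
proof (transfer)
  fix p v and c :: complex assume "proportional p v" "c \<noteq> 0"
  then obtain k where "k \<noteq> 0" "v = k *s p" "p \<noteq> 0" by (auto simp: proportional_def)
  then show "proportional p (c *s v)"
    unfolding proportional_def using \<open>c \<noteq> 0\<close>
    by (auto simp: vector_smult_assoc intro!: exI[of _ "c * k"])
qed

lemma coords_unique: "homog_coords P v \<Longrightarrow> homog_coords Q v \<Longrightarrow> P = Q"
proof (transfer)
  fix p q v assume "proportional p v" "proportional q v"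
  then show "proportional p q"
    using part_equivp_proportional by (meson part_equivp_symp part_equivp_transp)
qed

lemma point_exists: "v \<noteq> 0 \<Longrightarrow> \<exists>P. homog_coords P v"
proof (transfer)
  fix v :: "complex ^ 3" assume "v \<noteq> 0"
  then have "proportional v v" by (auto simp: proportional_def intro!: exI[of _ 1])
  then show "\<exists>P\<in>{x. proportional x x}. proportional P v" by blast
qed

lemma form_vanishes_at:
  assumes "f \<in> forms d" "homog_coords P v" "eval_poly f v = 0"
  shows "vanishes_at f P"
  unfolding vanishes_at_def
proof (intro allI impI)
  fix w assume "homog_coords P w"
  then obtain c where "w = c *s v" using coords_proportional assms(2) by blast
  then show "eval_poly f w = 0" using eval_form_scale[OF assms(1)] assms(3) by simp
qed

section \<open>Forms of degree \<open>e + 1\<close> with a point of multiplicity \<open>e\<close>\<close>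

definition homog_form :: "nat \<Rightarrow> complex poly \<Rightarrow> poly3 \<Rightarrow> poly3 \<Rightarrow> poly3"
  where "homog_form e p X Y = (\<Sum>i\<le>e. scale_poly (coeff p i) (X ^ i * Y ^ (e - i)))"

lemma eval_homog_form [simp]:
  "eval_poly (homog_form e p X Y) v = homog e p (eval_poly X v) (eval_poly Y v)"
  unfolding homog_form_def homog_def eval_poly_sum eval_poly_scale eval_poly_mult eval_poly_power
    mult.assoc ..

lemma homog_form_zero [simp]: "homog_form e 0 X Y = 0"
  by (simp add: homog_form_def)

lemma homog_form_add: "homog_form e (p + q) X Y = homog_form e p X Y + homog_form e q X Y"
  unfolding homog_form_def coeff_add poly3.scale_left_distrib sum.distrib ..

lemma homog_form_smult: "homog_form e (smult c p) X Y = scale_poly c (homog_form e p X Y)"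
  unfolding homog_form_def coeff_smult poly3.scale_sum_right poly3.scale_scale ..

lemma scale_poly_mult_right: "g * scale_poly c f = scale_poly c (g * f)"
  unfolding scale_poly_def by (rule mult.left_commute)

lemma scale_poly_mult_left: "scale_poly c f * g = scale_poly c (f * g)"
  unfolding scale_poly_def by (rule mult.assoc)

lemma homog_form_pCons: "homog_form (Suc e) (pCons 0 p) X Y = X * homog_form e p X Y"
proof -
  have "homog_form (Suc e) (pCons 0 p) X Y =
      (\<Sum>i\<le>e. scale_poly (coeff p i) (X ^ Suc i * Y ^ (e - i)))"
    unfolding homog_form_def sum.atMost_Suc_shift by simp
  also have "\<dots> = X * homog_form e p X Y"
    unfolding homog_form_def sum_distrib_left
    by (intro sum.cong refl) (simp only: scale_poly_mult_right power_Suc mult.assoc)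
  finally show ?thesis .
qed

lemma homog_form_Suc:
  assumes "degree p \<le> e"
  shows "homog_form (Suc e) p X Y = Y * homog_form e p X Y"
proof -
  have "coeff p (Suc e) = 0" using assms by (intro coeff_eq_0) simp
  then have "homog_form (Suc e) p X Y = (\<Sum>i\<le>e. scale_poly (coeff p i) (X ^ i * Y ^ (Suc e - i)))"
    by (simp add: homog_form_def)
  also have "\<dots> = Y * homog_form e p X Y"
    unfolding homog_form_def sum_distrib_left
    by (intro sum.cong refl)
      (simp only: scale_poly_mult_right Suc_diff_le atMost_iff power_Suc mult.left_commute)
  finally show ?thesis .
qed

lemma homog_form_in_forms:
  assumes "X \<in> forms 1" "Y \<in> forms 1"
  shows "homog_form e p X Y \<in> forms e"
  unfolding homog_form_def
proof (intro poly3.subspace_sum[OF subspace_forms] forms_scale)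
  fix i assume "i \<in> {..e}"
  then show "X ^ i * Y ^ (e - i) \<in> forms e"
    using forms_mult[OF forms_power[OF assms(1), of i] forms_power[OF assms(2), of "e - i"]] by simp
qed

text \<open>A Taylor expansion at the common zero of the linear forms \<open>X\<close> and
  \<open>Y\<close>: the summand with index \<open>k\<close> vanishes there to order at least
  \<open>k\<close>.\<close>

definition form_expansion :: "poly3 \<Rightarrow> poly3 \<Rightarrow> poly3 \<Rightarrow> nat \<Rightarrow> poly3 \<Rightarrow> bool"
  where "form_expansion X Y Z d f \<longleftrightarrow> (\<exists>p. (\<forall>k\<le>d. degree (p k) \<le> k) \<and>
    f = (\<Sum>k\<le>d. Z ^ (d - k) * homog_form k (p k) X Y))"

lemma form_expansion_add:
  assumes "form_expansion X Y Z d f" "form_expansion X Y Z d g"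
  shows "form_expansion X Y Z d (f + g)"
proof -
  obtain p q where "\<forall>k\<le>d. degree (p k) \<le> k" "f = (\<Sum>k\<le>d. Z ^ (d - k) * homog_form k (p k) X Y)"
    "\<forall>k\<le>d. degree (q k) \<le> k" "g = (\<Sum>k\<le>d. Z ^ (d - k) * homog_form k (q k) X Y)"
    using assms unfolding form_expansion_def by blast
  then show ?thesis
    unfolding form_expansion_def
    by (intro exI[of _ "\<lambda>k. p k + q k"])
      (simp add: homog_form_add distrib_left sum.distrib degree_add_le)
qed

lemma form_expansion_scale:
  assumes "form_expansion X Y Z d f"
  shows "form_expansion X Y Z d (scale_poly c f)"
proof -
  obtain p where p: "\<forall>k\<le>d. degree (p k) \<le> k" "f = (\<Sum>k\<le>d. Z ^ (d - k) * homog_form k (p k) X Y)"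
    using assms unfolding form_expansion_def by blast
  then show ?thesis
    unfolding form_expansion_def
    by (intro exI[of _ "\<lambda>k. smult c (p k)"])
      (auto simp: homog_form_smult scale_poly_mult_right poly3.scale_sum_right intro: order_trans[OF degree_smult_le])
qed

lemma form_expansion_zero: "form_expansion X Y Z d 0"
  unfolding form_expansion_def by (intro exI[of _ "\<lambda>k. 0"]) simp

lemma form_expansion_one: "form_expansion X Y Z 0 1"
  unfolding form_expansion_def
  by (intro exI[of _ "\<lambda>k. 1"]) (simp add: homog_form_def)

lemma form_expansion_mult:
  assumes "form_expansion X Y Z d f"
  shows "form_expansion X Y Z (Suc d) (X * f)" "form_expansion X Y Z (Suc d) (Y * f)"
    "form_expansion X Y Z (Suc d) (Z * f)"
proof -
  obtain p where p: "\<forall>k\<le>d. degree (p k) \<le> k" "f = (\<Sum>k\<le>d. Z ^ (d - k) * homog_form k (p k) X Y)"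
    using assms unfolding form_expansion_def by blast
  show "form_expansion X Y Z (Suc d) (X * f)"
    unfolding form_expansion_def
  proof (intro exI conjI allI impI)
    let ?q = "\<lambda>k. case k of 0 \<Rightarrow> 0 | Suc k \<Rightarrow> pCons 0 (p k)"
    show "degree (?q k) \<le> k" if "k \<le> Suc d" for k
      using p(1) that by (auto split: nat.split simp: degree_pCons_eq_if)
    have "X * f = (\<Sum>k\<le>d. Z ^ (d - k) * (X * homog_form k (p k) X Y))"
      unfolding p(2) sum_distrib_left by (intro sum.cong refl mult.left_commute)
    then show "X * f = (\<Sum>k\<le>Suc d. Z ^ (Suc d - k) * homog_form k (?q k) X Y)"
      unfolding sum.atMost_Suc_shift by (simp add: homog_form_pCons)
  qed
  show "form_expansion X Y Z (Suc d) (Y * f)"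
    unfolding form_expansion_def
  proof (intro exI conjI allI impI)
    let ?q = "\<lambda>k. case k of 0 \<Rightarrow> 0 | Suc k \<Rightarrow> p k"
    show "degree (?q k) \<le> k" if "k \<le> Suc d" for k
      using p(1) that by (auto split: nat.split simp: le_SucI)
    have "Y * f = (\<Sum>k\<le>d. Z ^ (d - k) * (Y * homog_form k (p k) X Y))"
      unfolding p(2) sum_distrib_left by (intro sum.cong refl mult.left_commute)
    then show "Y * f = (\<Sum>k\<le>Suc d. Z ^ (Suc d - k) * homog_form k (?q k) X Y)"
      unfolding sum.atMost_Suc_shift using p(1) by (simp add: homog_form_Suc)
  qed
  show "form_expansion X Y Z (Suc d) (Z * f)"
    unfolding form_expansion_def
  proof (intro exI conjI allI impI)
    let ?q = "\<lambda>k. if k \<le> d then p k else 0"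
    show "degree (?q k) \<le> k" if "k \<le> Suc d" for k
      using p(1) by simp
    have "Z * f = (\<Sum>k\<le>d. Z ^ (Suc d - k) * homog_form k (?q k) X Y)"
      unfolding p(2) sum_distrib_left
    proof (intro sum.cong refl)
      fix k assume "k \<in> {..d}"
      then have "Suc d - k = Suc (d - k)" "?q k = p k" by simp_all
      then show "Z * (Z ^ (d - k) * homog_form k (p k) X Y) = Z ^ (Suc d - k) * homog_form k (?q k) X Y"
        by (simp only: power_Suc mult.assoc)
    qed
    moreover have "?q (Suc d) = 0" by simp
    ultimately show "Z * f = (\<Sum>k\<le>Suc d. Z ^ (Suc d - k) * homog_form k (?q k) X Y)"
      by (simp only: sum.atMost_Suc homog_form_zero mult_zero_right add_0_right)
  qed
qed

lemma form_expansion_power_mult: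
  assumes "\<And>g d. form_expansion X Y Z d g \<Longrightarrow> form_expansion X Y Z (Suc d) (h * g)"
    and "form_expansion X Y Z d f"
  shows "form_expansion X Y Z (n + d) (h ^ n * f)"
proof (induction n)
  case 0
  show ?case using assms(2) by simp
next
  case (Suc n)
  show ?case using assms(1)[OF Suc] by (simp only: power_Suc mult.assoc add_Suc)
qed

abbreviation centred1 :: "complex \<Rightarrow> poly3"
  where "centred1 q \<equiv> indet 1 - scale_poly q (indet 3)"

abbreviation centred2 :: "complex \<Rightarrow> poly3"
  where "centred2 q \<equiv> indet 2 - scale_poly q (indet 3)"

lemma centred_forms: "centred1 q \<in> forms 1" "centred2 q \<in> forms 1"
  by (rule poly3.subspace_diff[OF subspace_forms indet_form forms_scale[OF indet_form]])+

text \<open>Each of the first two indeterminates is a centred form plus a multiple of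
  \<open>indet 3\<close>. Expansions are stable under multiplication by all three forms, hence exist
  for monomials.\<close>

lemma form_expansion_exists:
  assumes "f \<in> forms d"
  shows "form_expansion (centred1 q1) (centred2 q2) (indet 3) d f"
proof -
  let ?E = "form_expansion (centred1 q1) (centred2 q2) (indet 3)"
  have 1: "?E (Suc d) (indet 1 * g)" if "?E d g" for d g
  proof -
    have "indet 1 * g = centred1 q1 * g + scale_poly q1 (indet 3 * g)"
      unfolding left_diff_distrib scale_poly_mult_left by (rule diff_add_cancel[symmetric])
    then show ?thesis
      using that by (simp only: form_expansion_add form_expansion_scale form_expansion_mult)
  qed
  have 2: "?E (Suc d) (indet 2 * g)" if "?E d g" for d g
  proof -
    have "indet 2 * g = centred2 q2 * g + scale_poly q2 (indet 3 * g)"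
      unfolding left_diff_distrib scale_poly_mult_left by (rule diff_add_cancel[symmetric])
    then show ?thesis
      using that by (simp only: form_expansion_add form_expansion_scale form_expansion_mult)
  qed
  have mono: "?E (i + (j + (k + 0))) (indet 1 ^ i * (indet 2 ^ j * (indet 3 ^ k * 1)))" for i j k
    by (intro form_expansion_power_mult 1 2 form_expansion_mult(3) form_expansion_one)
  have "?E d (\<Sum>m\<in>M. Poly_Mapping.single m (Poly_Mapping.lookup f m))"
    if "finite M" "M \<subseteq> Poly_Mapping.keys f" for M
    using that
  proof (induction M rule: finite_induct)
    case (insert m M)
    let ?l = "Poly_Mapping.lookup m"
    have eq: "Poly_Mapping.single m (Poly_Mapping.lookup f m) =
        scale_poly (Poly_Mapping.lookup f m) (indet 1 ^ ?l 1 * (indet 2 ^ ?l 2 * (indet 3 ^ ?l 3 * 1)))"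
    proof -
      have "indet 1 ^ ?l 1 * (indet 2 ^ ?l 2 * (indet 3 ^ ?l 3 * 1)) = Poly_Mapping.single m 1"
        by (simp only: single_eq_indets mult.assoc mult_1_right)
      then show ?thesis by (simp only: scale_poly_def mult_single add_0_left mult_1_right)
    qed
    have "m \<in> Poly_Mapping.keys f" using insert.prems by blast
    then have "(\<Sum>i\<in>UNIV. ?l i) = d" using assms unfolding forms_def by blast
    then have "?l 1 + (?l 2 + (?l 3 + 0)) = d" by (simp only: sum_3 add.assoc add_0_right)
    then have "?E d (indet 1 ^ ?l 1 * (indet 2 ^ ?l 2 * (indet 3 ^ ?l 3 * 1)))"
      using mono[of "?l 1" "?l 2" "?l 3"] by (simp only:)
    moreover have "?E d (\<Sum>m\<in>M. Poly_Mapping.single m (Poly_Mapping.lookup f m))"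
      using insert.IH insert.prems by blast
    ultimately show ?case
      unfolding sum.insert[OF insert.hyps(1,2)] eq by (intro form_expansion_add form_expansion_scale)
  qed (simp add: form_expansion_zero)
  from this[of "Poly_Mapping.keys f"] show ?thesis unfolding poly3_expand[symmetric] by simp
qed

text \<open>Each of the \<open>n\<close> factors of a generator vanishes at \<open>t = 0\<close> and
  contributes a factor \<open>t\<close>; arbitrary polynomial coefficients restrict to polynomials
  in \<open>t\<close>.\<close>

lemma ideal_power_vanishing_order:
  assumes "f \<in> ideal_power (vanishing_ideal {Q}) n" "homog_coords Q v"
  shows "\<exists>P. \<forall>t. eval_poly f (v + t *s u) = t ^ n * poly P t"
  using assms(1) unfolding ideal_power_def
proof (induction rule: poly3_ideal.span_induct_alt)
  case base
  show ?case by (intro exI[of _ 0]) simp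
next
  case (step c x y)
  then obtain g where x: "x = (\<Prod>i<n. g i)" and g: "\<forall>i<n. g i \<in> vanishing_ideal {Q}" by blast
  have "\<forall>i. \<exists>R. i < n \<longrightarrow> (\<forall>t. eval_poly (g i) (v + t *s u) = t * poly R t)"
  proof (intro allI)
    fix i
    obtain R where R: "\<forall>t. eval_poly (g i) (v + t *s u) = poly R t"
      using eval_poly_along_line by blast
    show "\<exists>R. i < n \<longrightarrow> (\<forall>t. eval_poly (g i) (v + t *s u) = t * poly R t)"
    proof (cases "i < n")
      case True
      then have "eval_poly (g i) v = 0"
        using g assms(2) by (auto simp: vanishing_ideal_def vanishes_at_def)
      then have "poly R 0 = 0" using R[rule_format, of 0] by simp
      then have "[:- 0, 1:] dvd R" by (simp add: poly_eq_0_iff_dvd)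
      then obtain R' where "R = [:- 0, 1:] * R'" by (rule dvdE)
      then show ?thesis using R by (intro exI[of _ R']) simp
    qed simp
  qed
  then obtain R where R: "\<forall>i. i < n \<longrightarrow> (\<forall>t. eval_poly (g i) (v + t *s u) = t * poly (R i) t)"
    by metis
  obtain C where C: "\<forall>t. eval_poly c (v + t *s u) = poly C t" using eval_poly_along_line by blast
  obtain P where P: "\<forall>t. eval_poly y (v + t *s u) = t ^ n * poly P t" using step by blast
  show ?case
    by (intro exI[of _ "C * (\<Prod>i<n. R i) + P"])
      (simp add: x eval_poly_prod R C P poly_prod prod.distrib algebra_simps)
qed

lemma homog_scale: "homog k p (t * x) (t * y) = t ^ k * homog k p x y"
proof -
  have "(t * x) ^ i * (t * y) ^ (k - i) = t ^ k * (x ^ i * y ^ (k - i))" if "i \<le> k" for i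
    using that by (simp add: power_mult_distrib mult_ac flip: power_add)
  then show ?thesis by (simp add: homog_def sum_distrib_left mult_ac)
qed

text \<open>Along the line through \<open>Q\<close> in direction \<open>(s, 1, 0)\<close> the
  expansion of \<open>f\<close> becomes the sum of the \<open>t ^ k * poly (p k) s\<close>.
  Divisibility by \<open>t ^ e\<close> for every \<open>s\<close> leaves only the terms with
  \<open>k = e\<close> and \<open>k = Suc e\<close>.\<close>

lemma multiple_point_form:
  assumes f: "f \<in> forms (Suc e)" "f \<in> ideal_power (vanishing_ideal {Q}) e"
    and Q: "homog_coords Q (vector [q1, q2, 1])"
  shows "\<exists>a b. degree a \<le> e \<and> degree b \<le> Suc e \<and>
    f = indet 3 * homog_form e a (centred1 q1) (centred2 q2) + homog_form (Suc e) b (centred1 q1) (centred2 q2)"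
proof -
  let ?X = "centred1 q1" and ?Y = "centred2 q2"
  obtain p where p: "\<forall>k\<le>Suc e. degree (p k) \<le> k"
    and fp: "f = (\<Sum>k\<le>Suc e. indet 3 ^ (Suc e - k) * homog_form k (p k) ?X ?Y)"
    using form_expansion_exists[OF f(1)] unfolding form_expansion_def by blast
  have "p k = 0" if k: "k < e" for k
  proof -
    have "poly (p k) s = 0" for s
    proof -
      define u where "u = (vector [s, 1, 0] :: complex ^ 3)"
      obtain P where P: "\<forall>t. eval_poly f (vector [q1, q2, 1] + t *s u) = t ^ e * poly P t"
        using ideal_power_vanishing_order[OF f(2) Q] by blast
      have "poly (\<Sum>i\<le>Suc e. monom (poly (p i) s) i) t = poly (monom 1 e * P) t" for t
      proof -
        have *: "homog i (p i) (t * s) t = poly (monom (poly (p i) s) i) t" if "i \<le> Suc e" for i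
          using homog_scale[of i "p i" t s 1] homog_one[of "p i" i s] p that by (simp add: poly_monom)
        have "poly (\<Sum>i\<le>Suc e. monom (poly (p i) s) i) t = (\<Sum>i\<le>Suc e. homog i (p i) (t * s) t)"
          unfolding poly_sum by (rule sum.cong[OF refl]) (simp only: atMost_iff *)
        also have "\<dots> = eval_poly f (vector [q1, q2, 1] + t *s u)"
          unfolding fp by (simp add: eval_poly_sum u_def)
        finally show ?thesis using P by (simp add: poly_monom)
      qed
      then have "(\<Sum>i\<le>Suc e. monom (poly (p i) s) i) = monom 1 e * P"
        by (simp add: poly_eq_poly_eq_iff[symmetric] fun_eq_iff)
      then have "coeff (\<Sum>i\<le>Suc e. monom (poly (p i) s) i) k = coeff (monom 1 e * P) k" by simp
      moreover have "coeff (monom 1 e * P) k = 0" using k by (simp add: coeff_monom_mult)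
      moreover have "coeff (\<Sum>i\<le>Suc e. monom (poly (p i) s) i) k = (\<Sum>i\<le>Suc e. if i = k then poly (p k) s else 0)"
        unfolding coeff_sum by (intro sum.cong) auto
      ultimately show ?thesis using k by simp
    qed
    then show "p k = 0" using poly_all_0_iff_0 by blast
  qed
  then have "f = (\<Sum>k\<in>{e, Suc e}. indet 3 ^ (Suc e - k) * homog_form k (p k) ?X ?Y)"
    unfolding fp by (intro sum.mono_neutral_right) auto
  then have "f = indet 3 * homog_form e (p e) ?X ?Y + homog_form (Suc e) (p (Suc e)) ?X ?Y"
    by simp
  then show ?thesis using p by (intro exI[of _ "p e"] exI[of _ "p (Suc e)"]) auto
qed

text \<open>Supplies the converse of \<open>multiple_point_form\<close>. In degree
  \<open>Suc e\<close> one surplus factor \<open>X\<close> or \<open>Y\<close> is absorbed as a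
  coefficient.\<close>

lemma homog_form_in_ideal_power:
  assumes "X \<in> J" "Y \<in> J"
  shows "homog_form e p X Y \<in> ideal_power J e" "homog_form (Suc e) p X Y \<in> ideal_power J e"
proof -
  have mono: "X ^ i * Y ^ (e - i) \<in> ideal_power J e" if "i \<le> e" for i
  proof -
    have "(\<Prod>l<e. if l < i then X else Y) = (\<Prod>l\<in>{..<i}. X) * (\<Prod>l\<in>{i..<e}. Y)"
    proof -
      have *: "{..<e} = {..<i} \<union> {i..<e}" using that by auto
      have "(\<Prod>l<e. if l < i then X else Y) =
          (\<Prod>l\<in>{..<i}. if l < i then X else Y) * (\<Prod>l\<in>{i..<e}. if l < i then X else Y)"
        unfolding * by (rule prod.union_disjoint) auto
      then show ?thesis by simp
    qed
    then have "X ^ i * Y ^ (e - i) = (\<Prod>l<e. if l < i then X else Y)" by simp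
    then show ?thesis
      unfolding ideal_power_def using assms
      by (intro poly3_ideal.span_base CollectI exI[of _ "\<lambda>l. if l < i then X else Y"]) simp
  qed
  have sc: "scale_poly c g \<in> ideal_power J e" if "g \<in> ideal_power J e" for c g
    using that unfolding ideal_power_def scale_poly_def by (rule poly3_ideal.span_scale)
  show "homog_form e p X Y \<in> ideal_power J e"
    unfolding homog_form_def ideal_power_def
    by (intro poly3_ideal.span_sum sc[unfolded ideal_power_def] mono[unfolded ideal_power_def]) simp
  show "homog_form (Suc e) p X Y \<in> ideal_power J e"
    unfolding homog_form_def ideal_power_def
  proof (intro poly3_ideal.span_sum)
    fix i assume i: "i \<in> {..Suc e}"
    have "X ^ i * Y ^ (Suc e - i) \<in> ideal_power J e"
    proof (cases "i \<le> e")
      case True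
      then have "Y ^ (Suc e - i) = Y * Y ^ (e - i)" by (simp add: Suc_diff_le)
      then have eq: "X ^ i * Y ^ (Suc e - i) = Y * (X ^ i * Y ^ (e - i))" by (simp only: mult.left_commute)
      show ?thesis
        using mono[OF True] unfolding eq ideal_power_def by (rule poly3_ideal.span_scale)
    next
      case False
      then have "i = Suc e" using i by simp
      then have eq: "X ^ i * Y ^ (Suc e - i) = X * (X ^ e * Y ^ (e - e))" by simp
      show ?thesis
        using mono[OF order_refl] unfolding eq ideal_power_def by (rule poly3_ideal.span_scale)
    qed
    then show "scale_poly (coeff p i) (X ^ i * Y ^ (Suc e - i)) \<in>
        poly3_ideal.span {\<Prod>i<e. g i |g. \<forall>i<e. g i \<in> J}"
      unfolding ideal_power_def[symmetric] by (rule sc)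
  qed
qed

lemma centred_vanish:
  assumes "homog_coords Q (vector [q1, q2, 1])"
  shows "centred1 q1 \<in> vanishing_ideal {Q}" "centred2 q2 \<in> vanishing_ideal {Q}"
  using form_vanishes_at[OF centred_forms(1) assms, of q1] form_vanishes_at[OF centred_forms(2) assms, of q2]
  by (simp_all add: vanishing_ideal_def)

section \<open>Unexpected curves\<close>

lemma subspace_vanishing_ideal: "poly3.subspace (vanishing_ideal Z)"
  unfolding poly3.subspace_def by (auto simp: vanishing_ideal_def vanishes_at_def)

lemma subspace_ideal_power: "poly3.subspace (ideal_power J n)"
  unfolding poly3.subspace_def
proof (intro conjI ballI allI)
  show "0 \<in> ideal_power J n"
    unfolding ideal_power_def by (rule poly3_ideal.span_zero)
  show "f + g \<in> ideal_power J n" if "f \<in> ideal_power J n" "g \<in> ideal_power J n" for f g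
    using that unfolding ideal_power_def by (rule poly3_ideal.span_add)
  show "scale_poly c f \<in> ideal_power J n" if "f \<in> ideal_power J n" for c f
    using that unfolding ideal_power_def scale_poly_def by (rule poly3_ideal.span_scale)
qed

lemma graded_quotient_dim_eq_card:
  assumes "poly3.subspace J" "quotient_basis scale_poly (forms d) J D"
  shows "graded_quotient_dim J d = card D"
proof -
  obtain F where F: "finite F" "forms d \<subseteq> poly3.span F" using forms_finite_span by blast
  show ?thesis
    using poly3.quotient_dim_add[OF subspace_forms assms(1) F]
      poly3.quotient_basis_card[OF subspace_forms assms(1) F assms(2)]
    unfolding graded_quotient_dim_def by linarith
qed

text \<open>By \<open>full\<close>, a basis of the degree \<open>d\<close> part of \<open>V\<close>
  modulo \<open>W\<close> is also a basis of all forms of degree \<open>d\<close> modulo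
  \<open>W\<close>, as in the second isomorphism theorem.\<close>

lemma graded_dim_Int:
  assumes V: "poly3.subspace V" and W: "poly3.subspace W"
    and full: "\<And>f. f \<in> forms d \<Longrightarrow> \<exists>v\<in>V \<inter> forms d. f - v \<in> W"
  shows "graded_quotient_dim W d + graded_dim (V \<inter> W) d = graded_dim V d"
proof -
  obtain F where F: "finite F" "forms d \<subseteq> poly3.span F" using forms_finite_span by blast
  have VS: "poly3.subspace (V \<inter> forms d)"
    using V subspace_forms by (rule poly3.subspace_inter)
  have FV: "V \<inter> forms d \<subseteq> poly3.span F" using F(2) by blast
  obtain D where D: "quotient_basis scale_poly (V \<inter> forms d) W D"
    using poly3.quotient_basis_exists[OF VS W F(1) FV] by blast
  have "quotient_basis scale_poly (forms d) W D"
    unfolding quotient_basis_def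
  proof (intro conjI ballI)
    show "finite D" "D \<subseteq> forms d"
      "\<forall>c. (\<Sum>b\<in>D. scale_poly (c b) b) \<in> W \<longrightarrow> (\<forall>b\<in>D. c b = 0)"
      using D unfolding quotient_basis_def by blast+
    fix f assume "f \<in> forms d"
    then obtain v where v: "v \<in> V \<inter> forms d" "f - v \<in> W" using full by blast
    then obtain c where c: "v - (\<Sum>b\<in>D. scale_poly (c b) b) \<in> W"
      using D unfolding quotient_basis_def by blast
    have "(f - v) + (v - (\<Sum>b\<in>D. scale_poly (c b) b)) \<in> W"
      using v(2) c by (rule poly3.subspace_add[OF W])
    then show "\<exists>c. f - (\<Sum>b\<in>D. scale_poly (c b) b) \<in> W" by auto
  qed
  from graded_quotient_dim_eq_card[OF W this]
  have "graded_quotient_dim W d = card D" .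
  moreover have "card D + poly3.dim (V \<inter> forms d \<inter> W) = poly3.dim (V \<inter> forms d)"
    by (rule poly3.quotient_basis_card[OF VS W F(1) FV D])
  moreover have "V \<inter> forms d \<inter> W = V \<inter> W \<inter> forms d" by blast
  ultimately show ?thesis unfolding graded_dim_def by simp
qed

lemma graded_dim_pos:
  assumes "graded_dim V d > 0"
  shows "\<exists>f\<in>V \<inter> forms d. f \<noteq> 0"
proof (rule ccontr)
  assume "\<not> ?thesis"
  then have "V \<inter> forms d \<subseteq> poly3.span {}" by auto
  then have "poly3.dim (V \<inter> forms d) \<le> card ({} :: poly3 set)"
    by (rule poly3.dim_le_card) simp
  then show False using assms by (simp add: graded_dim_def)
qed

lemma open_affine_chart:
  assumes "zariski_open U" "U \<noteq> {}"
  shows "\<exists>W :: (complex \<times> complex) set. open W \<and> W \<noteq> {} \<and>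
    (\<forall>q\<in>W. \<exists>Q\<in>U. homog_coords Q (vector [fst q, snd q, 1]))"
proof -
  obtain S where S: "S \<subseteq> (\<Union>e. forms e)" "- U = {P. \<forall>f\<in>S. vanishes_at f P}"
    using assms(1) unfolding zariski_open_def zariski_closed_def by blast
  obtain P0 where "P0 \<in> U" using assms(2) by blast
  then have "\<not> (\<forall>f\<in>S. vanishes_at f P0)" using S(2) by blast
  then obtain f v0 where f: "f \<in> S" and v0: "homog_coords P0 v0" "eval_poly f v0 \<noteq> 0"
    unfolding vanishes_at_def by blast
  obtain e where e: "f \<in> forms e" using f S(1) by blast
  define W where "W = {q :: complex \<times> complex. eval_poly f (vector [fst q, snd q, 1]) \<noteq> 0}"
  have "open W"
    unfolding W_def eval_poly_def monom_val_def[symmetric] monom_val_3 vector_3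
    by (intro open_Collect_neq continuous_intros)
  moreover have "W \<noteq> {}"
  proof -
    obtain R where R: "\<forall>t. eval_poly f (v0 + t *s axis 3 1) = poly R t"
      using eval_poly_along_line by blast
    have "poly R 0 \<noteq> 0" using v0(2) R[rule_format, of 0] by simp
    then have "R \<noteq> 0" by auto
    \<comment> \<open>The point \<open>v0\<close> may lie at infinity. The second factor is the last
      coordinate along the chosen direction, so a common nonroot gives a point of the chart where
      \<open>f\<close> does not vanish.\<close>
    then have "R * [:v0 $ 3, 1:] \<noteq> 0" by (simp only: mult_eq_0_iff) simp
    then obtain t where t: "poly (R * [:v0 $ 3, 1:]) t \<noteq> 0"
      using poly_all_0_iff_0 by blast
    define v where "v = v0 + t *s axis 3 1"
    have "poly R t * (v0 $ 3 + t) \<noteq> 0"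
      using t by (simp add: algebra_simps)
    then have "poly R t \<noteq> 0" "v0 $ 3 + t \<noteq> 0" by auto
    then have v3: "v $ 3 \<noteq> 0" and fv: "eval_poly f v \<noteq> 0"
      using R by (auto simp: v_def)
    have "v = v $ 3 *s vector [v $ 1 / v $ 3, v $ 2 / v $ 3, 1]"
      using v3 by (simp add: vec_eq_iff forall_3)
    then have "eval_poly f v = (v $ 3) ^ e * eval_poly f (vector [v $ 1 / v $ 3, v $ 2 / v $ 3, 1])"
      using eval_form_scale[OF e] by metis
    then have "(v $ 1 / v $ 3, v $ 2 / v $ 3) \<in> W" using fv by (auto simp: W_def)
    then show ?thesis by blast
  qed
  moreover have "\<exists>Q\<in>U. homog_coords Q (vector [fst q, snd q, 1])" if q: "q \<in> W" for q
  proof -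
    have "(vector [fst q, snd q, 1] :: complex ^ 3) $ 3 \<noteq> 0 $ 3" by simp
    then have "(vector [fst q, snd q, 1] :: complex ^ 3) \<noteq> 0" by metis
    then obtain Q where Q: "homog_coords Q (vector [fst q, snd q, 1])" using point_exists by blast
    then have "\<not> vanishes_at f Q" using q unfolding W_def vanishes_at_def by blast
    then have "Q \<in> U" using S(2) f by blast
    with Q show ?thesis by blast
  qed
  ultimately show ?thesis by blast
qed

definition coords :: "proj_plane \<Rightarrow> complex ^ 3"
  where "coords P = (SOME v. homog_coords P v)"

lemma coords: "homog_coords P (coords P)"
  unfolding coords_def using coords_exist by (rule someI_ex)

text \<open>If all two by two minors vanish, the vectors are proportional. Signs and order are those
  required by \<open>generic_projection_center\<close>.\<close>

lemma distinct_points_cross: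
  assumes "P \<noteq> Q"
  shows "(coords P $ 1 * coords Q $ 2 - coords Q $ 1 * coords P $ 2,
    coords P $ 3 * coords Q $ 2 - coords Q $ 3 * coords P $ 2,
    coords P $ 1 * coords Q $ 3 - coords Q $ 1 * coords P $ 3) \<noteq> (0, 0, 0)"
proof
  define u v where "u = coords P" and "v = coords Q"
  assume "(coords P $ 1 * coords Q $ 2 - coords Q $ 1 * coords P $ 2,
    coords P $ 3 * coords Q $ 2 - coords Q $ 3 * coords P $ 2,
    coords P $ 1 * coords Q $ 3 - coords Q $ 1 * coords P $ 3) = (0, 0, 0)"
  then have z: "u $ 1 * v $ 2 = v $ 1 * u $ 2" "u $ 3 * v $ 2 = v $ 3 * u $ 2" "u $ 1 * v $ 3 = v $ 1 * u $ 3"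
    by (simp_all add: u_def v_def)
  have uv: "homog_coords P u" "homog_coords Q v" by (simp_all add: u_def v_def coords)
  have "\<forall>i j. u $ i * v $ j = v $ i * u $ j"
    using z by (simp add: forall_3 mult.commute)
  then have m: "u $ i * v $ j = v $ i * u $ j" for i j by blast
  have "u \<noteq> 0" "v \<noteq> 0" using uv coords_nonzero by blast+
  then obtain k where k: "u $ k \<noteq> 0" by (auto simp: vec_eq_iff)
  have v: "v = (v $ k / u $ k) *s u"
    using k m[of k] by (simp add: vec_eq_iff field_simps)
  then have "v $ k / u $ k \<noteq> 0" using \<open>v \<noteq> 0\<close> by (metis vector_smult_lzero)
  then have "homog_coords P v" using coords_scale[OF uv(1)] v by metis
  then show False using coords_unique[OF _ uv(2)] assms by blast
qed

text \<open>If the forms with the given multiplicity at \<open>Q\<close> took all the values on \<open>Z\<close> that forms of degree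
  \<open>j + 1\<close> take, they would together with the forms vanishing on \<open>Z\<close> span all forms, and the
  intersection would have the expected dimension.\<close>

lemma unexpected_at_point:
  fixes Z :: "proj_plane set" and j :: nat
  defines "x \<equiv> \<lambda>P. coords P $ 1" and "y \<equiv> \<lambda>P. coords P $ 2" and "z \<equiv> \<lambda>P. coords P $ 3"
  assumes Z: "finite Z" and Q: "homog_coords Q (vector [fst q, snd q, 1])"
    and dim: "int (graded_dim (vanishing_ideal Z \<inter> ideal_power (vanishing_ideal {Q}) j) (Suc j)) >
      max 0 (int (graded_dim (vanishing_ideal Z) (Suc j)) -
        int (graded_quotient_dim (ideal_power (vanishing_ideal {Q}) j) (Suc j)))"
  shows "on_curve j (\<lambda>i. x i - fst q * z i) (\<lambda>i. y i - snd q * z i) z Z"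
    and "\<exists>c. (\<forall>F\<in>projected_values x y z j q. (\<Sum>i\<in>Z. c i * F i) = 0) \<and>
      (\<exists>k l m. k + l + m = j + 1 \<and> (\<Sum>i\<in>Z. c i * x i ^ k * y i ^ l * z i ^ m) \<noteq> 0)"
proof -
  let ?I = "vanishing_ideal Z" and ?W = "ideal_power (vanishing_ideal {Q}) j"
  have val: "eval_poly (indet 3 * homog_form j a (centred1 (fst q)) (centred2 (snd q)) +
      homog_form (Suc j) b (centred1 (fst q)) (centred2 (snd q))) (coords i) =
      z i * homog j a (x i - fst q * z i) (y i - snd q * z i) +
      homog (Suc j) b (x i - fst q * z i) (y i - snd q * z i)" for a b i
    by (simp add: x_def y_def z_def)
  have "graded_dim (?I \<inter> ?W) (Suc j) > 0" using dim by linarith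
  then obtain f where f: "f \<in> ?I" "f \<in> ?W" "f \<in> forms (Suc j)" "f \<noteq> 0"
    using graded_dim_pos by blast
  obtain a b where ab: "degree a \<le> j" "degree b \<le> Suc j"
    "f = indet 3 * homog_form j a (centred1 (fst q)) (centred2 (snd q)) +
      homog_form (Suc j) b (centred1 (fst q)) (centred2 (snd q))"
    using multiple_point_form[OF f(3,2) Q] by blast
  show "on_curve j (\<lambda>i. x i - fst q * z i) (\<lambda>i. y i - snd q * z i) z Z"
    unfolding on_curve_def
  proof (intro exI conjI ballI)
    show "a \<noteq> 0 \<or> b \<noteq> 0" using f(4) ab(3) by auto
    fix P assume "P \<in> Z"
    then have "eval_poly f (coords P) = 0"
      using f(1) coords unfolding vanishing_ideal_def vanishes_at_def by blast
    then show "z P * homog j a (x P - fst q * z P) (y P - snd q * z P) +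
        homog (Suc j) b (x P - fst q * z P) (y P - snd q * z P) = 0"
      unfolding ab(3) val .
  qed (use ab in auto)
  have "\<exists>h\<in>forms (Suc j). \<forall>v\<in>?I \<inter> forms (Suc j). h - v \<notin> ?W"
  proof (rule ccontr)
    assume "\<not> ?thesis"
    then have "graded_quotient_dim ?W (Suc j) + graded_dim (?I \<inter> ?W) (Suc j) = graded_dim ?I (Suc j)"
      by (intro graded_dim_Int subspace_vanishing_ideal subspace_ideal_power) blast
    then show False using dim by linarith
  qed
  then obtain h where h: "h \<in> forms (Suc j)" "\<forall>v\<in>?I \<inter> forms (Suc j). h - v \<notin> ?W" by blast
  have ls: "linear_space (projected_values x y z j q)"
    unfolding projected_values_def by (rule linear_space_curve_values)
  \<comment> \<open>Agreement with the values of such a form \<open>g\<close> would split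
    \<open>h\<close> into \<open>h - g\<close>, which vanishes on \<open>Z\<close>, and
    \<open>g\<close>, which lies in the ideal power.\<close>
  have differ: "\<forall>F\<in>projected_values x y z j q. \<exists>i\<in>Z. F i \<noteq> eval_poly h (coords i)"
  proof (rule ballI, rule ccontr)
    fix F assume F: "F \<in> projected_values x y z j q"
    assume "\<not> (\<exists>i\<in>Z. F i \<noteq> eval_poly h (coords i))"
    then have eq: "F i = eval_poly h (coords i)" if "i \<in> Z" for i using that by blast
    obtain a b where F: "F = (\<lambda>i. z i * homog j a (x i - fst q * z i) (y i - snd q * z i) +
        homog (Suc j) b (x i - fst q * z i) (y i - snd q * z i))"
      using F unfolding projected_values_def curve_values_def by blast
    define g where "g = indet 3 * homog_form j a (centred1 (fst q)) (centred2 (snd q)) +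
        homog_form (Suc j) b (centred1 (fst q)) (centred2 (snd q))"
    have hf: "homog_form e p (centred1 (fst q)) (centred2 (snd q)) \<in> forms e" for e p
      by (rule homog_form_in_forms[OF centred_forms])
    have gf: "g \<in> forms (Suc j)"
      unfolding g_def using forms_mult[OF indet_form hf, of 3 j a] by (intro forms_add hf) simp
    have gW: "g \<in> ?W"
      unfolding g_def
    proof (rule poly3.subspace_add[OF subspace_ideal_power])
      show "indet 3 * homog_form j a (centred1 (fst q)) (centred2 (snd q)) \<in> ?W"
        using homog_form_in_ideal_power(1)[OF centred_vanish[OF Q], of j a]
        unfolding ideal_power_def by (rule poly3_ideal.span_scale)
      show "homog_form (Suc j) b (centred1 (fst q)) (centred2 (snd q)) \<in> ?W"
        by (rule homog_form_in_ideal_power(2)[OF centred_vanish[OF Q]])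
    qed
    have hg: "h - g \<in> forms (Suc j)"
      using h(1) gf by (rule poly3.subspace_diff[OF subspace_forms])
    have "eval_poly (h - g) (coords i) = 0" if "i \<in> Z" for i
      unfolding eval_poly_minus g_def val using eq[OF that] by (simp add: F)
    then have "vanishes_at (h - g) i" if "i \<in> Z" for i
      using form_vanishes_at[OF hg coords] that by blast
    then have "h - g \<in> ?I" by (simp add: vanishing_ideal_def)
    moreover have "h - (h - g) \<in> ?W" using gW by simp
    ultimately show False using h(2) hg by blast
  qed
  obtain c where c: "\<forall>F\<in>projected_values x y z j q. (\<Sum>i\<in>Z. c i * F i) = 0"
    "(\<Sum>i\<in>Z. c i * eval_poly h (coords i)) \<noteq> 0"
    using separating_functional[OF ls Z differ] by (elim exE conjE) (rule that)
  have "\<exists>k l m. k + l + m = j + 1 \<and> (\<Sum>i\<in>Z. c i * x i ^ k * y i ^ l * z i ^ m) \<noteq> 0"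
  proof (rule ccontr)
    assume none: "\<not> ?thesis"
    have "(\<Sum>i\<in>Z. c i * eval_poly h (coords i)) =
        (\<Sum>n\<in>Poly_Mapping.keys h. Poly_Mapping.lookup h n * (\<Sum>i\<in>Z. c i * monom_val n (coords i)))"
      unfolding eval_poly_def monom_val_def[symmetric] sum_distrib_left
      by (subst sum.swap) (simp add: mult.left_commute)
    also have "\<dots> = 0"
    proof (intro sum.neutral ballI)
      fix n assume "n \<in> Poly_Mapping.keys h"
      then have "Poly_Mapping.lookup n 1 + Poly_Mapping.lookup n 2 + Poly_Mapping.lookup n 3 = j + 1"
        using h(1) by (simp add: forms_def sum_3)
      then have "(\<Sum>i\<in>Z. c i * x i ^ Poly_Mapping.lookup n 1 * y i ^ Poly_Mapping.lookup n 2 *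
          z i ^ Poly_Mapping.lookup n 3) = 0"
        using none by blast
      then show "Poly_Mapping.lookup h n * (\<Sum>i\<in>Z. c i * monom_val n (coords i)) = 0"
        by (simp add: monom_val_3 x_def y_def z_def mult.assoc)
    qed
    finally show False using c(2) by contradiction
  qed
  then show "\<exists>c. (\<forall>F\<in>projected_values x y z j q. (\<Sum>i\<in>Z. c i * F i) = 0) \<and>
      (\<exists>k l m. k + l + m = j + 1 \<and> (\<Sum>i\<in>Z. c i * x i ^ k * y i ^ l * z i ^ m) \<noteq> 0)"
    using c(1) by (intro exI[of _ c] conjI)
qed

text \<open>Forms dual to the points of \<open>Z\<close> are a basis modulo the vanishing ideal,
  since every form differs from its interpolant by a form vanishing on \<open>Z\<close>.\<close>

lemma independent_conditions_if_separated:
  assumes Z: "finite Z"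
    and sep: "separates {\<lambda>P. eval_poly f (coords P) |f. f \<in> forms t} Z"
  shows "imposes_independent_conditions Z t"
proof -
  have "\<forall>P\<in>Z. \<exists>f. f \<in> forms t \<and> eval_poly f (coords P) = 1 \<and> (\<forall>R\<in>Z - {P}. eval_poly f (coords R) = 0)"
    using sep unfolding separates_def by blast
  then obtain f where f: "\<forall>P\<in>Z. f P \<in> forms t \<and> eval_poly (f P) (coords P) = 1 \<and>
      (\<forall>R\<in>Z - {P}. eval_poly (f P) (coords R) = 0)"
    by metis
  have val: "eval_poly (f P) (coords R) = (if P = R then 1 else 0)" if "P \<in> Z" "R \<in> Z" for P R
    using f that by auto
  have inj: "inj_on f Z"
  proof (rule inj_onI, rule ccontr)
    fix P R assume "P \<in> Z" "R \<in> Z" "f P = f R" "P \<noteq> R"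
    then show False using val[of P P] val[of R P] by simp
  qed
  have comb: "eval_poly (\<Sum>b\<in>f ` Z. scale_poly (c b) b) (coords R) = c (f R)" if "R \<in> Z" for c R
  proof -
    have "eval_poly (\<Sum>b\<in>f ` Z. scale_poly (c b) b) (coords R) =
        (\<Sum>P\<in>Z. c (f P) * eval_poly (f P) (coords R))"
      by (simp add: eval_poly_sum sum.reindex[OF inj])
    also have "\<dots> = (\<Sum>P\<in>Z. if P = R then c (f R) else 0)"
      using val that by (intro sum.cong) auto
    finally show ?thesis using Z that by simp
  qed
  have "quotient_basis scale_poly (forms t) (vanishing_ideal Z) (f ` Z)"
    unfolding quotient_basis_def
  proof (intro conjI allI impI ballI)
    show "finite (f ` Z)" using Z by simp
    show "f ` Z \<subseteq> forms t" using f by blast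
    show "c b = 0" if zero: "(\<Sum>b\<in>f ` Z. scale_poly (c b) b) \<in> vanishing_ideal Z" and b: "b \<in> f ` Z" for c b
    proof -
      obtain R where R: "R \<in> Z" "b = f R" using b by blast
      then have "eval_poly (\<Sum>b\<in>f ` Z. scale_poly (c b) b) (coords R) = 0"
        using zero coords unfolding vanishing_ideal_def vanishes_at_def by blast
      then show ?thesis unfolding comb[OF R(1)] by (simp only: R(2))
    qed
    fix g assume g: "g \<in> forms t"
    define c where "c b = eval_poly g (coords (inv_into Z f b))" for b
    define s where "s = (\<Sum>b\<in>f ` Z. scale_poly (c b) b)"
    have "s \<in> forms t"
      unfolding s_def using f by (intro poly3.subspace_sum[OF subspace_forms] forms_scale) blast
    then have gs: "g - s \<in> forms t" by (rule poly3.subspace_diff[OF subspace_forms g])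
    have "eval_poly (g - s) (coords R) = 0" if "R \<in> Z" for R
      unfolding eval_poly_minus s_def comb[OF that] by (simp add: c_def inv_into_f_f[OF inj that])
    then have "vanishes_at (g - s) R" if "R \<in> Z" for R
      using form_vanishes_at[OF gs coords] that by blast
    then have "g - s \<in> vanishing_ideal Z" by (simp add: vanishing_ideal_def)
    then show "\<exists>c. g - (\<Sum>b\<in>f ` Z. scale_poly (c b) b) \<in> vanishing_ideal Z"
      unfolding s_def by blast
  qed
  from graded_quotient_dim_eq_card[OF subspace_vanishing_ideal this]
  show ?thesis unfolding imposes_independent_conditions_def by (simp add: card_image[OF inj])
qed

lemma linear_space_form_values: "linear_space {\<lambda>P. eval_poly f (coords P) |f. f \<in> forms t}"
  unfolding linear_space_def
proof (intro conjI ballI allI)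
  show "(\<lambda>P. 0) \<in> {\<lambda>P. eval_poly f (coords P) |f. f \<in> forms t}"
    by (intro CollectI exI[of _ 0]) simp
  fix F G and a b :: complex
  assume "F \<in> {\<lambda>P. eval_poly f (coords P) |f. f \<in> forms t}" "G \<in> {\<lambda>P. eval_poly f (coords P) |f. f \<in> forms t}"
  then obtain f g where fg: "F = (\<lambda>P. eval_poly f (coords P))" "f \<in> forms t"
    "G = (\<lambda>P. eval_poly g (coords P))" "g \<in> forms t" by blast
  have "(\<lambda>P. a * F P + b * G P) = (\<lambda>P. eval_poly (scale_poly a f + scale_poly b g) (coords P))"
    by (simp add: fg)
  moreover have "scale_poly a f + scale_poly b g \<in> forms t"
    using fg by (intro forms_add forms_scale)
  ultimately show "(\<lambda>P. a * F P + b * G P) \<in> {\<lambda>P. eval_poly f (coords P) |f. f \<in> forms t}"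
    by (intro CollectI exI conjI)
qed

theorem theorem8p5:
  fixes Z :: "proj_plane set" and d :: nat
  assumes "finite Z"
    and "has_unexpected_curve Z d"
  shows "regularity Z \<le> d \<and> imposes_independent_conditions Z (d - 1)"
proof -
  let ?J = "\<lambda>Q. ideal_power (vanishing_ideal {Q}) (d - 1)"
  obtain U where U: "zariski_open U" "U \<noteq> {}" and dim: "\<forall>Q\<in>U.
      int (graded_dim (vanishing_ideal Z \<inter> ?J Q) d) >
      max 0 (int (graded_dim (vanishing_ideal Z) d) - int (graded_quotient_dim (?J Q) d))"
    using assms(2) unfolding has_unexpected_curve_def for_general_point_def by blast
  \<comment> \<open>For \<open>d = 0\<close> the ideal power is the whole ring and the intersection
    has the expected dimension. From here on \<open>d - 1\<close> is an honest difference.\<close>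
  have "d \<noteq> 0"
  proof
    assume d: "d = 0"
    obtain Q where Q: "Q \<in> U" using U(2) by blast
    have "1 \<in> ?J Q"
      unfolding ideal_power_def d by (intro poly3_ideal.span_base) simp
    then have "f * 1 \<in> ?J Q" for f
      unfolding ideal_power_def by (rule poly3_ideal.span_scale)
    then have "f \<in> ?J Q" for f by simp
    then have "graded_quotient_dim (?J Q) d + graded_dim (vanishing_ideal Z \<inter> ?J Q) d = graded_dim (vanishing_ideal Z) d"
      by (intro graded_dim_Int subspace_vanishing_ideal subspace_ideal_power bexI[of _ 0])
        (simp_all add: poly3.subspace_0[OF subspace_vanishing_ideal])
    then show False using dim[rule_format, OF Q] by linarith
  qed
  then obtain j where d: "d = Suc j" by (cases d) auto
  define x where "x = (\<lambda>P. coords P $ 1)"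
  define y where "y = (\<lambda>P. coords P $ 2)"
  define z where "z = (\<lambda>P. coords P $ 3)"
  obtain W :: "(complex \<times> complex) set" where W: "open W" "W \<noteq> {}"
    "\<forall>q\<in>W. \<exists>Q\<in>U. homog_coords Q (vector [fst q, snd q, 1])"
    using open_affine_chart[OF U] by blast
  have sep: "separates {\<lambda>P. eval_poly f (coords P) |f. f \<in> forms j} Z"
  proof (rule ccontr)
    let ?V = "{\<lambda>P. eval_poly f (coords P) |f. f \<in> forms j}"
    assume "\<not> separates ?V Z"
    then have "\<exists>P\<in>Z. \<not> (\<exists>F\<in>?V. F P = 1 \<and> (\<forall>i\<in>Z - {P}. F i = 0))"
      unfolding separates_def by (simp only: ball_simps)
    then obtain P where P: "P \<in> Z" "\<not> (\<exists>F\<in>?V. F P = 1 \<and> (\<forall>i\<in>Z - {P}. F i = 0))"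
      by (rule bexE)
    \<comment> \<open>The indicator of \<open>P\<close> is not a value vector of forms of degree
      \<open>j\<close>; the functional detecting this is a relation with nonzero coefficient at
      \<open>P\<close>.\<close>
    have differ: "\<forall>F\<in>?V. \<exists>i\<in>Z. F i \<noteq> (if i = P then 1 else 0)"
    proof (rule ballI, rule ccontr)
      fix F assume F: "F \<in> ?V"
      assume "\<not> (\<exists>i\<in>Z. F i \<noteq> (if i = P then 1 else 0))"
      then have "F i = (if i = P then 1 else 0)" if "i \<in> Z" for i using that by blast
      then have "F P = 1 \<and> (\<forall>i\<in>Z - {P}. F i = 0)" using P(1) by auto
      then have "\<exists>F\<in>?V. F P = 1 \<and> (\<forall>i\<in>Z - {P}. F i = 0)" using F by (rule bexI)
      then show False using P(2) by contradiction
    qed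
    obtain c where c: "\<forall>F\<in>?V. (\<Sum>i\<in>Z. c i * F i) = 0"
      "(\<Sum>i\<in>Z. c i * (if i = P then 1 else 0)) \<noteq> 0"
      using separating_functional[OF linear_space_form_values assms(1) differ] by (elim exE conjE) (rule that)
    have "c P = 0"
    proof (rule no_relation_of_general_position[OF assms(1) W(1,2)])
      show "\<forall>i\<in>Z. (x i, y i, z i) \<noteq> (0, 0, 0)"
      proof
        fix i
        have "coords i \<noteq> 0" using coords coords_nonzero by blast
        then show "(x i, y i, z i) \<noteq> (0, 0, 0)"
          by (auto simp: x_def y_def z_def vec_eq_iff forall_3)
      qed
      show "\<forall>i\<in>Z. \<forall>k\<in>Z. i \<noteq> k \<longrightarrow>
          (x i * y k - x k * y i, z i * y k - z k * y i, x i * z k - x k * z i) \<noteq> (0, 0, 0)"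
        unfolding x_def y_def z_def using distinct_points_cross by blast
      fix q assume q: "q \<in> W"
      then obtain Q where Q: "Q \<in> U" "homog_coords Q (vector [fst q, snd q, 1])" using W(3) by blast
      have D: "int (graded_dim (vanishing_ideal Z \<inter> ideal_power (vanishing_ideal {Q}) j) (Suc j)) >
        max 0 (int (graded_dim (vanishing_ideal Z) (Suc j)) -
          int (graded_quotient_dim (ideal_power (vanishing_ideal {Q}) j) (Suc j)))"
        using bspec[OF dim Q(1)] unfolding d by simp
      show "on_curve j (\<lambda>i. x i - fst q * z i) (\<lambda>i. y i - snd q * z i) z Z"
        unfolding x_def y_def z_def by (rule unexpected_at_point(1)[OF assms(1) Q(2) D])
      show "\<exists>c. (\<forall>F\<in>projected_values x y z j q. (\<Sum>i\<in>Z. c i * F i) = 0) \<and>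
          (\<exists>k l m. k + l + m = j + 1 \<and> (\<Sum>i\<in>Z. c i * x i ^ k * y i ^ l * z i ^ m) \<noteq> 0)"
        unfolding x_def y_def z_def by (rule unexpected_at_point(2)[OF assms(1) Q(2) D])
    next
      \<comment> \<open>A monomial in the projected and sheared coordinates is itself a form of
        degree \<open>j\<close>, hence killed by \<open>c\<close>.\<close>
      fix q1 q2 l :: complex and k m :: nat assume km: "k + m \<le> j"
      define f where "f = centred1 q1 ^ k * (centred2 q2 - scale_poly l (centred1 q1)) ^ (j - k - m) * indet 3 ^ m"
      have "centred2 q2 - scale_poly l (centred1 q1) \<in> forms 1"
        by (rule poly3.subspace_diff[OF subspace_forms centred_forms(2) forms_scale[OF centred_forms(1)]])
      then have "f \<in> forms (k * 1 + (j - k - m) * 1 + m * 1)"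
        unfolding f_def by (intro forms_mult forms_power centred_forms indet_form)
      then have "f \<in> forms j" using km by simp
      then have "(\<lambda>P. eval_poly f (coords P)) \<in> ?V" by blast
      from bspec[OF c(1) this] show "(\<Sum>i\<in>Z. c i * (x i - q1 * z i) ^ k *
          (y i - q2 * z i - l * (x i - q1 * z i)) ^ (j - k - m) * z i ^ m) = 0"
        unfolding f_def eval_poly_mult eval_poly_power eval_poly_minus eval_poly_scale eval_indet
          x_def y_def z_def mult.assoc .
    qed (rule P(1))
    then have "(\<Sum>i\<in>Z. c i * (if i = P then 1 else 0)) = 0"
      by (intro sum.neutral) auto
    then show False using c(2) by contradiction
  qed
  have ind: "imposes_independent_conditions Z (d - 1)"
    using independent_conditions_if_separated[OF assms(1) sep] by (simp add: d)
  then have "(LEAST r. graded_quotient_dim (vanishing_ideal Z) r = card Z) \<le> d - 1"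
    unfolding imposes_independent_conditions_def by (rule Least_le)
  then have "regularity Z \<le> d" using d by (simp add: regularity_def)
  then show ?thesis using ind ..
qed

end
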